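(* Let $k\geq 3$. There are constants $c_k>0$ and $C_k>0$ such that for all positive integers $n$, \[c_k\cdot\frac{((k-2)^2+1)^n}{n^{(k^2-4k+3)/2}}\;\leq\;|\operatorname{Av}_n(A_{k,k})|\;\leq\;C_k\cdot\frac{((k-2)^2+1)^n}{n^{(k^2-4k+3)/2}}.\]
   Context: A permutation $p=p_1\cdots p_n$ contains a pattern $q=q_1\cdots q_k$ if there are indices $i_1<\cdots<i_k$ with $p_{i_r}<p_{i_s}$ iff $q_r<q_s$; otherwise $p$ avoids $q$. $\operatorname{Av}_n(S)$ is the set of permutations of length $n$ avoiding every pattern in the set $S$. $A_{k,k}$ is the set of the $k-1$ permutations of length $k$ whose first $k-1$ entries are increasing and whose last entry is less than $k$ (i.e. the patterns $1\,2\cdots(j-1)(j+1)\cdots k\,j$ for $1\leq j\leq k-1$); e.g. $A_{5,5}=\{12354,12453,13452,23451\}$. *)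

theory Defs
  imports "HOL-Analysis.Analysis" "HOL-Combinatorics.Multiset_Permutations"
begin

text \<open>A permutation of length \<open>n\<close> is a list in \<open>permutations_of_set {1..n}\<close> (one-line notation).
  The \<open>r\<close>-th entry of the list \<open>p\<close>, counted from 0, is \<open>p ! r\<close>.\<close>

definition contains_pattern :: "nat list \<Rightarrow> nat list \<Rightarrow> bool" where
  "contains_pattern p q \<longleftrightarrow>
     (\<exists>i :: nat \<Rightarrow> nat.
        strict_mono_on {..<length q} i \<and>
        (\<forall>r<length q. i r < length p) \<and>
        (\<forall>r<length q. \<forall>s<length q. p ! i r < p ! i s \<longleftrightarrow> q ! r < q ! s))"

definition avoids_pattern :: "nat list \<Rightarrow> nat list \<Rightarrow> bool" where
  "avoids_pattern p q \<longleftrightarrow> \<not> contains_pattern p q"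

definition Av :: "nat \<Rightarrow> nat list set \<Rightarrow> nat list set" where
  "Av n S = {p \<in> permutations_of_set {1..n}. \<forall>q\<in>S. avoids_pattern p q}"

text \<open>The set \<open>A\<^bsub>k,k\<^esub>\<close>.\<close>

definition A_diag :: "nat \<Rightarrow> nat list set" where
  "A_diag k = {q \<in> permutations_of_set {1..k}. sorted_wrt (<) (butlast q) \<and> last q < k}"

lemma A_diag_eq:
  "A_diag k = (\<lambda>j. [1..<j] @ [Suc j..<Suc k] @ [j]) ` {1..<k}"
proof (intro equalityI subsetI)
  fix q assume "q \<in> A_diag k"
  then have q: "set q = {1..k}" "distinct q" "sorted_wrt (<) (butlast q)" "last q < k"
    by (auto simp: A_diag_def permutations_of_set_def)
  have "k > 0" using q(4) by simp
  then have ne: "q \<noteq> []" using q(1) by force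
  define b j where "b = butlast q" and "j = last q"
  have qb: "q = b @ [j]" using ne by (simp add: b_def j_def)
  have "j \<in> {1..k}" unfolding q(1)[symmetric] qb by simp
  then have j: "j \<in> {1..<k}" using q(4) by (simp add: j_def)
  have sb: "set b = {1..k} - {j}" unfolding q(1)[symmetric] using q(2) unfolding qb by simp
  have "b = [1..<j] @ [Suc j..<Suc k]"
  proof (rule sorted_distinct_set_unique)
    show "sorted b" using q(3) by (simp add: b_def strict_sorted_iff)
    show "distinct b" using q(2) qb by simp
    show "sorted ([1..<j] @ [Suc j..<Suc k])" by (auto simp: sorted_append)
    show "distinct ([1..<j] @ [Suc j..<Suc k])" by auto
    show "set b = set ([1..<j] @ [Suc j..<Suc k])" using j unfolding sb by auto
  qed
  with qb j show "q \<in> (\<lambda>j. [1..<j] @ [Suc j..<Suc k] @ [j]) ` {1..<k}" by auto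
next
  fix q assume "q \<in> (\<lambda>j. [1..<j] @ [Suc j..<Suc k] @ [j]) ` {1..<k}"
  then obtain j where j: "j \<in> {1..<k}" and q: "q = ([1..<j] @ [Suc j..<Suc k]) @ [j]"
    by auto
  have "butlast q = [1..<j] @ [Suc j..<Suc k]" "last q = j"
    unfolding q by (rule butlast_snoc, rule last_snoc)
  then have "sorted_wrt (<) (butlast q)" "last q < k"
    using j by (auto simp: sorted_wrt_append)
  moreover have "set q = {1..k}" "distinct q" using j unfolding q by auto
  ultimately show "q \<in> A_diag k"
    by (auto simp: A_diag_def permutations_of_set_def)
qed

end

theory Submission
  imports Defs "HOL-Library.Sublist"
begin

text \<open>
  Let \<open>d = k - 2\<close>. A permutation avoids \<open>A\<^bsub>k,k\<^esub>\<close> iff every entry at which an increasing subsequence of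
  length \<open>d + 1\<close> ends is smaller than all later entries. Such a permutation is a prefix
  without increasing subsequence of length \<open>d + 1\<close>, followed by the remaining values in increasing
  order; conversely each such prefix over \<open>{2..n}\<close> gives an avoiding permutation, in which the entry 1
  marks the end of the prefix. So \<open>|Av\<^sub>n|\<close> lies between \<open>B\<^bsub>n-1\<^esub>\<close> and \<open>B\<^sub>n\<close>, where \<open>B\<^sub>n\<close> counts the
  sequences of distinct elements of an \<open>n\<close>-set without increasing subsequence of length \<open>d + 1\<close>.

  By the Robinson--Schensted correspondence, in the form of Fomin's growth diagrams, \<open>B\<^sub>n\<close> is the sum of
  \<open>(n choose i) * V\<^sub>i\<close>, where \<open>V\<^sub>i\<close> is the sum of the squared numbers of standard tableaux with \<open>i\<close> boxes
  and at most \<open>d\<close> columns. The product formula for these numbers shows that \<open>V\<^sub>i\<close> is of the order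
  \<open>d\<^bsup>2i\<^esup> / i\<^bsup>(d\<^sup>2 - 1)/2\<^esup>\<close>: the factorials form a multinomial coefficient, which is bounded by Stirling's
  estimate, and the squared Vandermonde product is controlled by multinomial moments. Averaging over
  the binomial coefficients replaces \<open>d\<^sup>2\<close> by \<open>d\<^sup>2 + 1\<close> and keeps the exponent.
\<close>

subsection \<open>Growth diagrams on particle configurations\<close>

text \<open>Growth diagrams replace insertion because they are local: a row of cells can be read in
  either direction, so the correspondence follows from the fact that each cell rule is deterministic
  and reversible. Sequences that omit values need no standardization, since a walk along a row just
  stands still at an omitted value; this is the source of the binomial coefficient.

  Origin of the exponent: let \<open>p = d * (d - 1) / 2\<close> be the number of pairs of particles
  and \<open>M = i + p\<close> the sum of the particles. A squared tableau count is the square of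
  \<open>fact i\<close> times a Vandermonde product over a product of factorials. Replacing
  \<open>fact i\<close> by \<open>fact M\<close> costs M^(-p), squared M^(-2p). Typical differences
  of particles have size sqrt M, so the squared Vandermonde product contributes M^p. Of the two
  multinomial coefficients one is a summation weight with total d^M, the other is bounded by d^M *
  M^(-(d-1)/2). In total M has exponent -(p + (d-1)/2) = -(d^2-1)/2, which for d = k - 2 is
  -(k^2-4k+3)/2. For the lower bound it suffices to exhibit about M^((d-1)/2) shapes whose
  differences are all of order sqrt M.\<close>

text \<open>A partition with at most \<open>d\<close> columns of heights \<open>h\<^sub>0 \<ge> \<dots> \<ge> h\<^bsub>d-1\<^esub>\<close> is encoded by the
  \<open>d\<close>-element set of the numbers \<open>h\<^sub>c + d - 1 - c\<close>, so the empty partition is \<open>{..<d}\<close> and adding a box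
  to a column moves one element of the set up by one.\<close>

definition mv :: "nat \<Rightarrow> nat set \<Rightarrow> nat set" where
  "mv a A = insert (Suc a) (A - {a})"

definition movable :: "nat \<Rightarrow> nat set \<Rightarrow> bool" where
  "movable a A \<longleftrightarrow> a \<in> A \<and> Suc a \<notin> A"

definition cov :: "nat set \<Rightarrow> nat set \<Rightarrow> bool" where
  "cov A B \<longleftrightarrow> (\<exists>a. movable a A \<and> B = mv a A)"

definition run :: "nat set \<Rightarrow> nat \<Rightarrow> nat \<Rightarrow> bool" where
  "run A a e \<longleftrightarrow> a \<le> e \<and> {a..e} \<subseteq> A \<and> Suc e \<notin> A \<and> (\<forall>c. a = Suc c \<longrightarrow> c \<notin> A)"

text \<open>Fomin's local rules: \<open>A\<close>, \<open>B\<close>, \<open>C\<close>, \<open>D\<close> are the shapes at the south-west, south-east,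
  north-west and north-east corner of a unit cell, and the flag says whether the cell contains a
  point. A box added at the left end of a block of columns of equal height corresponds to an element at
  the upper end of a maximal run of the set, and a box removed at the right end of such a block to
  its lower end. Hence bumping maps the lower end of a run to its upper end, and a point acts as if a
  particle had entered at \<open>-1\<close>.\<close>

inductive cell :: "nat set \<Rightarrow> nat set \<Rightarrow> nat set \<Rightarrow> nat set \<Rightarrow> bool \<Rightarrow> bool" where
  vert: "B = A \<or> cov A B \<Longrightarrow> cell A A B B False"
| horiz: "B = A \<or> cov A B \<Longrightarrow> cell A B A B False"
| diamond: "a \<noteq> b \<Longrightarrow> movable a A \<Longrightarrow> movable b A \<Longrightarrow>
    cell A (mv a A) (mv b A) (mv a (mv b A)) False"
| bump: "movable a A \<Longrightarrow> run (mv a A) (Suc a) e \<Longrightarrow>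
    cell A (mv a A) (mv a A) (mv e (mv a A)) False"
| new: "run A 0 e \<Longrightarrow> cell A A A (mv e A) True"

section \<open>Elementary moves and maximal runs\<close>

lemma movable_diff: "movable a A \<Longrightarrow> A - mv a A = {a}"
  by (auto simp: movable_def mv_def)

lemma mv_inj_left: "movable a A \<Longrightarrow> movable b A \<Longrightarrow> mv a A = mv b A \<Longrightarrow> a = b"
  by (metis movable_diff singleton_inject)

lemma mv_undo: "movable a A \<Longrightarrow> A = insert a (mv a A - {Suc a})"
  by (auto simp: movable_def mv_def)

lemma mv_inj_right: "movable a A \<Longrightarrow> movable a B \<Longrightarrow> mv a A = mv a B \<Longrightarrow> A = B"
  by (metis mv_undo)

lemma mv_neq: "movable a A \<Longrightarrow> mv a A \<noteq> A"
  by (auto simp: movable_def mv_def)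

lemma not_cov_refl: "\<not> cov A A"
  unfolding cov_def using mv_neq by metis

lemma movable_comm:
  assumes "a \<noteq> b" "movable a A" "movable b A"
  shows "movable a (mv b A)" "mv a (mv b A) = mv b (mv a A)"
  using assms by (auto simp: movable_def mv_def)

lemma finite_mv [simp]: "finite (mv a A) \<longleftrightarrow> finite A"
  by (auto simp: mv_def)

lemma run_movable: "run A a e \<Longrightarrow> movable e A"
  by (auto simp: run_def movable_def)

lemma run_start_unique:
  assumes "run A a e" "run A b e" shows "a = b"
proof (rule ccontr)
  assume "a \<noteq> b"
  moreover have False if r: "run A a e" "run A b e" and "a < b" for a b
  proof -
    obtain c where "b = Suc c" using \<open>a < b\<close> by (cases b) auto
    then have "c \<in> {a..e}" "c \<notin> A" using r \<open>a < b\<close> by (auto simp: run_def)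
    then show False using r(1) by (auto simp: run_def)
  qed
  ultimately show False using assms by (meson linorder_neqE_nat)
qed

lemma run_end_unique:
  assumes "run A a e" "run A a f" shows "e = f"
proof (rule ccontr)
  assume "e \<noteq> f"
  moreover have False if "run A a e" "run A a f" "e < f" for e f
    using that by (auto simp: run_def subset_iff)
  ultimately show False using assms by (meson linorder_neqE_nat)
qed

lemma run_end_ex:
  assumes "finite A" "a \<in> A" "\<And>c. a = Suc c \<Longrightarrow> c \<notin> A"
  shows "\<exists>e. run A a e"
proof -
  have "\<exists>e. a \<le> e \<and> Suc e \<notin> A"
  proof -
    obtain m where m: "\<forall>x\<in>A. x \<le> m" using assms(1) finite_nat_set_iff_bounded_le by auto
    then have "a \<le> m \<and> Suc m \<notin> A" using assms(2) by (auto dest: bspec[of _ _ "Suc m"])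
    then show ?thesis by blast
  qed
  define e where "e = (LEAST e. a \<le> e \<and> Suc e \<notin> A)"
  have e: "a \<le> e" "Suc e \<notin> A"
    using LeastI_ex[OF \<open>\<exists>e. a \<le> e \<and> Suc e \<notin> A\<close>] by (auto simp: e_def)
  have "x \<in> A" if "a \<le> x" "x \<le> e" for x
  proof (cases "x = a")
    case False
    then have y: "x = Suc (x - 1)" "a \<le> x - 1" "x - 1 < e" using that by auto
    then show ?thesis using not_less_Least[of "x - 1" "\<lambda>e. a \<le> e \<and> Suc e \<notin> A"] by (auto simp: e_def)
  qed (use assms in auto)
  then show ?thesis using e assms by (auto simp: run_def)
qed

lemma run_start_ex:
  assumes "e \<in> A" "Suc e \<notin> A"
  shows "\<exists>a. run A a e"
proof -
  define a where "a = (LEAST a. {a..e} \<subseteq> A)"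
  have "{e..e} \<subseteq> A" using assms by auto
  then have a: "{a..e} \<subseteq> A" "a \<le> e"
    unfolding a_def by (rule LeastI, rule Least_le)
  have "c \<notin> A" if "a = Suc c" for c
  proof
    assume "c \<in> A"
    have "{c..e} = insert c {Suc c..e}" using that a(2) by auto
    with \<open>c \<in> A\<close> a(1) that have "{c..e} \<subseteq> A" by simp
    then have "a \<le> c" unfolding a_def by (rule Least_le)
    then show False using that by simp
  qed
  then show ?thesis using a assms by (auto simp: run_def)
qed

section \<open>The local rules: determinism in both directions\<close>

lemma cell_edges:
  assumes "cell A B C D x"
  shows "B = A \<or> cov A B" "C = A \<or> cov A C" "D = B \<or> cov B D" "D = C \<or> cov C D"
  using assms
  by (induction rule: cell.induct)
    (auto simp: cov_def dest: run_movable movable_comm movable_comm(1)[OF not_sym])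

lemma cell_forward_ex:
  assumes "finite A" "B = A \<or> cov A B" "C = A \<or> cov A C"
  shows "\<exists>D. cell A B C D False"
proof -
  consider "B = A" | "C = A" | a b where "movable a A" "movable b A" "B = mv a A" "C = mv b A"
    using assms by (auto simp: cov_def)
  then show ?thesis
  proof cases
    case 3
    show ?thesis
    proof (cases "a = b")
      case True
      have "\<exists>e. run (mv a A) (Suc a) e"
        by (rule run_end_ex) (use assms 3 in \<open>auto simp: mv_def\<close>)
      then show ?thesis using 3 True cell.bump by blast
    qed (use 3 cell.diamond in blast)
  qed (use assms cell.vert cell.horiz in blast)+
qed

lemma cell_forward_ex_new:
  assumes "finite A" "0 \<in> A"
  shows "\<exists>D. cell A A A D True"
  using run_end_ex[OF assms] cell.new by blast

lemma cell_forward_unique: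
  assumes "cell A B C D x" "cell A B C D' x"
  shows "D = D'"
  using assms(1)
proof (cases rule: cell.cases)
  case vert
  from assms(2) show ?thesis by (cases rule: cell.cases) (use vert in \<open>auto dest: mv_neq\<close>)
next
  case horiz
  from assms(2) show ?thesis by (cases rule: cell.cases) (use horiz in \<open>auto dest: mv_neq\<close>)
next
  case (diamond a b)
  from assms(2) show ?thesis
    by (cases rule: cell.cases) (use diamond in \<open>auto dest: mv_neq mv_inj_left\<close>)
next
  case (bump a e)
  from assms(2) show ?thesis
    by (cases rule: cell.cases)
      (use bump in \<open>auto dest: mv_neq mv_inj_left run_end_unique\<close>)
next
  case (new e)
  from assms(2) show ?thesis
    by (cases rule: cell.cases) (use new in \<open>auto dest: run_end_unique\<close>)
qed

text \<open>The delicate case is \<open>B = C\<close> with \<open>D\<close> above it. The particle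
  that moves from \<open>B\<close> to \<open>D\<close> stands at the upper end of a run of
  \<open>B\<close>, and the lower end of this run decides: if it is 0, the cell contains a point; if
  it is \<open>Suc c\<close>, moving that particle back to \<open>c\<close> gives
  \<open>A\<close>.\<close>

lemma cell_backward_ex:
  assumes "finite D" "D = B \<or> cov B D" "D = C \<or> cov C D"
  shows "\<exists>A x. cell A B C D x"
proof -
  consider "B = D" | "C = D" | a b where "movable a C" "movable b B" "D = mv a C" "D = mv b B"
    using assms by (auto simp: cov_def)
  then show ?thesis
  proof cases
    case 1
    then show ?thesis using assms(3) cell.horiz by metis
  next
    case 2
    then show ?thesis using assms(2) cell.vert by metis
  next
    case 3
    show ?thesis
    proof (cases "a = b")
      case True
      then have BC: "B = C" using 3 mv_inj_right by blast
      obtain s where s: "run B s b" using run_start_ex[of b B] 3(2) by (auto simp: movable_def)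
      show ?thesis
      proof (cases s)
        case 0
        then show ?thesis using s BC 3(4) cell.new by metis
      next
        case (Suc c)
        define A where "A = insert c (B - {Suc c})"
        have "c \<notin> B" "Suc c \<in> B" using s Suc by (auto simp: run_def)
        then have "movable c A" "B = mv c A" by (auto simp: A_def movable_def mv_def)
        then show ?thesis using s BC 3(4) Suc cell.bump[of c A b] by metis
      qed
    next
      case False
      define A where "A = insert b (C - {Suc b})"
      have "Suc a \<in> D" "a \<notin> D" using 3(3) by (simp_all add: mv_def)
      moreover have "Suc b \<in> D" "b \<notin> D" using 3(4) by (simp_all add: mv_def)
      ultimately have D: "Suc a \<in> D" "b \<notin> D" "Suc b \<in> D" "a \<notin> D" by simp_all
      \<comment> \<open>\<open>D\<close> contains both targets and neither source, so no move ends
        where the other starts and the two moves can be undone independently.\<close>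
      then have nb: "Suc a \<noteq> b" "Suc b \<noteq> a" by auto
      have b: "Suc b \<in> C" "b \<notin> C" using D False 3(3) by (auto simp: mv_def)
      have mA: "movable b A" "C = mv b A" using b by (auto simp: A_def movable_def mv_def)
      have "B = insert b (mv a C - {Suc b})" using mv_undo[OF 3(2)] 3(3,4) by simp
      also have "\<dots> = mv a A" using nb False
        by (auto simp: A_def mv_def)
      finally have "B = mv a A" .
      moreover have "movable a A" using 3(1) False nb
        by (auto simp: A_def movable_def)
      ultimately show ?thesis using cell.diamond[OF False _ mA(1)] mA(2) 3(3) by metis
    qed
  qed
qed

lemma cell_right_edge_trivial:
  assumes "cell A B C B x" shows "A = C \<and> \<not> x"
  using assms
proof (cases rule: cell.cases)
  case (diamond a b)
  have "movable a (mv b A)" using movable_comm(1) diamond by simp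
  then have "A = mv b A" using mv_inj_right[of a A "mv b A"] diamond by simp
  then show ?thesis using mv_neq diamond by simp
qed (auto dest: mv_neq run_movable)

lemma cell_top_edge_trivial:
  assumes "cell A B C C x" shows "A = B \<and> \<not> x"
  using assms
proof (cases rule: cell.cases)
  case (diamond a b)
  have "movable a (mv b A)" using movable_comm(1) diamond by simp
  from mv_neq[OF this] show ?thesis using diamond by simp
qed (auto dest: mv_neq run_movable)

text \<open>The three rules with \<open>D\<close> above both \<open>B\<close> and \<open>C\<close>,
  rephrased as moves out of \<open>B\<close> and \<open>C\<close>, so that they can be compared when
  only \<open>B\<close>, \<open>C\<close> and \<open>D\<close> are known.\<close>

lemma cell_proper_cases [consumes 3, case_names diamond bump new]:
  assumes "cell A B C D x" "D \<noteq> B" "D \<noteq> C"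
  obtains a b where "\<not> x" "B \<noteq> C" "movable a A" "movable b A" "movable a C" "movable b B"
      "B = mv a A" "C = mv b A" "D = mv a C" "D = mv b B"
  | a e where "\<not> x" "B = C" "movable a A" "run B (Suc a) e" "B = mv a A" "D = mv e B"
  | e where x "A = B" "B = C" "run B 0 e" "D = mv e B"
  using assms(1)
proof (cases rule: cell.cases)
  case (diamond a b)
  show ?thesis
  proof (rule that(1)[of a b])
    show "B \<noteq> C" unfolding diamond(1,2) using mv_inj_left diamond(5-7) by blast
    show "movable a C" "movable b B" unfolding diamond(1,2)
      using movable_comm(1) diamond(5-7) by auto
    show "D = mv a C" unfolding diamond(2,3) ..
    show "D = mv b B" unfolding diamond(1,3) using movable_comm(2) diamond(5-7) by simp
  qed (simp only: diamond(4) not_False_eq_True, (fact diamond)+)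
next
  case vert
  then show ?thesis using assms(3) by simp
next
  case horiz
  then show ?thesis using assms(2) by simp
next
  case (bump a e)
  then show ?thesis using that(2)[of a e] by simp
next
  case (new e)
  then show ?thesis using that(3)[of e] by simp
qed

text \<open>The moved particle is read off from \<open>B\<close> and \<open>D\<close>. If
  \<open>B = C\<close>, the unique lower end of its run separates a bump (\<open>Suc a\<close>) from
  a point (0).\<close>

lemma cell_backward_unique:
  assumes "cell A B C D x" "cell A' B C D x'"
  shows "A = A' \<and> x = x'"
proof -
  consider "D = B" | "D = C" | "D \<noteq> B" "D \<noteq> C" by blast
  then show ?thesis
  proof cases
    case 1
    then show ?thesis using assms cell_right_edge_trivial by metis
  next
    case 2
    then show ?thesis using assms cell_top_edge_trivial by metis
  next
    case 3
    from assms(1) 3 show ?thesis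
    proof (cases rule: cell_proper_cases)
      case (diamond a b)
      note d = this
      from assms(2) 3 show ?thesis
      proof (cases rule: cell_proper_cases)
        case (diamond a' b')
        have "a = a'" using mv_inj_left[OF d(5) diamond(5)] d(9) diamond(9) by simp
        then have "A = A'" using mv_inj_right[OF d(3)] d(7) diamond(3,7) by simp
        then show ?thesis using d(1) diamond(1) by simp
      qed (use d(2) in simp_all)
    next
      case (bump a e)
      note d = this
      have e: "movable e B" using d(4) run_movable by blast
      from assms(2) 3 show ?thesis
      proof (cases rule: cell_proper_cases)
        case (bump a' e')
        have "e = e'" using mv_inj_left[OF e run_movable[OF bump(4)]] d(6) bump(6) by simp
        then have "a = a'" using run_start_unique[OF d(4)] bump(4) by blast
        then have "A = A'" using mv_inj_right[OF d(3)] d(5) bump(3,5) by simp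
        then show ?thesis using d(1) bump(1) by simp
      next
        case (new e')
        have "e = e'" using mv_inj_left[OF e run_movable[OF new(4)]] d(6) new(5) by simp
        then have "Suc a = 0" using run_start_unique[OF d(4)] new(4) by blast
        then show ?thesis by simp
      qed (use d(2) in simp_all)
    next
      case (new e)
      note d = this
      have e: "movable e B" using d(4) run_movable by blast
      from assms(2) 3 show ?thesis
      proof (cases rule: cell_proper_cases)
        case (bump a' e')
        have "e = e'" using mv_inj_left[OF e run_movable[OF bump(4)]] d(5) bump(6) by simp
        then have "0 = Suc a'" using run_start_unique[OF d(4)] bump(4) by blast
        then show ?thesis by simp
      next
        case (new e')
        then show ?thesis using d(1,2) by simp
      qed (use d(3) in simp_all)
    qed
  qed
qed

text \<open>For a shape with \<open>d\<close> columns, \<open>d - mex A\<close> is the number of nonempty columns. It obeys the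
  recurrence of the length of a longest increasing chain.\<close>

definition mex :: "nat set \<Rightarrow> nat" where
  "mex A = (LEAST x. x \<notin> A)"

lemma mex_eqI:
  assumes "m \<notin> A" "{..<m} \<subseteq> A" shows "mex A = m"
  unfolding mex_def
proof (rule Least_equality)
  fix y assume "y \<notin> A"
  then show "m \<le> y" using assms(2) by (meson lessThan_iff not_le subsetD)
qed (fact assms(1))

lemma mex_props:
  assumes "finite A" shows "mex A \<notin> A" "{..<mex A} \<subseteq> A"
proof -
  obtain x where "x \<notin> A" using ex_new_if_finite[OF infinite_UNIV_nat assms] by blast
  then show "mex A \<notin> A" unfolding mex_def by (rule LeastI)
  show "{..<mex A} \<subseteq> A"
    using not_less_Least[of _ "\<lambda>x. x \<notin> A"] unfolding mex_def by blast
qed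

text \<open>Below its first gap the configuration is full, so the only particle that can move there
  is the one next to the gap; moves above the gap leave it in place.\<close>

lemma mex_mv:
  assumes "finite A" "movable a A"
  shows "mex (mv a A) = (if Suc a = mex A then a else mex A)"
proof (cases "Suc a = mex A")
  case True
  then have "{..<a} \<subseteq> A" using mex_props(2)[OF assms(1)] by auto
  then have "mex (mv a A) = a" by (intro mex_eqI) (auto simp: mv_def)
  then show ?thesis using True by simp
next
  case False
  have "\<not> a < mex A"
  proof
    assume "a < mex A"
    then have "Suc a \<in> A" using False mex_props(2)[OF assms(1)] by auto
    then show False using assms(2) by (simp add: movable_def)
  qed
  then have "mex (mv a A) = mex A"
    using False mex_props[OF assms(1)] by (intro mex_eqI) (auto simp: mv_def)
  then show ?thesis using False by simp
qed

lemma mex_mv_le: "finite A \<Longrightarrow> movable a A \<Longrightarrow> mex (mv a A) \<le> mex A"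
  by (simp add: mex_mv)

lemma cell_mex_new:
  assumes "cell A B C D True" "finite A"
  shows "mex A = Suc (mex D)"
  using assms(1)
proof (cases rule: cell.cases)
  case (new e)
  then have "mex A = Suc e" by (intro mex_eqI) (auto simp: run_def less_Suc_eq_le)
  then show ?thesis using mex_mv[OF assms(2) run_movable[OF new(4)]] new by simp
qed simp_all

lemma cell_mex:
  assumes "cell A B C D False" "finite A"
  shows "mex D = min (mex B) (mex C)"
  using assms(1)
proof (cases rule: cell.cases)
  case vert
  then show ?thesis using assms(2) by (auto simp: cov_def min_def dest: mex_mv_le)
next
  case horiz
  then show ?thesis using assms(2) by (auto simp: cov_def min_def dest: mex_mv_le)
next
  case (diamond a b)
  have "mex B = (if Suc a = mex A then a else mex A)"
    "mex C = (if Suc b = mex A then b else mex A)"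
    "mex D = (if Suc a = mex C then a else mex C)"
    using mex_mv diamond movable_comm(1)[of a b A] assms(2) by simp_all
  moreover have "Suc a \<noteq> b" using diamond by (auto simp: movable_def)
  ultimately show ?thesis using diamond(4) by (simp split: if_splits)
next
  case (bump a e)
  \<comment> \<open>The site \<open>a\<close> has just been vacated and lies below the particle
    \<open>e\<close> that moves next, so the second move cannot change \<open>mex\<close>.\<close>
  have "a \<notin> mv a A" by (auto simp: mv_def)
  then have "mex (mv a A) \<le> a" unfolding mex_def by (rule Least_le)
  moreover have "Suc a \<le> e" using bump by (auto simp: run_def)
  ultimately show ?thesis using bump mex_mv[of "mv a A" e] run_movable assms(2) by auto
qed simp_all

section \<open>Rows of a growth diagram\<close>

definition walk :: "nat \<Rightarrow> (nat \<Rightarrow> nat set) \<Rightarrow> bool" where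
  "walk n \<alpha> \<longleftrightarrow> (\<forall>j<n. \<alpha> (Suc j) = \<alpha> j \<or> cov (\<alpha> j) (\<alpha> (Suc j)))"

text \<open>One horizontal strip: lower edge \<open>\<alpha>\<close>, upper edge
  \<open>\<beta>\<close>, a point in column \<open>v\<close>. The left edge is trivial because no
  entry is below 0. For \<open>v \<ge> n\<close> the strip contains no point.\<close>

definition row :: "nat \<Rightarrow> (nat \<Rightarrow> nat set) \<Rightarrow> nat \<Rightarrow> (nat \<Rightarrow> nat set) \<Rightarrow> bool" where
  "row n \<alpha> v \<beta> \<longleftrightarrow> \<beta> 0 = \<alpha> 0 \<and> (\<forall>j<n. cell (\<alpha> j) (\<alpha> (Suc j)) (\<beta> j) (\<beta> (Suc j)) (j = v))"

lemma walkD: "walk n \<alpha> \<Longrightarrow> j < n \<Longrightarrow> \<alpha> (Suc j) = \<alpha> j \<or> cov (\<alpha> j) (\<alpha> (Suc j))"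
  by (simp add: walk_def)

lemma row_0: "row n \<alpha> v \<beta> \<Longrightarrow> \<beta> 0 = \<alpha> 0"
  by (simp add: row_def)

lemma rowD: "row n \<alpha> v \<beta> \<Longrightarrow> j < n \<Longrightarrow> cell (\<alpha> j) (\<alpha> (Suc j)) (\<beta> j) (\<beta> (Suc j)) (j = v)"
  by (simp add: row_def)

lemma row_walk:
  assumes "row n \<alpha> v \<beta>" shows "walk n \<alpha>" "walk n \<beta>"
  using cell_edges(1,4)[OF rowD[OF assms]] by (auto simp: walk_def)

lemma row_cong:
  assumes "\<And>j. j \<le> n \<Longrightarrow> \<alpha> j = \<alpha>' j" "\<And>j. j \<le> n \<Longrightarrow> \<beta> j = \<beta>' j"
  shows "row n \<alpha> v \<beta> \<longleftrightarrow> row n \<alpha>' v \<beta>'"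
  unfolding row_def using assms by (metis Suc_leI less_imp_le zero_le)

lemma row_Suc:
  "row (Suc n) \<alpha> v \<beta> \<longleftrightarrow>
    row n \<alpha> v \<beta> \<and> cell (\<alpha> n) (\<alpha> (Suc n)) (\<beta> n) (\<beta> (Suc n)) (n = v)"
  by (auto simp: row_def less_Suc_eq)

lemma row_before:
  assumes "row n \<alpha> v \<beta>" "j \<le> n" "j \<le> v" shows "\<beta> j = \<alpha> j"
  using assms(2,3)
proof (induction j)
  case 0
  then show ?case using assms(1) by (simp add: row_def)
next
  case (Suc j)
  have c: "cell (\<alpha> j) (\<alpha> (Suc j)) (\<alpha> j) (\<beta> (Suc j)) False"
    using rowD[OF assms(1), of j] Suc by simp
  show ?case using cell_forward_unique[OF c cell.horiz[OF cell_edges(1)[OF c]]] .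
qed

lemma cell_TrueD: "cell A B C D True \<Longrightarrow> B = A \<and> C = A \<and> cov A D \<and> 0 \<in> A"
  by (cases rule: cell.cases, assumption) (auto simp: cov_def run_def intro: run_movable[unfolded run_def])

lemma row_at:
  assumes "row n \<alpha> v \<beta>" "v < n"
  shows "\<alpha> (Suc v) = \<alpha> v" "0 \<in> \<alpha> v"
  using cell_TrueD rowD[OF assms] by auto

lemma row_after:
  assumes "row n \<alpha> v \<beta>" "j \<le> n" "v < j" shows "cov (\<alpha> j) (\<beta> j)"
  using assms(2,3)
proof (induction j)
  case (Suc j)
  show ?case
  proof (cases "j = v")
    case True
    then have "cell (\<alpha> v) (\<alpha> (Suc v)) (\<beta> v) (\<beta> (Suc v)) True"
      using rowD[OF assms(1), of j] Suc by simp
    from cell_TrueD[OF this] show ?thesis using True by simp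
  next
    case False
    then have c: "cell (\<alpha> j) (\<alpha> (Suc j)) (\<beta> j) (\<beta> (Suc j)) False" "cov (\<alpha> j) (\<beta> j)"
      using rowD[OF assms(1), of j] Suc by auto
    then have "\<beta> (Suc j) \<noteq> \<alpha> (Suc j)"
      using cell_right_edge_trivial not_cov_refl by metis
    then show ?thesis using cell_edges(3)[OF c(1)] by simp
  qed
qed simp

lemma row_forward_unique:
  assumes "row n \<alpha> v \<beta>" "row n \<alpha> v \<beta>'" "j \<le> n" shows "\<beta> j = \<beta>' j"
  using assms(3)
proof (induction j)
  case 0
  then show ?case using assms by (simp add: row_def)
next
  case (Suc j)
  then show ?case
    using cell_forward_unique rowD[OF assms(1), of j] rowD[OF assms(2), of j] by simp
qed

lemma row_forward_ex:
  assumes "walk n \<alpha>" "\<And>j. j \<le> n \<Longrightarrow> finite (\<alpha> j)" "v < n" "\<alpha> (Suc v) = \<alpha> v" "0 \<in> \<alpha> v"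
  shows "\<exists>\<beta>. row n \<alpha> v \<beta>"
proof -
  have "Suc v \<le> n" using assms(3) by simp
  then show ?thesis using assms(1,2)
  proof (induction n rule: dec_induct)
    case base
    obtain D where D: "cell (\<alpha> v) (\<alpha> v) (\<alpha> v) D True"
      using cell_forward_ex_new[OF _ assms(5)] base.prems(2)[of v] by auto
    have "row (Suc v) \<alpha> v (\<alpha>(Suc v := D))"
      using base.prems(1) D assms(4) unfolding row_def walk_def
      by (auto simp: less_Suc_eq intro!: cell.horiz)
    then show ?case by blast
  next
    case (step n)
    have "walk n \<alpha>" using step.prems(1) by (simp add: walk_def)
    then obtain \<beta> where b: "row n \<alpha> v \<beta>" using step by auto
    have "cov (\<alpha> n) (\<beta> n)" using row_after[OF b] step.hyps by simp
    moreover have "\<alpha> (Suc n) = \<alpha> n \<or> cov (\<alpha> n) (\<alpha> (Suc n))"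
      using step.prems(1) by (simp add: walk_def)
    moreover have "finite (\<alpha> n)" using step.prems(2) by simp
    ultimately obtain D where D: "cell (\<alpha> n) (\<alpha> (Suc n)) (\<beta> n) D False"
      using cell_forward_ex by meson
    have "row n \<alpha> v (\<beta>(Suc n := D))" using row_cong[of n \<alpha> \<alpha> \<beta> "\<beta>(Suc n := D)" v] b by simp
    then have "row (Suc n) \<alpha> v (\<beta>(Suc n := D))" using D step.hyps by (simp add: row_Suc)
    then show ?case by blast
  qed
qed

text \<open>Reading from right to left, the upper shape covers the lower one until a cell with a
  point is met. Such a cell must occur, because otherwise the left end \<open>\<beta> 0\<close>
  would cover some shape.\<close>

lemma row_backward_ex:
  assumes "walk n \<beta>" "\<And>j. j \<le> n \<Longrightarrow> finite (\<beta> j)" "\<And>A. \<not> cov A (\<beta> 0)" "cov A (\<beta> n)"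
  shows "\<exists>\<alpha> v. v < n \<and> row n \<alpha> v \<beta> \<and> \<alpha> n = A"
  using assms
proof (induction n arbitrary: A)
  case (Suc n)
  have w: "walk n \<beta>" "\<beta> (Suc n) = \<beta> n \<or> cov (\<beta> n) (\<beta> (Suc n))"
    using Suc.prems(1) by (simp_all add: walk_def)
  obtain B x where B: "cell B A (\<beta> n) (\<beta> (Suc n)) x"
    using cell_backward_ex[of "\<beta> (Suc n)" A "\<beta> n"] Suc.prems(2,4) w(2) by auto
  show ?case
  proof (cases x)
    case True
    then have AB: "A = B" "\<beta> n = B" using cell_TrueD B by auto
    \<comment> \<open>The column index \<open>n\<close> lies outside the first \<open>n\<close>
      cells, so this is a strip without a point; left of the point both edges agree.\<close>
    have r: "row n \<beta> n \<beta>"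
      using w(1) unfolding row_def walk_def by (auto intro!: cell.horiz)
    have "row n (\<beta>(Suc n := A)) n \<beta>" using row_cong[of n \<beta> "\<beta>(Suc n := A)" \<beta> \<beta> n] r by simp
    then have "row (Suc n) (\<beta>(Suc n := A)) n \<beta>" using B AB True by (simp add: row_Suc)
    then show ?thesis by (metis fun_upd_same lessI)
  next
    case False
    have "\<beta> n \<noteq> B"
    proof
      assume "\<beta> n = B"
      then have "A = \<beta> (Suc n)"
        using B False cell_forward_unique[OF _ cell.horiz[OF cell_edges(1)[OF B]]] by metis
      then show False using Suc.prems(4) not_cov_refl by simp
    qed
    then have "cov B (\<beta> n)" using cell_edges(2)[OF B] by simp
    with Suc.IH[OF w(1) _ Suc.prems(3)] Suc.prems(2)
    obtain \<alpha> v where a: "v < n" "row n \<alpha> v \<beta>" "\<alpha> n = B" by (metis le_Suc_eq)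
    have "row n (\<alpha>(Suc n := A)) v \<beta>" using row_cong[of n \<alpha> "\<alpha>(Suc n := A)" \<beta> \<beta> v] a by simp
    then have "row (Suc n) (\<alpha>(Suc n := A)) v \<beta>" using B a False by (simp add: row_Suc)
    then show ?thesis using a(1) by (metis fun_upd_same less_SucI)
  qed
qed auto

lemma row_backward_unique:
  assumes "row n \<alpha> v \<beta>" "row n \<alpha>' v' \<beta>" "v < n" "v' < n" "\<alpha> n = \<alpha>' n"
  shows "v = v' \<and> (\<forall>j\<le>n. \<alpha> j = \<alpha>' j)"
  using assms
proof (induction n)
  case (Suc n)
  have "\<alpha> n = \<alpha>' n \<and> (n = v) = (n = v')"
    by (rule cell_backward_unique[of _ "\<alpha> (Suc n)" "\<beta> n" "\<beta> (Suc n)"])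
      (use Suc.prems in \<open>simp_all add: row_Suc\<close>)
  then have eq: "\<alpha> n = \<alpha>' n" "(n = v) = (n = v')" by simp_all
  have r: "row n \<alpha> v \<beta>" "row n \<alpha>' v' \<beta>" using Suc.prems by (simp_all add: row_Suc)
  show ?case
  proof (cases "n = v")
    case True
    then show ?thesis
      using row_before[OF r(1)] row_before[OF r(2)] eq Suc.prems(5) by (auto simp: le_Suc_eq)
  next
    case False
    then have "v < n" "v' < n" using Suc.prems(3,4) eq(2) by simp_all
    then show ?thesis using Suc.IH[OF r _ _ eq(1)] Suc.prems(5) by (auto simp: le_Suc_eq)
  qed
qed simp

lemma row_step_iff:
  assumes "row n \<alpha> v \<beta>" "j < n" "v < n"
  shows "\<beta> (Suc j) = \<beta> j \<longleftrightarrow> j \<noteq> v \<and> \<alpha> (Suc j) = \<alpha> j"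
proof -
  consider "j < v" | "j = v" | "v < j" by linarith
  then show ?thesis
  proof cases
    case 1
    then show ?thesis using row_before[OF assms(1)] assms by simp
  next
    case 2
    have "cov (\<alpha> (Suc v)) (\<beta> (Suc v))" using row_after[OF assms(1)] assms by simp
    then show ?thesis
      using 2 row_at[OF assms(1,3)] row_before[OF assms(1), of v] assms not_cov_refl by auto
  next
    case 3
    then have c: "cell (\<alpha> j) (\<alpha> (Suc j)) (\<beta> j) (\<beta> (Suc j)) False"
      using rowD[OF assms(1,2)] by simp
    have "\<beta> (Suc j) = \<beta> j" if "\<alpha> (Suc j) = \<alpha> j"
      using cell_forward_unique[of "\<alpha> j" "\<alpha> j" "\<beta> j"] cell.vert[OF cell_edges(2)[OF c]] c that
      by auto
    moreover have "\<alpha> (Suc j) = \<alpha> j" if "\<beta> (Suc j) = \<beta> j"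
      using cell_top_edge_trivial[of "\<alpha> j" "\<alpha> (Suc j)" "\<beta> j"] c that by auto
    ultimately show ?thesis using 3 by auto
  qed
qed

lemma walk_mex_mono:
  assumes "walk n \<alpha>" "\<And>j. j \<le> n \<Longrightarrow> finite (\<alpha> j)" "j < n"
  shows "mex (\<alpha> (Suc j)) \<le> mex (\<alpha> j)"
  using assms mex_mv_le[of "\<alpha> j"] by (auto simp: walk_def cov_def)

text \<open>Read through \<open>d - mex\<close>: after appending \<open>v\<close>, the longest
  increasing subsequence below \<open>j > v\<close> is the longer of the old one and the one below
  \<open>v\<close> extended by \<open>v\<close>. This is the counterpart of
  \<open>inc_subseq_snoc\<close>.\<close>

lemma row_mex:
  assumes "row n \<alpha> v \<beta>" "v < n" "\<And>j. j \<le> n \<Longrightarrow> finite (\<alpha> j)" "j \<le> n"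
  shows "mex (\<beta> j) = (if j \<le> v then mex (\<alpha> j) else min (mex (\<alpha> j)) (mex (\<alpha> v) - 1))"
  using assms(4)
proof (induction j)
  case 0
  then show ?case using row_before[OF assms(1)] by simp
next
  case (Suc j)
  consider "j < v" | "j = v" | "v < j" by linarith
  then show ?case
  proof cases
    case 1
    then show ?thesis using row_before[OF assms(1) Suc.prems] by simp
  next
    case 2
    have c: "cell (\<alpha> v) (\<alpha> (Suc v)) (\<beta> v) (\<beta> (Suc v)) True"
      using rowD[OF assms(1,2)] by simp
    show ?thesis
      using 2 cell_mex_new[OF c assms(3)] row_at(1)[OF assms(1,2)] assms(2) by simp
  next
    case 3
    have c: "cell (\<alpha> j) (\<alpha> (Suc j)) (\<beta> j) (\<beta> (Suc j)) False"
      using rowD[OF assms(1), of j] Suc.prems 3 by simp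
    \<comment> \<open>The cell rule gives a minimum that still contains
      \<open>mex (\<alpha> j)\<close>; since \<open>mex\<close> decreases along a walk, that term is
      absorbed by \<open>mex (\<alpha> (Suc j))\<close>.\<close>
    show ?thesis
      using cell_mex[OF c assms(3)] walk_mex_mono[OF row_walk(1)[OF assms(1)] assms(3), of j]
        Suc 3 by (simp add: min_def)
  qed
qed

subsection \<open>Counting sequences without long increasing subsequences\<close>

definition inc_subseq :: "nat \<Rightarrow> nat list \<Rightarrow> nat \<Rightarrow> bool" where
  "inc_subseq j p r \<longleftrightarrow>
    (\<exists>xs. subseq xs p \<and> sorted_wrt (<) xs \<and> length xs = r \<and> set xs \<subseteq> {..<j})"

lemma subseq_snoc_iff:
  "subseq xs (p @ [v]) \<longleftrightarrow> subseq xs p \<or> (\<exists>ys. xs = ys @ [v] \<and> subseq ys p)"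
proof
  assume "subseq xs (p @ [v])"
  then obtain as bs where "xs = as @ bs" "subseq as p" "subseq bs [v]"
    by (auto simp: subseq_append_iff)
  moreover have "bs = [] \<or> bs = [v]" using \<open>subseq bs [v]\<close>
    by (cases bs) (auto split: if_splits dest: subseq_Cons2_neq simp: list_emb_Cons_iff1)
  ultimately show "subseq xs p \<or> (\<exists>ys. xs = ys @ [v] \<and> subseq ys p)" by auto
qed auto

lemma inc_subseq_Nil: "inc_subseq j [] r \<longleftrightarrow> r = 0"
  by (auto simp: inc_subseq_def)

lemma inc_subseq_snoc:
  "inc_subseq j (p @ [v]) r \<longleftrightarrow>
    inc_subseq j p r \<or> (v < j \<and> (\<exists>r'. r = Suc r' \<and> inc_subseq v p r'))"
proof
  assume "inc_subseq j (p @ [v]) r"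
  then obtain xs where xs: "subseq xs (p @ [v])" "sorted_wrt (<) xs" "length xs = r" "set xs \<subseteq> {..<j}"
    by (auto simp: inc_subseq_def)
  show "inc_subseq j p r \<or> (v < j \<and> (\<exists>r'. r = Suc r' \<and> inc_subseq v p r'))"
  proof (cases "subseq xs p")
    case True
    then show ?thesis using xs by (auto simp: inc_subseq_def)
  next
    case False
    then obtain ys where ys: "xs = ys @ [v]" "subseq ys p" using xs(1) by (auto simp: subseq_snoc_iff)
    then have "inc_subseq v p (length ys)" using xs
      by (auto simp: inc_subseq_def sorted_wrt_append intro!: exI[of _ ys])
    then show ?thesis using xs ys by auto
  qed
next
  assume "inc_subseq j p r \<or> (v < j \<and> (\<exists>r'. r = Suc r' \<and> inc_subseq v p r'))"
  then show "inc_subseq j (p @ [v]) r"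
  proof
    assume "inc_subseq j p r"
    then show ?thesis unfolding inc_subseq_def using subseq_rev_drop_many by blast
  next
    assume "v < j \<and> (\<exists>r'. r = Suc r' \<and> inc_subseq v p r')"
    then obtain xs where "v < j" "subseq xs p" "sorted_wrt (<) xs" "r = Suc (length xs)" "set xs \<subseteq> {..<v}"
      by (auto simp: inc_subseq_def)
    then show ?thesis unfolding inc_subseq_def
      by (intro exI[of _ "xs @ [v]"]) (auto simp: sorted_wrt_append)
  qed
qed

text \<open>The number of standard tableaux with \<open>i\<close> boxes of the shape encoded by
  \<open>A\<close>, counted as saturated chains from the empty shape.\<close>

fun chains :: "nat \<Rightarrow> nat \<Rightarrow> nat set \<Rightarrow> nat" where
  "chains d 0 A = (if A = {..<d} then 1 else 0)"
| "chains d (Suc i) A = (\<Sum>B | cov B A. chains d i B)"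

text \<open>A normal form: only the values up to \<open>n\<close> carry information, and freezing
  the rest makes equality of walks equality of functions, so that they can be counted.\<close>

definition fixed_after :: "nat \<Rightarrow> (nat \<Rightarrow> 'a) \<Rightarrow> bool" where
  "fixed_after n \<beta> \<longleftrightarrow> (\<forall>j\<ge>n. \<beta> j = \<beta> n)"

lemma fixed_after_min: "fixed_after n (\<lambda>j. \<alpha> (min j n))"
  by (simp add: fixed_after_def min_def)

lemma fixed_after_const: "fixed_after n (\<lambda>_. c)"
  by (simp add: fixed_after_def)

lemma fixed_afterD: "fixed_after n \<beta> \<Longrightarrow> n \<le> j \<Longrightarrow> \<beta> j = \<beta> n"
  unfolding fixed_after_def by blast

lemma fun_eq_horizon:
  assumes "fixed_after n \<beta>" "fixed_after n \<beta>'" "\<And>j. j \<le> n \<Longrightarrow> \<beta> j = \<beta>' j"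
  shows "\<beta> = \<beta>'"
proof
  fix j
  show "\<beta> j = \<beta>' j"
  proof (cases "j \<le> n")
    case False
    then show ?thesis
      using fixed_afterD[OF assms(1), of j] fixed_afterD[OF assms(2), of j] assms(3)[of n] by simp
  qed (rule assms(3))
qed

section \<open>Sequences as pairs of a walk (insertion tableau) and a chain (recording
  tableau)\<close>

definition walks :: "nat \<Rightarrow> nat \<Rightarrow> (nat \<Rightarrow> nat set) set" where
  "walks d n = {\<beta>. \<beta> 0 = {..<d} \<and> walk n \<beta> \<and> (fixed_after n \<beta>)}"

text \<open>\<open>rsk d n p \<beta>\<close>: the shape that the Robinson--Schensted correspondence assigns to the subsequence
  of the entries of \<open>p\<close> below \<open>j\<close> is \<open>\<beta> j\<close>. The relation gets stuck when more than \<open>d\<close> columns would be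
  needed.\<close>

inductive rsk :: "nat \<Rightarrow> nat \<Rightarrow> nat list \<Rightarrow> (nat \<Rightarrow> nat set) \<Rightarrow> bool" for d n where
  rsk_Nil: "rsk d n [] (\<lambda>_. {..<d})"
| rsk_snoc: "rsk d n p \<alpha> \<Longrightarrow> v < n \<Longrightarrow> row n \<alpha> v \<beta> \<Longrightarrow> fixed_after n \<beta> \<Longrightarrow> rsk d n (p @ [v]) \<beta>"

lemma not_cov_start: "\<not> cov A {..<d}"
proof
  assume "cov A {..<d}"
  then obtain a where a: "movable a A" "{..<d} = mv a A" by (auto simp: cov_def)
  have "a \<notin> {..<d}" "Suc a \<in> {..<d}" unfolding a(2) by (auto simp: mv_def)
  then show False by simp
qed

lemma cov_card:
  assumes "cov A B" "finite A" shows "card B = card A"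
proof -
  obtain a where a: "a \<in> A" "Suc a \<notin> A" "B = insert (Suc a) (A - {a})"
    using assms(1) by (auto simp: cov_def mv_def movable_def)
  have "card B = Suc (card (A - {a}))" unfolding a(3) using a(2) assms(2) by (subst card_insert_disjoint) auto
  then show ?thesis using card.remove[OF assms(2) a(1)] by simp
qed

lemma cov_finite: "cov A B \<Longrightarrow> finite B \<longleftrightarrow> finite A"
  by (auto simp: cov_def)

lemma finite_pred: "finite A \<Longrightarrow> finite {B. cov B A}"
proof (rule finite_subset)
  show "{B. cov B A} \<subseteq> (\<lambda>b. insert b (A - {Suc b})) ` (\<lambda>a. a - 1) ` A"
  proof
    fix B assume "B \<in> {B. cov B A}"
    then obtain a where "movable a B" "A = mv a B" by (auto simp: cov_def)
    then have "B = insert a (A - {Suc a})" "Suc a \<in> A" using mv_undo by (auto simp: mv_def)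
    then show "B \<in> (\<lambda>b. insert b (A - {Suc b})) ` (\<lambda>a. a - 1) ` A" by force
  qed
qed simp

lemma walksD:
  assumes "\<beta> \<in> walks d n" shows "\<beta> 0 = {..<d}" "walk n \<beta>" "fixed_after n \<beta>"
  using assms by (simp_all add: walks_def)

lemma walks_card:
  assumes "\<beta> \<in> walks d n" shows "finite (\<beta> j) \<and> card (\<beta> j) = d"
proof -
  have le: "finite (\<beta> j) \<and> card (\<beta> j) = d" if "j \<le> n" for j
    using that
  proof (induction j)
    case 0
    show ?case unfolding walksD(1)[OF assms] by simp
  next
    case (Suc j)
    then have j: "j < n" and IH: "finite (\<beta> j)" "card (\<beta> j) = d" by simp_all
    from walkD[OF walksD(2)[OF assms] j] show ?case
    proof
      assume "\<beta> (Suc j) = \<beta> j"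
      then show ?thesis using IH by (simp only:)
    next
      assume "cov (\<beta> j) (\<beta> (Suc j))"
      then show ?thesis using cov_card cov_finite IH by blast
    qed
  qed
  show ?thesis
  proof (cases "j \<le> n")
    case False
    then have "n \<le> j" by simp
    then have "\<beta> j = \<beta> n" by (rule fixed_afterD[OF walksD(3)[OF assms]])
    then show ?thesis using le[of n] by (simp only: le_refl)
  qed (rule le)
qed

lemma rsk_walks: "rsk d n p \<beta> \<Longrightarrow> \<beta> \<in> walks d n"
proof (induction rule: rsk.induct)
  case rsk_Nil
  then show ?case by (simp add: walks_def walk_def fixed_after_const)
next
  case (rsk_snoc p \<alpha> v \<beta>)
  then show ?case
    using row_walk(2)[OF rsk_snoc.hyps(3)] row_0[OF rsk_snoc.hyps(3)] walksD(1)[OF rsk_snoc.IH]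
    by (simp add: walks_def)
qed

lemma rsk_NilD: "rsk d n [] \<beta> \<Longrightarrow> \<beta> = (\<lambda>_. {..<d})"
  by (erule rsk.cases) auto

lemma rsk_snocD:
  "rsk d n (p @ [v]) \<beta> \<Longrightarrow> v < n \<and> (fixed_after n \<beta>) \<and> (\<exists>\<alpha>. rsk d n p \<alpha> \<and> row n \<alpha> v \<beta>)"
  by (erule rsk.cases) auto

lemma rsk_unique: "rsk d n p \<beta> \<Longrightarrow> rsk d n p \<beta>' \<Longrightarrow> \<beta> = \<beta>'"
proof (induction p arbitrary: \<beta> \<beta>' rule: rev_induct)
  case Nil
  then show ?case using rsk_NilD by metis
next
  case (snoc v p)
  obtain \<alpha> where a: "fixed_after n \<beta>" "rsk d n p \<alpha>" "row n \<alpha> v \<beta>"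
    using rsk_snocD[OF snoc.prems(1)] by auto
  obtain \<alpha>' where a': "fixed_after n \<beta>'" "rsk d n p \<alpha>'" "row n \<alpha>' v \<beta>'"
    using rsk_snocD[OF snoc.prems(2)] by auto
  have "\<alpha> = \<alpha>'" using snoc.IH a a' by blast
  then have "\<beta> j = \<beta>' j" if "j \<le> n" for j using row_forward_unique[OF a(3)] a'(3) that by simp
  then show ?case by (rule fun_eq_horizon[OF a(1) a'(1)])
qed

text \<open>The walk \<open>\<beta>\<close> plays the role of the insertion tableau, and the
  right-end shapes of the successive rows form the recording tableau. Each shape \<open>A\<close>
  covered by \<open>\<beta> n\<close> determines exactly one last entry and one row below, so the
  fibre satisfies the recursion of \<open>chains\<close>.\<close>

lemma card_rsk_fibre:
  assumes "\<beta> \<in> walks d n"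
  shows "finite {p. length p = i \<and> rsk d n p \<beta>} \<and>
    card {p. length p = i \<and> rsk d n p \<beta>} = chains d i (\<beta> n)"
  using assms
proof (induction i arbitrary: \<beta>)
  case 0
  have "rsk d n [] \<beta> \<longleftrightarrow> \<beta> n = {..<d}"
  proof
    assume "\<beta> n = {..<d}"
    have "\<beta> j = {..<d}" if "j \<le> n" for j
      using that
    proof (induction j rule: inc_induct)
      case (step j)
      then have "\<beta> (Suc j) = \<beta> j \<or> cov (\<beta> j) (\<beta> (Suc j))"
        using walkD[OF walksD(2)[OF 0] step.hyps(2)] by simp
      then show ?case unfolding step.IH using not_cov_start by auto
    qed fact
    then have "\<beta> = (\<lambda>_. {..<d})"
      using fun_eq_horizon[OF walksD(3)[OF 0] fixed_after_const] by simp
    then show "rsk d n [] \<beta>" using rsk_Nil by metis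
  qed (auto dest: rsk_NilD)
  then have "{p. length p = 0 \<and> rsk d n p \<beta>} = (if \<beta> n = {..<d} then {[]} else {})" by auto
  then show ?case by simp
next
  case (Suc i)
  define P where "P = {A. cov A (\<beta> n)}"
  have fin: "finite (\<beta> j)" for j using walks_card[OF Suc.prems] by simp
  have b0: "\<beta> 0 = {..<d}" "walk n \<beta>" "fixed_after n \<beta>" using walksD[OF Suc.prems] by simp_all
  have nc: "\<not> cov A (\<beta> 0)" for A using b0(1) not_cov_start by simp
  have "\<exists>\<alpha> v. v < n \<and> row n \<alpha> v \<beta> \<and> \<alpha> n = A \<and> \<alpha> \<in> walks d n" if "A \<in> P" for A
  proof -
    obtain \<alpha> v where a: "v < n" "row n \<alpha> v \<beta>" "\<alpha> n = A"
      using row_backward_ex[OF b0(2) fin nc, of A] \<open>A \<in> P\<close> by (auto simp: P_def)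
    define \<alpha>' where "\<alpha>' j = \<alpha> (min j n)" for j
    have "row n \<alpha>' v \<beta>" using row_cong[of n \<alpha> \<alpha>' \<beta> \<beta> v] a by (simp add: \<alpha>'_def)
    moreover from this have "\<alpha>' \<in> walks d n"
      using row_walk(1)[of n \<alpha>' v \<beta>] row_0[of n \<alpha>' v \<beta>] b0(1) fixed_after_min[of n \<alpha>]
      by (simp add: walks_def \<alpha>'_def[abs_def])
    moreover have "\<alpha>' n = A" using a(3) by (simp add: \<alpha>'_def)
    ultimately show ?thesis using a(1) by blast
  qed
  then obtain \<alpha> v where
    a: "\<And>A. A \<in> P \<Longrightarrow> v A < n \<and> row n (\<alpha> A) (v A) \<beta> \<and> \<alpha> A n = A \<and> \<alpha> A \<in> walks d n"
    by metis
  define F where "F A = (\<lambda>p. p @ [v A]) ` {p. length p = i \<and> rsk d n p (\<alpha> A)}" for A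
  have eq: "{p. length p = Suc i \<and> rsk d n p \<beta>} = (\<Union>A\<in>P. F A)"
  proof (intro equalityI subsetI)
    fix p assume "p \<in> {p. length p = Suc i \<and> rsk d n p \<beta>}"
    then obtain q w where p: "p = q @ [w]" "length q = i" "rsk d n (q @ [w]) \<beta>"
      by (cases p rule: rev_cases) auto
    obtain \<alpha>' where a': "w < n" "rsk d n q \<alpha>'" "row n \<alpha>' w \<beta>"
      using rsk_snocD[OF p(3)] by auto
    define A where "A = \<alpha>' n"
    have A: "A \<in> P" using row_after[OF a'(3)] a'(1) by (simp add: P_def A_def)
    have aA: "v A < n" "row n (\<alpha> A) (v A) \<beta>" "\<alpha> A n = A" "\<alpha> A \<in> walks d n"
      using a[OF A] by simp_all
    have "w = v A \<and> (\<forall>j\<le>n. \<alpha>' j = \<alpha> A j)"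
      by (rule row_backward_unique[OF a'(3) aA(2) a'(1) aA(1)]) (simp add: aA(3) A_def[symmetric])
    then have u: "w = v A" "\<And>j. j \<le> n \<Longrightarrow> \<alpha>' j = \<alpha> A j" by simp_all
    have "\<alpha>' = \<alpha> A"
      by (rule fun_eq_horizon[OF walksD(3)[OF rsk_walks[OF a'(2)]] walksD(3)[OF aA(4)] u(2)])
    then have "p \<in> F A" unfolding F_def p(1) u(1) using p(2) a'(2) by blast
    then show "p \<in> (\<Union>A\<in>P. F A)" using A by blast
  next
    fix p assume "p \<in> (\<Union>A\<in>P. F A)"
    then show "p \<in> {p. length p = Suc i \<and> rsk d n p \<beta>}"
      using a b0(3) by (auto simp: F_def intro: rsk_snoc)
  qed
  have F: "finite (F A) \<and> card (F A) = chains d i A" if "A \<in> P" for A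
    using Suc.IH[of "\<alpha> A"] a[OF that] by (auto simp: F_def card_image inj_on_def)
  have disj: "F A \<inter> F B = {}" if "A \<in> P" "B \<in> P" "A \<noteq> B" for A B
  proof -
    have False if "rsk d n p (\<alpha> A)" "rsk d n p (\<alpha> B)" for p
      using rsk_unique[OF that] a[OF \<open>A \<in> P\<close>] a[OF \<open>B \<in> P\<close>] \<open>A \<noteq> B\<close> by metis
    then show ?thesis by (auto simp: F_def)
  qed
  have "finite P" unfolding P_def by (rule finite_pred[OF fin])
  then have "card (\<Union>A\<in>P. F A) = (\<Sum>A\<in>P. card (F A))"
    by (intro card_UN_disjoint) (use F disj in auto)
  also have "\<dots> = chains d (Suc i) (\<beta> n)" using F by (simp add: P_def)
  finally show ?case unfolding eq using \<open>finite P\<close> F by auto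
qed

text \<open>Schensted's theorem: both sides obey the same recurrence under appending an entry,
  namely \<open>inc_subseq_snoc\<close> and \<open>row_mex\<close>.\<close>

lemma rsk_inc_subseq:
  assumes "rsk d n p \<alpha>" "j \<le> n"
  shows "inc_subseq j p r \<longleftrightarrow> r + mex (\<alpha> j) \<le> d"
  using assms
proof (induction arbitrary: j r rule: rsk.induct)
  case rsk_Nil
  have "mex {..<d} = d" by (rule mex_eqI) auto
  then show ?case by (simp add: inc_subseq_Nil)
next
  case (rsk_snoc p \<alpha> v \<beta>)
  have fin: "finite (\<alpha> j)" for j using walks_card[OF rsk_walks[OF rsk_snoc.hyps(1)]] by simp
  \<comment> \<open>Needed because \<open>row_mex\<close> contains the truncated subtraction
    \<open>mex (\<alpha> v) - 1\<close>.\<close>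
  have m: "mex (\<alpha> v) \<noteq> 0"
    using row_at(2)[OF rsk_snoc.hyps(3,2)] mex_props(1)[OF fin, of v] by metis
  have 0: "mex (\<alpha> j) \<le> d"
    using rsk_snoc.IH[OF rsk_snoc.prems, of 0] by (auto simp: inc_subseq_def)
  have IH: "inc_subseq j p r \<longleftrightarrow> r + mex (\<alpha> j) \<le> d" "inc_subseq v p r' \<longleftrightarrow> r' + mex (\<alpha> v) \<le> d" for r'
    using rsk_snoc.IH rsk_snoc.prems rsk_snoc.hyps(2) by simp_all
  show ?case unfolding inc_subseq_snoc IH row_mex[OF rsk_snoc.hyps(3,2) fin rsk_snoc.prems]
    using m 0 by (cases r) auto
qed

lemma rsk_step_iff:
  assumes "rsk d n p \<alpha>" "j < n" shows "\<alpha> (Suc j) = \<alpha> j \<longleftrightarrow> j \<notin> set p"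
  using assms
proof (induction arbitrary: j rule: rsk.induct)
  case (rsk_snoc p \<alpha> v \<beta>)
  then show ?case using row_step_iff[OF rsk_snoc.hyps(3) rsk_snoc.prems rsk_snoc.hyps(2)] by auto
qed simp

lemma rsk_valid:
  assumes "rsk d n p \<alpha>"
  shows "distinct p" "set p \<subseteq> {..<n}" "\<not> inc_subseq n p (Suc d)"
proof -
  show "\<not> inc_subseq n p (Suc d)" using rsk_inc_subseq[OF assms, of n] by simp
  show "set p \<subseteq> {..<n}" using assms by (induction rule: rsk.induct) auto
  show "distinct p" using assms
  proof (induction rule: rsk.induct)
    case (rsk_snoc p \<alpha> v \<beta>)
    have "v \<notin> set p" using rsk_step_iff[OF rsk_snoc.hyps(1,2)] row_at(1)[OF rsk_snoc.hyps(3,2)] by simp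
    then show ?case using rsk_snoc.IH by simp
  qed simp
qed

text \<open>The diagram never gets stuck: an increasing subsequence of length \<open>d\<close> below
  \<open>v\<close> would be extended by \<open>v\<close> to length \<open>d + 1\<close>, so
  \<open>mex (\<alpha> v)\<close> is positive and the point rule applies.\<close>

lemma rsk_ex:
  assumes "distinct p" "set p \<subseteq> {..<n}" "\<not> inc_subseq n p (Suc d)"
  shows "\<exists>\<alpha>. rsk d n p \<alpha>"
  using assms
proof (induction p rule: rev_induct)
  case Nil
  then show ?case using rsk_Nil by blast
next
  case (snoc v p)
  have v: "v < n" "v \<notin> set p" using snoc.prems by auto
  obtain \<alpha> where a: "rsk d n p \<alpha>" using snoc by (auto simp: inc_subseq_snoc)
  have w: "\<alpha> \<in> walks d n" using rsk_walks[OF a] .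
  have fin: "finite (\<alpha> j)" for j using walks_card[OF w] by simp
  have "\<not> inc_subseq v p d" using snoc.prems(3) v by (auto simp: inc_subseq_snoc)
  then have "0 < mex (\<alpha> v)" using rsk_inc_subseq[OF a, of v] v by simp
  then have "0 \<in> \<alpha> v" using mex_props(2)[OF fin, of v] by auto
  moreover have "\<alpha> (Suc v) = \<alpha> v" using rsk_step_iff[OF a] v by simp
  ultimately obtain \<beta> where b: "row n \<alpha> v \<beta>"
    using row_forward_ex[OF walksD(2)[OF w] fin v(1)] by auto
  define \<beta>' where "\<beta>' j = \<beta> (min j n)" for j
  have "row n \<alpha> v \<beta>'" using row_cong[of n \<alpha> \<alpha> \<beta> \<beta>' v] b by (simp add: \<beta>'_def)
  then have "rsk d n (p @ [v]) \<beta>'" using rsk_snoc[OF a v(1)] fixed_after_min[of n \<beta>] by (simp add: \<beta>'_def[abs_def])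
  then show ?case by blast
qed

text \<open>The particles of the empty shape add up to \<open>\<Sum>{..<d}\<close> and every move
  adds 1, so \<open>i\<close> is the number of boxes.\<close>

definition shapes :: "nat \<Rightarrow> nat \<Rightarrow> nat set set" where
  "shapes d i = {A. finite A \<and> card A = d \<and> \<Sum>A = i + \<Sum>{..<d}}"

text \<open>The quantity \<open>V\<^sub>i\<close> of the overview; \<open>no_inc\<close> below is
  the set counted by \<open>B\<^sub>n\<close>.\<close>

definition sq_sum :: "nat \<Rightarrow> nat \<Rightarrow> nat" where
  "sq_sum d i = (\<Sum>A\<in>shapes d i. (chains d i A)\<^sup>2)"

definition no_inc :: "nat \<Rightarrow> nat \<Rightarrow> nat list set" where
  "no_inc d n = {p. distinct p \<and> set p \<subseteq> {..<n} \<and> \<not> inc_subseq n p (Suc d)}"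

lemma finite_shapes: "finite (shapes d i)"
proof (rule finite_subset)
  show "shapes d i \<subseteq> Pow {..i + \<Sum>{..<d}}"
  proof (intro subsetI PowI)
    fix A x assume A: "A \<in> shapes d i" and x: "x \<in> A"
    have "x \<le> \<Sum>A" using A x by (intro member_le_sum[of x A "\<lambda>x. x", simplified]) (auto simp: shapes_def)
    then show "x \<in> {..i + \<Sum>{..<d}}" using A by (simp add: shapes_def)
  qed
qed simp

lemma sum_mv:
  assumes "movable a A" "finite A" shows "\<Sum>(mv a A) = Suc (\<Sum>A)"
proof -
  have a: "a \<in> A" "Suc a \<notin> A" using assms(1) by (auto simp: movable_def)
  have "\<Sum>(mv a A) = Suc a + \<Sum>(A - {a})" unfolding mv_def using a(2) assms(2) by (subst sum.insert) auto
  then show ?thesis using sum.remove[OF assms(2) a(1), of "\<lambda>x. x"] by simp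
qed

lemma shapes_cov:
  assumes "cov B A"
  shows "A \<in> shapes d (Suc i) \<longleftrightarrow> B \<in> shapes d i"
proof (cases "finite B")
  case True
  obtain a where "movable a B" "A = mv a B" using assms by (auto simp: cov_def)
  then have "\<Sum>A = Suc (\<Sum>B)" using sum_mv True by simp
  then show ?thesis using cov_card[OF assms True] cov_finite[OF assms] True by (simp add: shapes_def)
next
  case False
  then show ?thesis using cov_finite[OF assms] by (simp add: shapes_def)
qed

lemma chains_shapes: "chains d i A \<noteq> 0 \<Longrightarrow> A \<in> shapes d i"
proof (induction i arbitrary: A)
  case 0
  then show ?case by (simp add: shapes_def split: if_splits)
next
  case (Suc i)
  then obtain B where "cov B A" "chains d i B \<noteq> 0"
    by (metis (mono_tags, lifting) chains.simps(2) mem_Collect_eq sum.neutral)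
  then show ?case using Suc.IH shapes_cov by blast
qed

section \<open>Counting walks and sequences by shape\<close>

lemma sum_binomial_Suc:
  "(\<Sum>i\<le>Suc n. (Suc n choose i) * f i) =
    (\<Sum>i\<le>n. (n choose i) * f i) + (\<Sum>i\<le>n. (n choose i) * (f (Suc i) :: nat))"
proof -
  have "(\<Sum>i\<le>Suc n. (n choose i) * f i) = (\<Sum>i\<le>n. (n choose i) * f i)" by simp
  then have *: "(\<Sum>i\<le>n. (n choose i) * f i) = f 0 + (\<Sum>i\<le>n. (n choose Suc i) * f (Suc i))"
    unfolding sum.atMost_Suc_shift by simp
  show ?thesis unfolding sum.atMost_Suc_shift * by (simp add: sum.distrib[symmetric] algebra_simps)
qed

lemma walks_Suc_end:
  "{\<beta> \<in> walks d (Suc n). \<beta> (Suc n) = A} =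
    (\<Union>B\<in>insert A {B. cov B A}. (\<lambda>\<beta> j. if j \<le> n then \<beta> j else A) ` {\<beta> \<in> walks d n. \<beta> n = B})"
  (is "?L = ?R")
proof (intro equalityI subsetI)
  fix \<beta> assume "\<beta> \<in> ?L"
  then have b: "\<beta> \<in> walks d (Suc n)" "\<beta> (Suc n) = A" by simp_all
  define \<gamma> where "\<gamma> j = \<beta> (min j n)" for j
  have "walk n \<gamma>" using walkD[OF walksD(2)[OF b(1)]] by (simp add: walk_def \<gamma>_def)
  then have "\<gamma> \<in> walks d n"
    using walksD(1)[OF b(1)] fixed_after_min[of n \<beta>] by (simp add: walks_def \<gamma>_def[abs_def])
  moreover have "\<gamma> n \<in> insert A {B. cov B A}"
    using walkD[OF walksD(2)[OF b(1)], of n] b(2) by (auto simp: \<gamma>_def)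
  moreover have "\<beta> = (\<lambda>j. if j \<le> n then \<gamma> j else A)"
  proof
    fix j
    have "\<beta> j = A" if "Suc n \<le> j" using fixed_afterD[OF walksD(3)[OF b(1)] that] b(2) by simp
    then show "\<beta> j = (if j \<le> n then \<gamma> j else A)" by (simp add: \<gamma>_def)
  qed
  ultimately show "\<beta> \<in> ?R" by blast
next
  fix \<beta> assume "\<beta> \<in> ?R"
  then obtain \<gamma> where g: "\<gamma> \<in> walks d n" "\<gamma> n = A \<or> cov (\<gamma> n) A"
    "\<beta> = (\<lambda>j. if j \<le> n then \<gamma> j else A)" by auto
  have "walk (Suc n) \<beta>"
    using walkD[OF walksD(2)[OF g(1)]] g(2) by (auto simp: walk_def g(3) less_Suc_eq)
  moreover have "fixed_after (Suc n) \<beta>" by (simp add: fixed_after_def g(3))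
  ultimately show "\<beta> \<in> ?L" using walksD(1)[OF g(1)] by (simp add: walks_def g(3))
qed

text \<open>A walk is a chain together with the choice of the \<open>i\<close> columns in which it
  moves. The induction removes the last column, in which the walk stays or moves, and this is
  Pascal's rule.\<close>

lemma card_walks_end:
  assumes "finite A"
  shows "finite {\<beta> \<in> walks d n. \<beta> n = A} \<and>
    card {\<beta> \<in> walks d n. \<beta> n = A} = (\<Sum>i\<le>n. (n choose i) * chains d i A)"
  using assms
proof (induction n arbitrary: A)
  case 0
  have "\<beta> = (\<lambda>_. {..<d})" if "\<beta> \<in> walks d 0" for \<beta>
    using fun_eq_horizon[OF walksD(3)[OF that] fixed_after_const] walksD(1)[OF that] by simp
  then have "walks d 0 = {\<lambda>_. {..<d}}" by (auto simp: walks_def walk_def fixed_after_const)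
  then have "{\<beta> \<in> walks d 0. \<beta> 0 = A} = (if A = {..<d} then {\<lambda>_. {..<d}} else {})" by auto
  then show ?case by simp
next
  case (Suc n)
  define S where "S B = {\<beta> \<in> walks d n. \<beta> n = B}" for B
  define g where "g = (\<lambda>(\<beta> :: nat \<Rightarrow> nat set) j. if j \<le> n then \<beta> j else A)"
  define c where "c B = (\<Sum>i\<le>n. (n choose i) * chains d i B)" for B
  have fP: "finite {B. cov B A}" by (rule finite_pred[OF Suc.prems])
  have S: "finite (S B) \<and> card (S B) = c B" if "B \<in> insert A {B. cov B A}" for B
    using Suc.IH[of B] that cov_finite Suc.prems unfolding S_def c_def by blast
  have inj: "inj_on g (walks d n)"
  proof (rule inj_onI)
    fix \<beta> \<beta>' assume b: "\<beta> \<in> walks d n" "\<beta>' \<in> walks d n" "g \<beta> = g \<beta>'"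
    have "\<beta> j = \<beta>' j" if "j \<le> n" for j using fun_cong[OF b(3), of j] that by (simp add: g_def)
    then show "\<beta> = \<beta>'" using fun_eq_horizon[OF walksD(3)[OF b(1)] walksD(3)[OF b(2)]] by blast
  qed
  have gn: "g \<beta> n = \<beta> n" for \<beta> by (simp add: g_def)
  have "x n = B" if "x \<in> g ` S B" for x B using that gn by (auto simp: S_def)
  then have disj: "g ` S B \<inter> g ` S C = {}" if "B \<noteq> C" for B C using that by blast
  have cg: "card (g ` S B) = card (S B)" for B
    by (rule card_image, rule inj_on_subset[OF inj]) (auto simp: S_def)
  have eq: "{\<beta> \<in> walks d (Suc n). \<beta> (Suc n) = A} = (\<Union>B\<in>insert A {B. cov B A}. g ` S B)"
    unfolding walks_Suc_end g_def S_def ..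
  have "card {\<beta> \<in> walks d (Suc n). \<beta> (Suc n) = A} = (\<Sum>B\<in>insert A {B. cov B A}. card (g ` S B))"
    unfolding eq by (intro card_UN_disjoint) (use fP S disj in auto)
  also have "\<dots> = (\<Sum>B\<in>insert A {B. cov B A}. c B)" unfolding cg using S by (intro sum.cong) auto
  also have "\<dots> = c A + (\<Sum>B | cov B A. c B)" using fP not_cov_refl by simp
  also have "(\<Sum>B | cov B A. c B) = (\<Sum>i\<le>n. (n choose i) * chains d (Suc i) A)"
    unfolding c_def by (subst sum.swap) (simp add: sum_distrib_left)
  also have "c A + \<dots> = (\<Sum>i\<le>Suc n. (Suc n choose i) * chains d i A)"
    unfolding c_def sum_binomial_Suc ..
  finally have "card {\<beta> \<in> walks d (Suc n). \<beta> (Suc n) = A} = \<dots>" .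
  moreover have "finite {\<beta> \<in> walks d (Suc n). \<beta> (Suc n) = A}"
    unfolding eq by (intro finite_UN_I finite_imageI) (use fP S in simp_all)
  ultimately show ?case by (intro conjI)
qed

text \<open>Group the sequences by the final shape \<open>A\<close>: there are
  \<open>(n choose i) * chains d i A\<close> walks ending in \<open>A\<close>, and each has a fibre
  of size \<open>chains d i A\<close>.\<close>

lemma card_no_inc_length:
  "finite {p \<in> no_inc d n. length p = i} \<and>
    card {p \<in> no_inc d n. length p = i} = (n choose i) * sq_sum d i"
proof -
  define W where "W A = {\<beta> \<in> walks d n. \<beta> n = A}" for A
  define F where "F \<beta> = {p. length p = i \<and> rsk d n p \<beta>}" for \<beta>
  have Y: "finite A" if "A \<in> shapes d i" for A using that by (simp add: shapes_def)
  have W: "finite (W A)" "card (W A) = (\<Sum>i\<le>n. (n choose i) * chains d i A)" if "A \<in> shapes d i" for A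
    using card_walks_end[OF Y[OF that]] by (simp_all add: W_def)
  have F: "finite (F \<beta>)" "card (F \<beta>) = chains d i A" if "\<beta> \<in> W A" for \<beta> A
    using card_rsk_fibre[of \<beta> d n i] that by (auto simp: F_def W_def)
  have eq: "{p \<in> no_inc d n. length p = i} = (\<Union>A\<in>shapes d i. \<Union>\<beta>\<in>W A. F \<beta>)"
  proof (intro equalityI subsetI)
    fix p assume p: "p \<in> {p \<in> no_inc d n. length p = i}"
    then obtain \<beta> where b: "rsk d n p \<beta>" using rsk_ex[of p n d] by (auto simp: no_inc_def)
    then have w: "\<beta> \<in> W (\<beta> n)" "p \<in> F \<beta>" using rsk_walks p by (auto simp: W_def F_def)
    then have "card (F \<beta>) \<noteq> 0" using F(1)[OF w(1)] by auto
    then have "\<beta> n \<in> shapes d i" using F(2)[OF w(1)] chains_shapes by simp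
    then show "p \<in> (\<Union>A\<in>shapes d i. \<Union>\<beta>\<in>W A. F \<beta>)" using w by blast
  next
    fix p assume "p \<in> (\<Union>A\<in>shapes d i. \<Union>\<beta>\<in>W A. F \<beta>)"
    then obtain \<beta> where "length p = i" "rsk d n p \<beta>" by (auto simp: F_def)
    then show "p \<in> {p \<in> no_inc d n. length p = i}"
      using rsk_valid[of d n p \<beta>] by (simp add: no_inc_def)
  qed
  have disjF: "F \<beta> \<inter> F \<beta>' = {}" if "\<beta> \<noteq> \<beta>'" for \<beta> \<beta>' using that rsk_unique unfolding F_def by blast
  have WF: "finite (\<Union>\<beta>\<in>W A. F \<beta>)" "card (\<Union>\<beta>\<in>W A. F \<beta>) = card (W A) * chains d i A"
    if "A \<in> shapes d i" for A
  proof -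
    show "finite (\<Union>\<beta>\<in>W A. F \<beta>)" using W(1)[OF that] F(1) by blast
    have "card (\<Union>\<beta>\<in>W A. F \<beta>) = (\<Sum>\<beta>\<in>W A. card (F \<beta>))"
      by (intro card_UN_disjoint) (use W(1)[OF that] F(1) disjF in auto)
    also have "\<dots> = card (W A) * chains d i A" using F(2) by simp
    finally show "card (\<Union>\<beta>\<in>W A. F \<beta>) = card (W A) * chains d i A" .
  qed
  have "card {p \<in> no_inc d n. length p = i} = (\<Sum>A\<in>shapes d i. card (\<Union>\<beta>\<in>W A. F \<beta>))"
    unfolding eq
  proof (intro card_UN_disjoint ballI impI)
    fix A B :: "nat set" assume "A \<noteq> B"
    then have "\<beta> \<noteq> \<beta>'" if "\<beta> \<in> W A" "\<beta>' \<in> W B" for \<beta> \<beta>' using that by (auto simp: W_def)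
    then show "(\<Union>\<beta>\<in>W A. F \<beta>) \<inter> (\<Union>\<beta>\<in>W B. F \<beta>) = {}" using disjF by blast
  qed (use finite_shapes WF in auto)
  also have "\<dots> = (\<Sum>A\<in>shapes d i. (n choose i) * (chains d i A)\<^sup>2)"
  proof (rule sum.cong[OF refl])
    fix A assume A: "A \<in> shapes d i"
    \<comment> \<open>The shape fixes its number of boxes, so only one term of the formula for walks
      survives.\<close>
    have "chains d j A = 0" if "j \<noteq> i" for j using chains_shapes[of d j A] A that by (auto simp: shapes_def)
    then have "(\<Sum>j\<le>n. (n choose j) * chains d j A) = (\<Sum>j\<le>n. if j = i then (n choose i) * chains d i A else 0)"
      by (intro sum.cong) auto
    also have "\<dots> = (n choose i) * chains d i A" by (cases "i \<le> n") simp_all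
    finally show "card (\<Union>\<beta>\<in>W A. F \<beta>) = (n choose i) * (chains d i A)\<^sup>2"
      using WF(2)[OF A] W(2)[OF A] by (simp add: power2_eq_square)
  qed
  also have "\<dots> = (n choose i) * sq_sum d i" by (simp add: sq_sum_def sum_distrib_left)
  finally have "card {p \<in> no_inc d n. length p = i} = \<dots>" .
  moreover have "finite {p \<in> no_inc d n. length p = i}"
    unfolding eq by (intro finite_UN_I finite_shapes WF)
  ultimately show ?thesis by simp
qed

lemma card_no_inc:
  "finite (no_inc d n)" "card (no_inc d n) = (\<Sum>i\<le>n. (n choose i) * sq_sum d i)"
proof -
  have eq: "no_inc d n = (\<Union>i\<in>{..n}. {p \<in> no_inc d n. length p = i})"
  proof -
    have "length p \<le> n" if "p \<in> no_inc d n" for p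
      using that card_mono[of "{..<n}" "set p"] distinct_card[of p] by (auto simp: no_inc_def)
    then show ?thesis by auto
  qed
  show "finite (no_inc d n)" by (subst eq) (use card_no_inc_length in blast)
  have "card (no_inc d n) = (\<Sum>i\<le>n. card {p \<in> no_inc d n. length p = i})"
    by (subst eq, intro card_UN_disjoint) (use card_no_inc_length in auto)
  then show "card (no_inc d n) = (\<Sum>i\<le>n. (n choose i) * sq_sum d i)"
    using card_no_inc_length by simp
qed

subsection \<open>The product formula for chains\<close>

lemma prod_linear_poly_degree:
  fixes f :: "'a \<Rightarrow> real"
  assumes "finite B"
  shows "degree (\<Prod>c\<in>B. [:- f c, 1:]) = card B" "coeff (\<Prod>c\<in>B. [:- f c, 1:]) (card B) = 1"
proof -
  show d: "degree (\<Prod>c\<in>B. [:- f c, 1:]) = card B"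
    by (subst degree_prod_eq_sum_degree) simp_all
  show "coeff (\<Prod>c\<in>B. [:- f c, 1:]) (card B) = 1"
    using lead_coeff_prod[of "\<lambda>c. [:- f c, 1:]" B] by (simp add: d)
qed

text \<open>\<open>h\<close> equals its Lagrange interpolant at \<open>B\<close>, each of whose
  basis polynomials is a monic polynomial of degree \<open>card B - 1\<close> divided by its value
  at its own node.\<close>

lemma lagrange_leading_coeff:
  fixes h :: "real poly"
  assumes "finite B" "degree h < card B"
  shows "coeff h (card B - 1) = (\<Sum>b\<in>B. poly h b / (\<Prod>c\<in>B - {b}. (b - c)))"
proof -
  define w where "w b = (\<Prod>c\<in>B - {b}. (b - c))" for b
  define l where "l b = (\<Prod>c\<in>B - {b}. [:- c, 1:])" for b
  define q where "q = (\<Sum>b\<in>B. smult (poly h b / w b) (l b))"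
  have pl: "poly (l b) x = (\<Prod>c\<in>B - {b}. (x - c))" for b x by (simp add: l_def poly_prod)
  have w: "w b \<noteq> 0" for b using assms(1) by (auto simp: w_def)
  have dl: "degree (l b) = card B - 1" "coeff (l b) (card B - 1) = 1" if "b \<in> B" for b
    using prod_linear_poly_degree[of "B - {b}" "\<lambda>c. c"] assms(1) that by (simp_all add: l_def)
  have dq: "degree q < card B" unfolding q_def
    by (rule degree_sum_less) (use assms dl in \<open>auto intro: le_less_trans[OF degree_smult_le]\<close>)
  have "poly q x = poly h x" if x: "x \<in> B" for x
  proof -
    have "poly q x = (\<Sum>b\<in>B. poly h b / w b * poly (l b) x)" by (simp add: q_def poly_sum)
    also have "\<dots> = (\<Sum>b\<in>B. if b = x then poly h x else 0)"
    proof (rule sum.cong[OF refl])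
      fix b assume "b \<in> B"
      show "poly h b / w b * poly (l b) x = (if b = x then poly h x else 0)"
      proof (cases "b = x")
        case True
        then show ?thesis using w[of x] by (simp add: pl w_def)
      next
        case False
        then have "poly (l b) x = 0" using assms(1) x by (auto simp: pl)
        then show ?thesis using False by simp
      qed
    qed
    also have "\<dots> = poly h x" using assms(1) x by simp
    finally show ?thesis .
  qed
  then have "q = h" by (intro poly_eqI_degree[of B]) (use dq assms in auto)
  have "coeff q (card B - 1) = (\<Sum>b\<in>B. poly h b / w b * coeff (l b) (card B - 1))"
    by (simp add: q_def coeff_sum)
  also have "\<dots> = (\<Sum>b\<in>B. poly h b / (\<Prod>c\<in>B - {b}. (b - c)))" using dl by (simp add: w_def)
  finally show ?thesis unfolding \<open>q = h\<close> .
qed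

text \<open>These are the first elementary symmetric sum, and the changes of the first two under the
  shift of all roots by 1. The factors \<open>pCons 0\<close>, that is multiplication by the
  variable, let every coefficient be read at index \<open>card B\<close>, without subtraction on
  indices and without special cases for small \<open>B\<close>.\<close>

lemma prod_linear_poly_shift_coeffs:
  fixes B :: "real set"
  assumes "finite B"
  defines "P \<equiv> (\<Prod>c\<in>B. [:- c, 1:])" and "Q \<equiv> (\<Prod>c\<in>B. [:- (c + 1), 1:])"
    and "n \<equiv> real (card B)"
  shows "coeff (pCons 0 P) (card B) = - \<Sum>B" (is ?P)
    and "coeff (pCons 0 (Q - P)) (card B) = - n" (is ?Q)
    and "coeff (pCons 0 (pCons 0 (Q - P))) (card B) = (n - 1) * \<Sum>B + n * (n - 1) / 2" (is ?R)
proof -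
  have "?P \<and> ?Q \<and> ?R" unfolding P_def Q_def n_def using assms(1)
  proof induction
    case (insert b B)
    define P Q where "P = (\<Prod>c\<in>B. [:- c, 1:])" and "Q = (\<Prod>c\<in>B. [:- (c + 1), 1:])"
    define n where "n = real (card B)"
    have lin: "[:- c, 1:] * p = pCons 0 p - smult c p" for c and p :: "real poly" by simp
    have P': "(\<Prod>c\<in>insert b B. [:- c, 1:]) = pCons 0 P - smult b P"
      unfolding P_def using insert.hyps lin by simp
    have Q': "(\<Prod>c\<in>insert b B. [:- (c + 1), 1:]) = pCons 0 Q - smult (b + 1) Q"
      unfolding Q_def using insert.hyps lin[of "b + 1"] by simp
    have D': "(\<Prod>c\<in>insert b B. [:- (c + 1), 1:]) - (\<Prod>c\<in>insert b B. [:- c, 1:]) =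
        pCons 0 (Q - P) - smult b (Q - P) - Q"
    proof -
      have "pCons 0 (Q - P) = pCons 0 Q - pCons 0 P" by simp
      then show ?thesis unfolding P' Q' by (simp only:) (simp add: smult_diff_right smult_add_left)
    qed
    have lead: "coeff P (card B) = 1" "coeff Q (card B) = 1"
      unfolding P_def Q_def by (rule prod_linear_poly_degree(2)[OF insert.hyps(1)])+
    have IH: "coeff (pCons 0 P) (card B) = - \<Sum>B" "coeff (pCons 0 (Q - P)) (card B) = - n"
      "coeff (pCons 0 (pCons 0 (Q - P))) (card B) = (n - 1) * \<Sum>B + n * (n - 1) / 2"
      using insert.IH by (simp_all only: P_def Q_def n_def)
    have cQ: "coeff (pCons 0 Q) (card B) = - n - \<Sum>B"
    proof -
      have "pCons 0 Q = pCons 0 (Q - P) + pCons 0 P" by simp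
      then show ?thesis using IH(1,2) by (metis (no_types, lifting) coeff_add add_uminus_conv_diff)
    qed
    have "pCons 0 (pCons 0 (Q - P) - smult b (Q - P) - Q) =
        pCons 0 (pCons 0 (Q - P)) - smult b (pCons 0 (Q - P)) - pCons 0 Q" by simp
    then have "coeff (pCons 0 (pCons 0 (Q - P) - smult b (Q - P) - Q)) (card B) =
        (n - 1) * \<Sum>B + n * (n - 1) / 2 + b * n + n + \<Sum>B"
      by (simp only: coeff_diff coeff_smult IH cQ)
    moreover have "card (insert b B) = Suc (card B)" "\<Sum>(insert b B) = b + \<Sum>B"
      using insert.hyps by simp_all
    ultimately show ?case unfolding D' using IH(1,2) lead
      by (simp add: P' n_def[symmetric] field_simps)
  qed simp
  then show ?P ?Q ?R by simp_all
qed

text \<open>Lagrange interpolation of \<open>x * Q x - (x - n) * P x\<close> at the roots of \<open>P x = (\<Prod>c\<in>B. x - c)\<close>, where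
  \<open>Q x = P (x - 1)\<close>.\<close>

lemma sum_shift_quotients:
  fixes B :: "real set"
  assumes "finite B"
  shows "(\<Sum>b\<in>B. b * (\<Prod>c\<in>B - {b}. (b - 1 - c) / (b - c))) =
    \<Sum>B - real (card B) * (real (card B) - 1) / 2"
proof (cases "B = {}")
  case False
  define n where "n = real (card B)"
  define P Q where "P = (\<Prod>c\<in>B. [:- c, 1:])" and "Q = (\<Prod>c\<in>B. [:- (c + 1), 1:])"
  define h where "h = pCons 0 (Q - P) + smult n P"
  have pos: "card B > 0" using assms False by (simp add: card_gt_0_iff)
  note c = prod_linear_poly_shift_coeffs[OF assms, folded P_def Q_def n_def]
  have d: "degree P = card B" "degree Q = card B" "coeff P (card B) = 1" "coeff Q (card B) = 1"
    unfolding P_def Q_def by (rule prod_linear_poly_degree[OF assms])+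
  \<comment> \<open>In \<open>Q - P\<close> the leading terms cancel, and the multiple
    \<open>n\<close> of \<open>P\<close> is chosen to cancel the coefficient at
    \<open>card B\<close>; so \<open>card B\<close> nodes suffice for the interpolation.\<close>
  have "coeff h m = 0" if "m \<ge> card B" for m
  proof (cases "m = card B")
    case True
    then show ?thesis using c(2) d(3) by (simp add: h_def)
  next
    case False
    then obtain k where "m = Suc k" "k \<ge> card B" using \<open>m \<ge> card B\<close> by (cases m) auto
    then show ?thesis using d by (cases "k = card B") (auto simp: h_def coeff_eq_0)
  qed
  then have dh: "degree h < card B" using pos by (metis leading_coeff_0_iff degree_0 not_less)
  have "coeff h (card B - 1) = coeff (pCons 0 h) (card B)" using pos by (cases "card B") auto
  also have "pCons 0 h = pCons 0 (pCons 0 (Q - P)) + smult n (pCons 0 P)" by (simp add: h_def)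
  also have "coeff \<dots> (card B) = n * (n - 1) / 2 - \<Sum>B" 
    by (simp only: coeff_add coeff_smult c) (simp add: field_simps)
  finally have "n * (n - 1) / 2 - \<Sum>B = (\<Sum>b\<in>B. poly h b / (\<Prod>c\<in>B - {b}. (b - c)))"
    using lagrange_leading_coeff[OF assms dh] by simp
  also have "\<dots> = (\<Sum>b\<in>B. - (b * (\<Prod>c\<in>B - {b}. (b - 1 - c) / (b - c))))"
  proof (rule sum.cong[OF refl])
    fix b assume b: "b \<in> B"
    have "poly P b = 0" using assms b by (auto simp: P_def poly_prod)
    then have "poly h b = b * poly Q b" by (simp add: h_def)
    also have "poly Q b = (\<Prod>c\<in>B. (b - 1 - c))" by (simp add: Q_def poly_prod algebra_simps)
    also have "\<dots> = (b - 1 - b) * (\<Prod>c\<in>B - {b}. (b - 1 - c))" by (rule prod.remove[OF assms b])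
    also have "b - 1 - b = - 1" by simp
    finally show "poly h b / (\<Prod>c\<in>B - {b}. (b - c)) = - (b * (\<Prod>c\<in>B - {b}. (b - 1 - c) / (b - c)))"
      by (simp add: prod_dividef algebra_simps)
  qed
  finally show ?thesis by (simp add: sum_negf n_def)
qed simp

section \<open>The Vandermonde product and the tableau count\<close>

definition vandermonde :: "nat set \<Rightarrow> real" where
  "vandermonde A = (\<Prod>(x, y)\<in>{(x, y). x \<in> A \<and> y \<in> A \<and> x < y}. real y - real x)"

lemma finite_less_pairs: "finite A \<Longrightarrow> finite {(x, y). x \<in> A \<and> y \<in> A \<and> x < (y :: nat)}"
  by (rule finite_subset[of _ "A \<times> A"]) auto

lemma vandermonde_pos: "vandermonde A > 0"
  unfolding vandermonde_def by (rule prod_pos) auto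

lemma vandermonde_insert:
  assumes "finite S" "b \<notin> S"
  shows "vandermonde (insert b S) = vandermonde S * (\<Prod>c\<in>S. \<bar>real b - real c\<bar>)"
proof -
  define f where "f c = (min b c, max b c)" for c
  define g where "g = (\<lambda>(x, y). real y - real x)"
  define T where "T S = {(x, y). x \<in> S \<and> y \<in> S \<and> x < (y :: nat)}" for S
  have eq: "T (insert b S) = T S \<union> f ` S"
  proof (intro equalityI subsetI)
    fix p assume "p \<in> T (insert b S)"
    then obtain x y where p: "p = (x, y)" "x \<in> insert b S" "y \<in> insert b S" "x < y" by (auto simp: T_def)
    then consider "x \<in> S" "y \<in> S" | "x = b" "y \<in> S" | "y = b" "x \<in> S" by auto
    then show "p \<in> T S \<union> f ` S"
    proof cases
      case 2
      then have "p = f y" using p by (simp add: f_def)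
      then show ?thesis using 2 by blast
    next
      case 3
      then have "p = f x" using p by (simp add: f_def)
      then show ?thesis using 3 by blast
    qed (use p in \<open>simp add: T_def\<close>)
  next
    fix p assume "p \<in> T S \<union> f ` S"
    moreover have "f c \<in> T (insert b S)" if "c \<in> S" for c
      using that assms(2) by (cases b c rule: linorder_cases) (auto simp: T_def f_def)
    moreover have "T S \<subseteq> T (insert b S)" by (auto simp: T_def)
    ultimately show "p \<in> T (insert b S)" by blast
  qed
  have "f c \<notin> T S" for c
    using assms(2) by (cases "b \<le> c") (auto simp: T_def f_def)
  then have disj: "T S \<inter> f ` S = {}" by blast
  have inj: "inj_on f S" by (auto simp: inj_on_def f_def min_def max_def split: if_splits)
  have "prod g (T (insert b S)) = prod g (T S) * prod g (f ` S)"
    unfolding eq by (rule prod.union_disjoint) (use assms(1) finite_less_pairs disj in \<open>auto simp: T_def\<close>)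
  also have "prod g (f ` S) = (\<Prod>c\<in>S. \<bar>real b - real c\<bar>)"
    unfolding prod.reindex[OF inj] by (rule prod.cong) (auto simp: g_def f_def min_def max_def)
  finally show ?thesis by (simp add: vandermonde_def g_def T_def)
qed

text \<open>Identifies the empty shape as the only one without boxes. Induction by removing the
  maximum, which is at least \<open>card A - 1\<close>.\<close>

lemma sum_ge_sum_lessThan:
  assumes "finite A" "card A = d"
  shows "\<Sum>{..<d} \<le> \<Sum>A" "\<Sum>A = \<Sum>{..<d} \<Longrightarrow> A = {..<d}"
proof -
  have "\<Sum>{..<d} \<le> \<Sum>A \<and> (\<Sum>A = \<Sum>{..<d} \<longrightarrow> A = {..<d})"
    using assms
  proof (induction d arbitrary: A)
    case (Suc d)
    have ne: "A \<noteq> {}" using Suc.prems(2) by auto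
    define m where "m = Max A"
    have m: "m \<in> A" "A \<subseteq> {..m}" unfolding m_def using Max_in[OF Suc.prems(1) ne] Max_ge[OF Suc.prems(1)] by auto
    have "d \<le> m" using card_mono[OF finite_atMost m(2)] Suc.prems(2) by simp
    have "finite (A - {m})" "card (A - {m}) = d" using Suc.prems m(1) by simp_all
    from Suc.IH[OF this]
    have IH: "\<Sum>{..<d} \<le> \<Sum>(A - {m})" "\<Sum>(A - {m}) = \<Sum>{..<d} \<Longrightarrow> A - {m} = {..<d}" by blast+
    have s: "\<Sum>A = m + \<Sum>(A - {m})" by (rule sum.remove[OF Suc.prems(1) m(1)])
    have s': "\<Sum>{..<Suc d} = d + \<Sum>{..<d}" by simp
    have "A = {..<Suc d}" if eq: "\<Sum>A = \<Sum>{..<Suc d}"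
    proof -
      have md: "\<Sum>(A - {m}) = \<Sum>{..<d}" "m = d" using eq s s' IH(1) \<open>d \<le> m\<close> by linarith+
      have "A = insert m (A - {m})" using m(1) by blast
      also have "\<dots> = insert m {..<d}" by (simp only: IH(2)[OF md(1)])
      also have "\<dots> = {..<Suc d}" by (simp only: md(2) lessThan_Suc)
      finally show ?thesis .
    qed
    moreover have "\<Sum>{..<Suc d} \<le> \<Sum>A" using s s' IH(1) \<open>d \<le> m\<close> by linarith
    ultimately show ?case by blast
  qed simp
  then show "\<Sum>{..<d} \<le> \<Sum>A" "\<Sum>A = \<Sum>{..<d} \<Longrightarrow> A = {..<d}" by simp_all
qed

text \<open>Frobenius's determinantal form of the hook length formula: the tableau count divided by
  the factorial of the number of boxes, up to normalization.\<close>

definition shape_weight :: "nat set \<Rightarrow> real" where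
  "shape_weight A = vandermonde A / (\<Prod>a\<in>A. fact a)"

lemma shape_weight_pos: "shape_weight A > 0"
  unfolding shape_weight_def by (intro divide_pos_pos vandermonde_pos prod_pos) auto

text \<open>Moving the particle \<open>Suc a\<close> back to \<open>a\<close> changes only its own
  factors. No other particle is at \<open>a\<close> or \<open>Suc a\<close>, so corresponding
  differences have equal signs and the absolute values drop out of the quotients.\<close>

lemma shape_weight_pred:
  assumes "finite A" "Suc a \<in> A" "a \<notin> A"
  shows "shape_weight (insert a (A - {Suc a})) =
    shape_weight A * (real (Suc a) * (\<Prod>c\<in>A - {Suc a}. (real (Suc a) - 1 - real c) / (real (Suc a) - real c)))"
proof -
  define S where "S = A - {Suc a}"
  have S: "finite S" "Suc a \<notin> S" "a \<notin> S" "A = insert (Suc a) S" using assms by (auto simp: S_def)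
  define p q where "p = (\<Prod>c\<in>S. \<bar>real a - real c\<bar>)" and "q = (\<Prod>c\<in>S. \<bar>real (Suc a) - real c\<bar>)"
  have "0 < \<bar>real (Suc a) - real c\<bar>" if "c \<in> S" for c
    using that S(2) by (auto simp del: of_nat_Suc)
  then have q: "q > 0" unfolding q_def by (rule prod_pos)
  define r where "r = (\<Prod>c\<in>S. (real (Suc a) - 1 - real c) / (real (Suc a) - real c))"
  define Z :: real where "Z = (\<Prod>x\<in>insert a S. fact x)"
  have r: "p / q = r"
    unfolding r_def p_def q_def prod_dividef[symmetric]
  proof (rule prod.cong[OF refl])
    fix c assume "c \<in> S"
    then have "c \<noteq> a" "c \<noteq> Suc a" using S(2,3) by auto
    then consider "c < a" | "Suc a < c" by linarith
    then show "\<bar>real a - real c\<bar> / \<bar>real (Suc a) - real c\<bar> =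
        (real (Suc a) - 1 - real c) / (real (Suc a) - real c)"
    proof cases
      case 1
      then have "\<bar>real a - real c\<bar> = real a - real c" "\<bar>real (Suc a) - real c\<bar> = real (Suc a) - real c"
        by simp_all
      then show ?thesis by simp
    next
      case 2
      then have "\<bar>real a - real c\<bar> = - (real a - real c)" "\<bar>real (Suc a) - real c\<bar> = - (real (Suc a) - real c)"
        by simp_all
      then show ?thesis by (simp only: minus_divide_divide) simp
    qed
  qed
  have v: "vandermonde (insert a S) = vandermonde A * r"
    using q vandermonde_insert[OF S(1,2)] vandermonde_insert[OF S(1,3)]
    by (simp add: S(4) p_def q_def flip: r)
  have Z: "(\<Prod>x\<in>A. fact x :: real) = real (Suc a) * Z"
    unfolding Z_def S(4) using S(1-3) by simp
  have "vandermonde A * r / Z = vandermonde A / (s * Z) * (s * r)" if "s \<noteq> 0" for s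
    using that by simp
  from this[of "real (Suc a)"] show ?thesis
    unfolding shape_weight_def S_def[symmetric] r_def[symmetric] Z Z_def[symmetric] v by simp
qed

text \<open>The hook length formula, up to the constant factor \<open>shape_weight {..<d}\<close>.\<close>

lemma chains_eq_shape_weight:
  assumes "A \<in> shapes d i"
  shows "real (chains d i A) = fact i * shape_weight A / shape_weight {..<d}"
  using assms
proof (induction i arbitrary: A)
  case 0
  then have "A = {..<d}" using sum_ge_sum_lessThan(2)[of A d] by (simp add: shapes_def)
  then show ?case using shape_weight_pos[of "{..<d}"] by simp
next
  case (Suc i)
  have fin: "finite A" "card A = d" "\<Sum>A = Suc i + \<Sum>{..<d}" using Suc.prems by (simp_all add: shapes_def)
  define w where "w = shape_weight {..<d}"
  define F where "F b = b * (\<Prod>c\<in>real ` A - {b}. (b - 1 - c) / (b - c))" for b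
  define M where "M = {a. Suc a \<in> A \<and> a \<notin> A}"
  have "finite (Suc -` A)" by (rule finite_vimageI[OF fin(1)]) simp
  then have finM: "finite M" by (rule finite_subset[rotated]) (auto simp: M_def)
  have pred: "{B. cov B A} = (\<lambda>a. insert a (A - {Suc a})) ` M"
  proof (intro equalityI subsetI)
    fix B assume "B \<in> {B. cov B A}"
    then obtain a where a: "movable a B" "A = mv a B" by (auto simp: cov_def)
    have "a \<in> M" using a(1) unfolding a(2) M_def by (auto simp: mv_def)
    then show "B \<in> (\<lambda>a. insert a (A - {Suc a})) ` M" using mv_undo[OF a(1)] a(2) by blast
  next
    fix B assume "B \<in> (\<lambda>a. insert a (A - {Suc a})) ` M"
    then obtain a where a: "Suc a \<in> A" "a \<notin> A" "B = insert a (A - {Suc a})" by (auto simp: M_def)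
    then have "movable a B" "A = mv a B" by (auto simp: movable_def mv_def)
    then show "B \<in> {B. cov B A}" by (auto simp: cov_def)
  qed
  have inj: "inj_on (\<lambda>a. insert a (A - {Suc a})) M"
  proof (rule inj_onI)
    fix a b assume "a \<in> M" "b \<in> M" "insert a (A - {Suc a}) = insert b (A - {Suc b})"
    then have "a \<in> insert b (A - {Suc b})" "a \<notin> A" by (auto simp: M_def)
    then show "a = b" by auto
  qed
  have "real (chains d (Suc i) A) = (\<Sum>B | cov B A. real (chains d i B))" by simp
  also have "\<dots> = (\<Sum>B | cov B A. fact i * shape_weight B / w)"
    using Suc.IH shapes_cov Suc.prems by (intro sum.cong) (auto simp: w_def)
  also have "\<dots> = (\<Sum>a\<in>M. fact i * shape_weight (insert a (A - {Suc a})) / w)"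
    unfolding pred by (subst sum.reindex[OF inj]) simp
  also have "\<dots> = (\<Sum>a\<in>M. fact i * shape_weight A / w * F (real (Suc a)))"
  proof (rule sum.cong[OF refl])
    fix a assume "a \<in> M"
    then have a: "Suc a \<in> A" "a \<notin> A" by (auto simp: M_def)
    have "real ` A - {real (Suc a)} = real ` (A - {Suc a})" by auto
    then have "F (real (Suc a)) =
        real (Suc a) * (\<Prod>c\<in>A - {Suc a}. (real (Suc a) - 1 - real c) / (real (Suc a) - real c))"
      unfolding F_def by (simp add: prod.reindex)
    then show "fact i * shape_weight (insert a (A - {Suc a})) / w = fact i * shape_weight A / w * F (real (Suc a))"
      using shape_weight_pred[OF fin(1) a] by simp
  qed
  also have "\<dots> = fact i * shape_weight A / w * (\<Sum>a\<in>M. F (real (Suc a)))"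
    by (simp add: sum_distrib_left)
  also have "(\<Sum>a\<in>M. F (real (Suc a))) = (\<Sum>b\<in>(\<lambda>a. real (Suc a)) ` M. F b)"
    by (subst sum.reindex) (auto simp: inj_on_def)
  \<comment> \<open>The sum may run over all particles, including those that cannot move back: if
    the site below is occupied, a factor of the product vanishes, and for the particle at 0 the
    leading factor does.\<close>
  also have "\<dots> = (\<Sum>b\<in>real ` A. F b)"
  proof (rule sum.mono_neutral_left)
    show "finite (real ` A)" using fin by simp
    show "(\<lambda>a. real (Suc a)) ` M \<subseteq> real ` A"
      by (auto simp: M_def simp del: of_nat_Suc)
    show "\<forall>b\<in>real ` A - (\<lambda>a. real (Suc a)) ` M. F b = 0"
    proof
      fix b assume b: "b \<in> real ` A - (\<lambda>a. real (Suc a)) ` M"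
      then obtain x where x: "x \<in> A" "b = real x" by auto
      show "F b = 0"
      proof (cases x)
        case (Suc a)
        then have "a \<notin> M" using b x by auto
        then have "a \<in> A" using x Suc by (auto simp: M_def)
        then have "real a \<in> real ` A - {b}" using x Suc by auto
        moreover have "b - 1 - real a = 0" using x Suc by simp
        ultimately show ?thesis unfolding F_def using fin(1) by (auto intro!: prod_zero)
      qed (simp add: F_def x)
    qed
  qed
  also have "\<dots> = \<Sum>(real ` A) - real d * (real d - 1) / 2"
    unfolding F_def using sum_shift_quotients[of "real ` A"] fin by (simp add: card_image)
  also have "\<Sum>(real ` A) = real (\<Sum>A)" by (simp add: sum.reindex)
  \<comment> \<open>After subtracting the sum of the empty shape, the number \<open>Suc i\<close> of
    boxes is left, which turns \<open>fact i\<close> into \<open>fact (Suc i)\<close>.\<close>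
  also have "real (\<Sum>A) = real (Suc i) + real d * (real d - 1) / 2"
  proof -
    have "real (\<Sum>{..<d}) = real d * (real d - 1) / 2" by (induction d) (simp_all add: field_simps)
    then show ?thesis using fin(3) by simp
  qed
  finally show ?case by (simp add: w_def)
qed

subsection \<open>Factorials and multinomial sums\<close>

lemma ln_ge_quotient:
  fixes x :: real
  assumes "x \<ge> 1" shows "2 * (x - 1) / (x + 1) \<le> ln x"
proof -
  define f where "f x = ln x * (x + 1) - 2 * x" for x :: real
  have "f 1 \<le> f x"
  proof (rule DERIV_nonneg_imp_nondecreasing[OF assms])
    fix t :: real assume t: "1 \<le> t" "t \<le> x"
    have "(f has_real_derivative ln t + 1 / t - 1) (at t)"
      unfolding f_def using t by (auto intro!: derivative_eq_intros) (simp add: field_simps)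
    moreover have "ln t + 1 / t - 1 \<ge> 0" using ln_le_minus_one[of "1 / t"] t by (simp add: ln_div)
    ultimately show "\<exists>y. (f has_real_derivative y) (at t) \<and> 0 \<le> y" by blast
  qed
  then show ?thesis using assms by (simp add: f_def pos_divide_le_eq)
qed

lemma ln_le_half_diff:
  fixes x :: real
  assumes "x \<ge> 1" shows "ln x \<le> (x - 1 / x) / 2"
proof -
  define f where "f x = x * x - 2 * (x * ln x)" for x :: real
  have "f 1 \<le> f x"
  proof (rule DERIV_nonneg_imp_nondecreasing[OF assms])
    fix t :: real assume t: "1 \<le> t" "t \<le> x"
    have "(f has_real_derivative 2 * (t - 1 - ln t)) (at t)"
      unfolding f_def using t by (auto intro!: derivative_eq_intros)
    moreover have "2 * (t - 1 - ln t) \<ge> 0" using ln_le_minus_one[of t] t by simp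
    ultimately show "\<exists>y. (f has_real_derivative y) (at t) \<and> 0 \<le> y" by blast
  qed
  then have "1 + 2 * (x * ln x) \<le> x * x" by (simp add: f_def)
  then show ?thesis using assms by (simp add: field_simps)
qed

text \<open>\<open>L\<close> decreases from \<open>L 1 = 1\<close>, and by the two logarithm
  estimates each step loses at most 1/(4n) - 1/(4(n+1)). The term 1/(4n) in the lower bound makes
  these losses telescope.\<close>

lemma ln_fact_stirling:
  assumes "n \<ge> 1"
  defines "L \<equiv> \<lambda>n. ln (fact n) + real n - (real n + 1 / 2) * ln (real n)"
  shows "3 / 4 + 1 / (4 * real n) \<le> L n" "L n \<le> 1"
proof -
  have "3 / 4 + 1 / (4 * real n) \<le> L n \<and> L n \<le> 1" using assms(1)
  proof (induction n rule: dec_induct)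
    case base
    show ?case by (simp add: L_def)
  next
    case (step n)
    define x where "x = (real n + 1) / real n"
    have n: "real n > 0" using step.hyps by simp
    have x: "x \<ge> 1" "ln x = ln (real n + 1) - ln (real n)" using n by (auto simp: x_def ln_div)
    have step_eq: "L n - L (Suc n) = (real n + 1 / 2) * ln x - 1"
    proof -
      have "ln (fact (Suc n) :: real) = ln (real n + 1) + ln (fact n)"
        unfolding fact_Suc by (subst ln_mult) (simp_all add: add.commute)
      then show ?thesis by (simp add: L_def x(2) algebra_simps del: fact_Suc)
    qed
    have "(real n + 1 / 2) * (2 * (x - 1) / (x + 1)) \<le> (real n + 1 / 2) * ln x"
      using ln_ge_quotient[OF x(1)] n by (intro mult_left_mono) auto
    moreover have "(real n + 1 / 2) * (2 * (x - 1) / (x + 1)) = 1"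
      using n by (simp add: x_def divide_simps)
    moreover have "(real n + 1 / 2) * ln x \<le> (real n + 1 / 2) * ((x - 1 / x) / 2)"
      using ln_le_half_diff[OF x(1)] n by (intro mult_left_mono) auto
    moreover have "(real n + 1 / 2) * ((x - 1 / x) / 2) - 1 = 1 / (4 * real n) - 1 / (4 * real (Suc n))"
      using n by (simp add: x_def divide_simps) (simp add: algebra_simps power2_eq_square)
    ultimately show ?case using step.IH step_eq by linarith
  qed
  then show "3 / 4 + 1 / (4 * real n) \<le> L n" "L n \<le> 1" by simp_all
qed

lemma fact_bounds:
  assumes "n \<ge> 1"
  shows "sqrt n * (real n / exp 1) ^ n \<le> fact n" "fact n \<le> exp 1 * (sqrt n * (real n / exp 1) ^ n)"
proof -
  have n: "real n > 0" using assms by simp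
  define G where "G = sqrt n * (real n / exp 1) ^ n"
  have G: "G > 0" using n by (simp add: G_def)
  have "ln G = ln (sqrt n) + ln ((real n / exp 1) ^ n)" unfolding G_def using n by (subst ln_mult) auto
  also have "\<dots> = (real n + 1 / 2) * ln n - real n"
    using n by (simp add: ln_sqrt ln_realpow ln_div algebra_simps)
  finally have "ln (fact n) - ln G = ln (fact n) + real n - (real n + 1 / 2) * ln (real n)" by simp
  then have l: "0 \<le> ln (fact n) - ln G" "ln (fact n) \<le> 1 + ln G"
  proof -
    have "3 / 4 + 1 / (4 * real n) \<ge> 0" by simp
    then show "0 \<le> ln (fact n) - ln G" "ln (fact n) \<le> 1 + ln G"
      using ln_fact_stirling[OF assms] \<open>ln (fact n) - ln G = _\<close> by linarith+
  qed
  show "sqrt n * (real n / exp 1) ^ n \<le> fact n"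
    using l(1) G unfolding G_def[symmetric] by (simp add: ln_le_cancel_iff)
  have "1 + ln G = ln (exp 1 * G)" using G by (simp add: ln_mult)
  then show "fact n \<le> exp 1 * (sqrt n * (real n / exp 1) ^ n)"
    using l(2) G unfolding G_def[symmetric] by (simp add: ln_le_cancel_iff)
qed

lemma fact_add_le: "fact (a + k) \<le> fact a * real (a + k) ^ k"
proof (induction k)
  case (Suc k)
  have "fact (a + Suc k) = real (Suc (a + k)) * fact (a + k)" by simp
  also have "\<dots> \<le> real (a + Suc k) * (fact a * real (a + k) ^ k)" using Suc by (intro mult_mono) auto
  also have "\<dots> \<le> real (a + Suc k) * (fact a * real (a + Suc k) ^ k)"
    by (intro mult_left_mono power_mono) auto
  finally show ?case by (simp add: algebra_simps)
qed simp

text \<open>Passing from \<open>q!\<close> to \<open>a!\<close> adds factors larger than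
  \<open>q\<close> or removes factors at most \<open>q\<close>, so q^a / a! peaks at a = q. This
  bounds a product of factorials one factor at a time.\<close>

lemma fact_mult_power_le:
  fixes a q :: nat
  shows "fact q * real q ^ a \<le> fact a * real q ^ q"
proof (cases "q \<le> a")
  case True
  have "fact q * real q ^ k \<le> fact (q + k)" for k
  proof (induction k)
    case (Suc k)
    have "fact q * real q ^ Suc k = real q * (fact q * real q ^ k)" by simp
    also have "\<dots> \<le> real (Suc (q + k)) * fact (q + k)" using Suc by (intro mult_mono) auto
    finally show ?case by simp
  qed simp
  from this[of "a - q"] have "fact q * real q ^ (a - q) * real q ^ q \<le> fact a * real q ^ q"
    using True by (intro mult_right_mono) auto
  then show ?thesis using True by (simp add: mult.assoc flip: power_add)
next
  case False
  from fact_add_le[of a "q - a"] have "fact q * real q ^ a \<le> fact a * real q ^ (q - a) * real q ^ a"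
    using False by (intro mult_right_mono) auto
  then show ?thesis using False by (simp add: mult.assoc flip: power_add)
qed

lemma fact_add_ge: "fact a * real (Suc a) ^ k \<le> fact (a + k)"
proof (induction k)
  case (Suc k)
  have "fact a * real (Suc a) ^ Suc k = real (Suc a) * (fact a * real (Suc a) ^ k)" by simp
  also have "\<dots> \<le> real (Suc (a + k)) * fact (a + k)" using Suc by (intro mult_mono) auto
  finally show ?case by simp
qed simp

section \<open>The multinomial theorem\<close>

definition compositions :: "'a set \<Rightarrow> nat \<Rightarrow> ('a \<Rightarrow> nat) set" where
  "compositions I M = {l \<in> I \<rightarrow>\<^sub>E UNIV. sum l I = M}"

lemma finite_compositions: "finite I \<Longrightarrow> finite (compositions I M)"
  by (rule finite_subset[of _ "I \<rightarrow>\<^sub>E {..M}"])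
    (auto simp: compositions_def PiE_iff extensional_def intro: member_le_sum finite_PiE)

text \<open>Splitting off the coordinate \<open>k\<close> reduces the identity to the binomial
  theorem; with the division by \<open>fact M\<close> the summand is a product over the
  coordinates.\<close>

lemma multinomial_exp_sum:
  fixes x :: "'a \<Rightarrow> real"
  assumes "finite I"
  shows "(\<Sum>l\<in>compositions I M. \<Prod>k\<in>I. x k ^ l k / fact (l k)) = (\<Sum>k\<in>I. x k) ^ M / fact M"
  using assms
proof (induction I arbitrary: M)
  case empty
  have eq: "compositions {} M = (if M = 0 then {\<lambda>_. undefined} else {})"
    by (auto simp: compositions_def)
  show ?case unfolding eq by (simp add: power_0_left)
next
  case (insert k I)
  define f where "f J l = (\<Prod>k\<in>J. x k ^ l k / fact (l k))" for J and l :: "'a \<Rightarrow> nat"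
  have cong: "f I (l(k := a)) = f I l" for l a
    unfolding f_def using insert.hyps by (intro prod.cong) auto
  have sumc: "sum (l(k := a)) I = sum l I" for l :: "'a \<Rightarrow> nat" and a
    using insert.hyps by (intro sum.cong) auto
  have "(\<Sum>l\<in>compositions (insert k I) M. f (insert k I) l) =
      (\<Sum>(a, l)\<in>(SIGMA a:{..M}. compositions I (M - a)). x k ^ a / fact a * f I l)"
  \<comment> \<open>Compositions are \<open>undefined\<close> outside their index set, so forgetting
    the coordinate \<open>k\<close> means resetting it to \<open>undefined\<close>.\<close>
  proof (rule sum.reindex_bij_witness[of _ "\<lambda>(a, l). l(k := a)" "\<lambda>l. (l k, l(k := undefined))"])
    fix l assume l: "l \<in> compositions (insert k I) M"
    then have s: "l k + sum l I = M" using insert.hyps by (simp add: compositions_def)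
    show "(case (l k, l(k := undefined)) of (a, l) \<Rightarrow> l(k := a)) = l" by auto
    show "(l k, l(k := undefined)) \<in> (SIGMA a:{..M}. compositions I (M - a))"
      using l s sumc insert.hyps by (auto simp: compositions_def PiE_iff extensional_def)
    show "(case (l k, l(k := undefined)) of (a, l) \<Rightarrow> x k ^ a / fact a * f I l) = f (insert k I) l"
      using insert.hyps cong by (simp add: f_def)
  next
    fix p assume "p \<in> (SIGMA a:{..M}. compositions I (M - a))"
    then obtain a l where p: "p = (a, l)" "a \<le> M" "l \<in> compositions I (M - a)" by auto
    then have "l k = undefined" using insert.hyps by (auto simp: compositions_def PiE_iff extensional_def)
    then show "(\<lambda>l. (l k, l(k := undefined))) (case p of (a, l) \<Rightarrow> l(k := a)) = p" using p(1) by auto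
    show "(case p of (a, l) \<Rightarrow> l(k := a)) \<in> compositions (insert k I) M"
      using p sumc insert.hyps by (auto simp: compositions_def PiE_iff extensional_def)
  qed
  also have "\<dots> = (\<Sum>a\<le>M. \<Sum>l\<in>compositions I (M - a). x k ^ a / fact a * f I l)"
    using finite_compositions[OF insert.hyps(1)] by (subst sum.Sigma) auto
  also have "\<dots> = (\<Sum>a\<le>M. x k ^ a / fact a * ((\<Sum>k\<in>I. x k) ^ (M - a) / fact (M - a)))"
    unfolding f_def sum_distrib_left[symmetric] insert.IH ..
  also have "\<dots> = (\<Sum>a\<le>M. (real (M choose a) * x k ^ a * (\<Sum>k\<in>I. x k) ^ (M - a)) / fact M)"
    by (intro sum.cong) (auto simp: binomial_fact)
  also have "\<dots> = (x k + (\<Sum>k\<in>I. x k)) ^ M / fact M"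
    unfolding binomial_ring sum_divide_distrib by simp
  finally show ?case using insert.hyps by (simp add: f_def)
qed

subsection \<open>Upper bound\<close>

text \<open>The exponent \<open>\<Sum>{..<card A}\<close> is the number of pairs, written as a sum
  because inserting an element into \<open>S\<close> adds \<open>card S\<close> factors.\<close>

lemma vandermonde_le:
  assumes "finite A" "\<And>x y. x \<in> A \<Longrightarrow> y \<in> A \<Longrightarrow> \<bar>real x - real y\<bar> \<le> D"
  shows "vandermonde A \<le> D ^ (\<Sum>{..<card A})"
  using assms
proof (induction A rule: finite_induct)
  case (insert b S)
  have "vandermonde (insert b S) = vandermonde S * (\<Prod>c\<in>S. \<bar>real b - real c\<bar>)"
    by (rule vandermonde_insert[OF insert.hyps])
  also have "\<dots> \<le> D ^ (\<Sum>{..<card S}) * (\<Prod>c\<in>S. D)"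
  proof (rule mult_mono)
    show "vandermonde S \<le> D ^ (\<Sum>{..<card S})" using insert by blast
    show "(\<Prod>c\<in>S. \<bar>real b - real c\<bar>) \<le> (\<Prod>c\<in>S. D)" using insert.prems by (intro prod_mono) auto
    have "0 \<le> D" using insert.prems[of b b] by simp
    then show "0 \<le> D ^ (\<Sum>{..<card S})" by simp
  qed (auto intro: prod_nonneg)
  finally show ?case using insert.hyps by (simp add: power_add mult.commute)
qed (simp add: vandermonde_def)

lemma vandermonde_ge:
  assumes "finite A" "0 \<le> h" "\<And>x y. x \<in> A \<Longrightarrow> y \<in> A \<Longrightarrow> x \<noteq> y \<Longrightarrow> h \<le> \<bar>real x - real y\<bar>"
  shows "h ^ (\<Sum>{..<card A}) \<le> vandermonde A"
  using assms
proof (induction A rule: finite_induct)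
  case (insert b S)
  have "h ^ (\<Sum>{..<card S}) * (\<Prod>c\<in>S. h) \<le> vandermonde S * (\<Prod>c\<in>S. \<bar>real b - real c\<bar>)"
  proof (rule mult_mono)
    show "h ^ (\<Sum>{..<card S}) \<le> vandermonde S" using insert by blast
    have "b \<noteq> c" if "c \<in> S" for c using that insert.hyps by auto
    then show "(\<Prod>c\<in>S. h) \<le> (\<Prod>c\<in>S. \<bar>real b - real c\<bar>)"
      using insert.prems by (intro prod_mono) auto
  qed (use insert.prems(1) vandermonde_pos[of S] in \<open>auto intro: prod_nonneg\<close>)
  also have "\<dots> = vandermonde (insert b S)" by (rule vandermonde_insert[OF insert.hyps, symmetric])
  finally show ?case using insert.hyps by (simp add: power_add mult.commute)
qed (simp add: vandermonde_def)

section \<open>Exponential moments of multinomial coordinates\<close>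

lemma power_div_fact_le_exp:
  fixes y :: real
  assumes "0 \<le> y" shows "y ^ n \<le> fact n * exp y"
proof -
  have "(\<Sum>k\<in>{n}. y ^ k /\<^sub>R fact k) \<le> (\<Sum>k. y ^ k /\<^sub>R fact k)"
    by (rule sum_le_suminf[OF summable_exp_generic]) (use assms in auto)
  then have "y ^ n / fact n \<le> exp y" by (simp add: exp_def divide_inverse mult.commute)
  then show ?thesis by (simp add: pos_divide_le_eq mult.commute)
qed

lemma even_power_le_exp: "(x :: real) ^ (2 * p) \<le> fact (2 * p) * (exp x + exp (- x))"
proof -
  have "x ^ (2 * p) = \<bar>x\<bar> ^ (2 * p)" by (simp add: power_mult)
  also have "\<dots> \<le> fact (2 * p) * exp \<bar>x\<bar>" by (rule power_div_fact_le_exp) simp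
  also have "\<dots> \<le> fact (2 * p) * (exp x + exp (- x))"
    by (intro mult_left_mono) (auto simp: abs_if)
  finally show ?thesis .
qed

lemma exp_unit_step_le:
  fixes t :: real
  assumes "0 \<le> t" "t \<le> 1"
  shows "exp t \<le> 1 + t + t\<^sup>2" "exp (- t) \<le> 1 - t + t\<^sup>2"
proof -
  show "exp t \<le> 1 + t + t\<^sup>2" by (rule exp_bound[OF assms])
  \<comment> \<open>The product on the right is 1 + t^3.\<close>
  have "1 \<le> (1 + t) * (1 - t + t\<^sup>2)" using assms by (simp add: algebra_simps power2_eq_square)
  also have "\<dots> \<le> exp t * (1 - t + t\<^sup>2)"
  proof (rule mult_right_mono)
    show "1 + t \<le> exp t" by (rule exp_ge_add_one_self)
    show "0 \<le> 1 - t + t\<^sup>2" using assms by simp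
  qed
  finally show "exp (- t) \<le> 1 - t + t\<^sup>2" by (simp add: exp_minus field_simps)
qed

lemma shape_enumeration:
  assumes "A \<in> shapes d i"
  shows "\<exists>l\<in>compositions {..<d} (i + \<Sum>{..<d}). inj_on l {..<d} \<and> l ` {..<d} = A"
proof -
  have A: "finite A" "card A = d" "\<Sum>A = i + \<Sum>{..<d}" using assms by (simp_all add: shapes_def)
  obtain h where h: "bij_betw h {0..<d} A" using ex_bij_betw_nat_finite[OF A(1)] A(2) by auto
  define l where "l = restrict h {..<d}"
  have b: "bij_betw l {..<d} A"
    using h by (simp add: l_def bij_betw_restrict_eq atLeast0LessThan)
  have "sum l {..<d} = \<Sum>A" using sum.reindex_bij_betw[OF b, of "\<lambda>x. x"] by simp
  then have "l \<in> compositions {..<d} (i + \<Sum>{..<d})" using A(3) by (simp add: compositions_def l_def)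
  then show ?thesis using b by (auto simp: bij_betw_def)
qed

text \<open>The weights tilt coordinate \<open>i\<close> up and coordinate \<open>j\<close> down by
  the same \<open>\<theta>\<close>; the linear terms cancel in the sum of the weights, and only a
  quadratic excess remains.\<close>

lemma prod_exp_step:
  fixes \<theta> :: real
  assumes "i < d" "j < d"
  defines "x \<equiv> \<lambda>k. exp (\<theta> * ((if k = i then 1 else 0) - (if k = j then 1 else 0)))"
  shows "(\<Prod>k<d. x k ^ l k) = exp (\<theta> * (real (l i) - real (l j)))"
    and "0 \<le> \<theta> \<Longrightarrow> \<theta> \<le> 1 \<Longrightarrow> (\<Sum>k<d. x k) \<le> real d + 2 * \<theta>\<^sup>2"
proof -
  have "(\<Prod>k<d. x k ^ l k) = exp (\<Sum>k<d. real (l k) * (\<theta> * ((if k = i then 1 else 0) - (if k = j then 1 else 0))))"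
    unfolding exp_sum[OF finite_lessThan] x_def by (simp add: exp_of_nat_mult)
  also have "(\<Sum>k<d. real (l k) * (\<theta> * ((if k = i then 1 else 0) - (if k = j then 1 else 0)))) =
      (\<Sum>k<d. (if k = i then \<theta> * real (l i) else 0) - (if k = j then \<theta> * real (l j) else 0))"
    by (intro sum.cong) auto
  also have "\<dots> = \<theta> * (real (l i) - real (l j))"
    using assms(1,2) by (simp add: sum_subtractf right_diff_distrib)
  finally show "(\<Prod>k<d. x k ^ l k) = exp (\<theta> * (real (l i) - real (l j)))" .
  assume t: "0 \<le> \<theta>" "\<theta> \<le> 1"
  have "(\<Sum>k<d. x k) \<le> (\<Sum>k<d. 1 + ((if k = i then \<theta> + \<theta>\<^sup>2 else 0) + (if k = j then \<theta>\<^sup>2 - \<theta> else 0)))"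
    using exp_unit_step_le[OF t] by (intro sum_mono) (auto simp: x_def)
  also have "\<dots> = real d + 2 * \<theta>\<^sup>2" using assms(1,2) by (simp add: sum.distrib)
  finally show "(\<Sum>k<d. x k) \<le> real d + 2 * \<theta>\<^sup>2" .
qed

lemma one_add_power_le_exp:
  fixes x :: real assumes "0 \<le> x" shows "(1 + x) ^ n \<le> exp (real n * x)"
  using power_mono[OF exp_ge_add_one_self[of x], of n] assms by (simp add: exp_of_nat_mult)

text \<open>The even moments of a difference of two multinomial coordinates are of the order of the
  corresponding power of \<open>M\<close>, by the exponential moment at \<open>1 / sqrt (M + 1)\<close>.\<close>

lemma sum_even_moment_le:
  assumes "i < d" "j < d"
  shows "(\<Sum>l\<in>compositions {..<d} M. (real (l i) - real (l j)) ^ (2 * p) / (\<Prod>k<d. fact (l k)))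
    \<le> 2 * fact (2 * p) * exp 2 * real (M + 1) ^ p * real d ^ M / fact M"
proof -
  \<comment> \<open>With this scale \<open>M * \<theta>\<^sup>2\<close> stays below 1, so the
    quadratic excess raised to the power \<open>M\<close> costs at most \<open>exp 2\<close>;
    \<open>M + 1\<close> avoids a division by 0.\<close>
  define \<theta> where "\<theta> = 1 / sqrt (real (M + 1))"
  have t: "0 \<le> \<theta>" "\<theta> \<le> 1" "\<theta>\<^sup>2 = 1 / real (M + 1)" by (simp_all add: \<theta>_def power_divide)
  define S where "S i j = (\<Sum>l\<in>compositions {..<d} M. exp (\<theta> * (real (l i) - real (l j))) / (\<Prod>k<d. fact (l k)))" for i j
  have S: "S i j \<le> exp 2 * real d ^ M / fact M" if "i < d" "j < d" for i j
  proof -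
    define x where "x k = exp (\<theta> * ((if k = i then 1 else 0) - (if k = j then 1 else 0)))" for k
    have "S i j = (\<Sum>l\<in>compositions {..<d} M. \<Prod>k<d. x k ^ l k / fact (l k))"
      unfolding S_def prod_dividef x_def prod_exp_step(1)[OF that] ..
    also have "\<dots> = (\<Sum>k<d. x k) ^ M / fact M" by (rule multinomial_exp_sum) simp
    also have "\<dots> \<le> (real d * (1 + 2 / real (M + 1))) ^ M / fact M"
    proof (intro divide_right_mono power_mono)
      have "1 \<le> real d" using that by simp
      then have "1 * (2 / real (M + 1)) \<le> real d * (2 / real (M + 1))" by (intro mult_right_mono) auto
      moreover have "(\<Sum>k<d. x k) \<le> real d + 2 * \<theta>\<^sup>2"
        unfolding x_def by (rule prod_exp_step(2)[OF that t(1,2)])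
      ultimately show "(\<Sum>k<d. x k) \<le> real d * (1 + 2 / real (M + 1))"
        using t(3) by (simp add: distrib_left)
    qed (auto simp: x_def intro: sum_nonneg)
    also have "\<dots> = real d ^ M * (1 + 2 / real (M + 1)) ^ M / fact M" by (simp add: power_mult_distrib)
    also have "\<dots> \<le> real d ^ M * exp 2 / fact M"
    proof (intro divide_right_mono mult_left_mono)
      have "(1 + 2 / real (M + 1)) ^ M \<le> exp (real M * (2 / real (M + 1)))"
        by (rule one_add_power_le_exp) simp
      also have "\<dots> \<le> exp 2" by (simp add: field_simps)
      finally show "(1 + 2 / real (M + 1)) ^ M \<le> exp 2" .
    qed auto
    finally show ?thesis by (simp add: mult.commute)
  qed
  have "(\<Sum>l\<in>compositions {..<d} M. (real (l i) - real (l j)) ^ (2 * p) / (\<Prod>k<d. fact (l k)))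
    \<le> (\<Sum>l\<in>compositions {..<d} M. real (M + 1) ^ p * fact (2 * p) *
        (exp (\<theta> * (real (l i) - real (l j))) / (\<Prod>k<d. fact (l k)) + exp (\<theta> * (real (l j) - real (l i))) / (\<Prod>k<d. fact (l k))))"
  proof (rule sum_mono)
    fix l :: "nat \<Rightarrow> nat"
    define y where "y = real (l i) - real (l j)"
    define Q :: real where "Q = (\<Prod>k<d. fact (l k))"
    have Q: "Q > 0" unfolding Q_def by (intro prod_pos) auto
    have "y = sqrt (real (M + 1)) * (\<theta> * y)" by (simp add: \<theta>_def)
    then have "y ^ (2 * p) = (sqrt (real (M + 1)) * (\<theta> * y)) ^ (2 * p)" by (rule arg_cong)
    also have "\<dots> = real (M + 1) ^ p * (\<theta> * y) ^ (2 * p)"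
      by (simp add: power_mult_distrib power_mult[of "sqrt _"])
    also have "\<dots> \<le> real (M + 1) ^ p * (fact (2 * p) * (exp (\<theta> * y) + exp (- (\<theta> * y))))"
      by (intro mult_left_mono even_power_le_exp) simp
    finally have "y ^ (2 * p) / Q \<le> real (M + 1) ^ p * (fact (2 * p) * (exp (\<theta> * y) + exp (- (\<theta> * y)))) / Q"
      using Q by (intro divide_right_mono) auto
    also have "\<dots> = real (M + 1) ^ p * fact (2 * p) * (exp (\<theta> * y) / Q + exp (- (\<theta> * y)) / Q)"
      by (simp only: add_divide_distrib[symmetric] times_divide_eq_right mult.assoc)
    also have "- (\<theta> * y) = \<theta> * (real (l j) - real (l i))" by (simp add: y_def algebra_simps)
    finally show "(real (l i) - real (l j)) ^ (2 * p) / (\<Prod>k<d. fact (l k)) \<le> real (M + 1) ^ p * fact (2 * p) *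
        (exp (\<theta> * (real (l i) - real (l j))) / (\<Prod>k<d. fact (l k)) + exp (\<theta> * (real (l j) - real (l i))) / (\<Prod>k<d. fact (l k)))"
      unfolding y_def Q_def .
  qed
  also have "\<dots> = real (M + 1) ^ p * fact (2 * p) * (S i j + S j i)"
    unfolding S_def sum_distrib_left[symmetric] sum.distrib ..
  also have "\<dots> \<le> real (M + 1) ^ p * fact (2 * p) * (2 * (exp 2 * real d ^ M / fact M))"
    using S[OF assms] S[OF assms(2,1)] by (intro mult_left_mono) auto
  finally show ?thesis by (simp add: mult_ac)
qed

text \<open>Each of the \<open>p\<close> differences is at most maximum minus minimum, a difference
  of two coordinates of an enumeration of the shape. Since it is unknown which two, all
  \<open>d * d\<close> pairs are summed, and then the sum is extended from shapes to all
  compositions, where the moment bound applies.\<close>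

lemma sum_vandermonde_sq_le:
  fixes d i :: nat
  defines "p \<equiv> \<Sum>{..<d}"
  assumes "d \<ge> 1"
  shows "(\<Sum>A\<in>shapes d i. (vandermonde A)\<^sup>2 / (\<Prod>a\<in>A. fact a))
    \<le> real d ^ 2 * (2 * fact (2 * p) * exp 2 * real (i + p + 1) ^ p * real d ^ (i + p) / fact (i + p))"
proof -
  define V where "V = compositions {..<d} (i + p)"
  have "\<exists>l. l \<in> V \<and> inj_on l {..<d} \<and> l ` {..<d} = A" if "A \<in> shapes d i" for A
    using shape_enumeration[OF that] unfolding V_def p_def Bex_def .
  then obtain e where e: "\<And>A. A \<in> shapes d i \<Longrightarrow> e A \<in> V" "\<And>A. A \<in> shapes d i \<Longrightarrow> inj_on (e A) {..<d}"
    "\<And>A. A \<in> shapes d i \<Longrightarrow> e A ` {..<d} = A" by metis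
  define g where "g l = (\<Sum>a<d. \<Sum>b<d. (real (l a) - real (l b)) ^ (2 * p) / (\<Prod>k<d. fact (l k)))" for l
  have gpos: "0 \<le> g l" for l unfolding g_def
    by (intro sum_nonneg divide_nonneg_nonneg prod_nonneg) (auto simp: power_mult)
  have le: "(vandermonde A)\<^sup>2 / (\<Prod>a\<in>A. fact a) \<le> g (e A)" if A: "A \<in> shapes d i" for A
  proof -
    define l where "l = e A"
    have l: "inj_on l {..<d}" "l ` {..<d} = A" using e A by (simp_all add: l_def)
    have fA: "finite A" "card A = d" using A by (simp_all add: shapes_def)
    have ne: "A \<noteq> {}" using fA \<open>d \<ge> 1\<close> by auto
    have Mx: "Max A \<in> A" "Min A \<in> A" using fA ne by simp_all
    have "Max A \<in> l ` {..<d}" "Min A \<in> l ` {..<d}" unfolding l(2) by (fact Mx)+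
    then obtain a b where ab: "a < d" "b < d" "l a = Max A" "l b = Min A" by (elim imageE) simp
    have "\<bar>real x - real y\<bar> \<le> real (Max A) - real (Min A)" if "x \<in> A" "y \<in> A" for x y
    proof -
      have "x \<le> Max A" "y \<le> Max A" "Min A \<le> x" "Min A \<le> y" using that fA by simp_all
      then show ?thesis by linarith
    qed
    then have "vandermonde A \<le> (real (Max A) - real (Min A)) ^ (\<Sum>{..<card A})"
      by (rule vandermonde_le[OF fA(1)])
    then have "vandermonde A \<le> (real (l a) - real (l b)) ^ p" unfolding ab fA(2) p_def .
    then have "(vandermonde A)\<^sup>2 \<le> ((real (l a) - real (l b)) ^ p)\<^sup>2"
      using vandermonde_pos[of A] by (intro power_mono) auto
    then have 1: "(vandermonde A)\<^sup>2 \<le> (real (l a) - real (l b)) ^ (2 * p)"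
      by (simp add: mult.commute flip: power_mult)
    have 2: "(\<Prod>a\<in>A. fact a :: real) = (\<Prod>k<d. fact (l k))"
      unfolding l(2)[symmetric] by (rule prod.reindex[OF l(1), unfolded o_def])
    have pos: "0 \<le> (real (l a) - real (l b)) ^ (2 * p) / (\<Prod>k<d. fact (l k))" for a b
      by (intro divide_nonneg_nonneg prod_nonneg) (auto simp: power_mult)
    have "(vandermonde A)\<^sup>2 / (\<Prod>a\<in>A. fact a) \<le> (real (l a) - real (l b)) ^ (2 * p) / (\<Prod>k<d. fact (l k))"
      unfolding 2 by (intro divide_right_mono[OF 1] prod_nonneg) auto
    also have "\<dots> \<le> (\<Sum>b<d. (real (l a) - real (l b)) ^ (2 * p) / (\<Prod>k<d. fact (l k)))"
      using ab(2) pos by (intro member_le_sum) auto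
    also have "\<dots> \<le> g l" unfolding g_def
      using ab(1) pos by (intro member_le_sum[of a "{..<d}" "\<lambda>a. \<Sum>b<d. (real (l a) - real (l b)) ^ (2 * p) / (\<Prod>k<d. fact (l k))"] sum_nonneg) auto
    finally show ?thesis by (simp add: l_def)
  qed
  have inj: "inj_on e (shapes d i)" by (rule inj_on_inverseI[of _ "\<lambda>l. l ` {..<d}"]) (rule e(3))
  have "(\<Sum>A\<in>shapes d i. (vandermonde A)\<^sup>2 / (\<Prod>a\<in>A. fact a)) \<le> (\<Sum>A\<in>shapes d i. g (e A))"
    by (intro sum_mono le)
  also have "\<dots> = (\<Sum>l\<in>e ` shapes d i. g l)" by (simp add: sum.reindex[OF inj])
  also have "\<dots> \<le> (\<Sum>l\<in>V. g l)"
    using e(1) gpos by (intro sum_mono2) (auto simp: V_def finite_compositions)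
  also have "\<dots> = (\<Sum>a<d. \<Sum>b<d. \<Sum>l\<in>V. (real (l a) - real (l b)) ^ (2 * p) / (\<Prod>k<d. fact (l k)))"
    unfolding g_def by (subst sum.swap, intro sum.cong refl, rule sum.swap)
  also have "\<dots> \<le> (\<Sum>a<d. \<Sum>b<d. 2 * fact (2 * p) * exp 2 * real (i + p + 1) ^ p * real d ^ (i + p) / fact (i + p))"
    unfolding V_def by (intro sum_mono sum_even_moment_le) auto
  also have "\<dots> = real d ^ 2 * (2 * fact (2 * p) * exp 2 * real (i + p + 1) ^ p * real d ^ (i + p) / fact (i + p))"
    by (simp add: power2_eq_square)
  finally show ?thesis .
qed

text \<open>All factorials are compared with \<open>fact q\<close> for a common \<open>q\<close>
  near \<open>M / d\<close>. Stirling's bounds then leave \<open>sqrt (M + 1) / sqrt q ^ d\<close>,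
  the source of the exponent \<open>(d - 1) / 2\<close>.\<close>

lemma fact_div_prod_fact_le:
  assumes "A \<in> shapes d i" "d \<ge> 1"
  defines "M \<equiv> i + \<Sum>{..<d}"
  shows "fact M / (\<Prod>a\<in>A. fact a)
    \<le> exp (1 + real d) * real d powr (real d / 2) * real (M + 1) powr (- ((real d - 1) / 2)) * real d ^ M"
proof -
  have A: "finite A" "card A = d" "\<Sum>A = M" using assms by (simp_all add: shapes_def)
  \<comment> \<open>Rounding up gives \<open>q \<ge> 1\<close> even for \<open>M = 0\<close>, and
    \<open>M / q \<le> d\<close>; the excess \<open>s\<close> is at most \<open>d\<close> and costs
    only a constant factor.\<close>
  define q where "q = M div d + 1"
  define s where "s = d * q - M"
  define t where "t = d * (M div d)"
  have "M mod d < d" "t + M mod d = M" "d * q = t + d"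
    using assms(2) by (simp_all add: t_def q_def algebra_simps)
  then have dq: "d * q = M + s" "s \<le> d" "M + 1 \<le> d * q"
    unfolding s_def by arith+
  have q1: "q \<ge> 1" by (simp add: q_def)
  have q: "real q > 0" using q1 by simp
  have d: "real d > 0" using assms(2) by simp
  have "(\<Prod>a\<in>A. fact q * real q ^ a) \<le> (\<Prod>a\<in>A. fact a * real q ^ q)"
    by (intro prod_mono conjI fact_mult_power_le) simp
  also have "(\<Prod>a\<in>A. fact q * real q ^ a) = fact q ^ d * real q ^ M"
    using A by (simp add: prod.distrib power_sum[symmetric])
  also have "(\<Prod>a\<in>A. fact a * real q ^ q) = (\<Prod>a\<in>A. fact a) * real q ^ (d * q)"
    using A by (simp add: prod.distrib mult.commute[of d q] flip: power_mult)
  finally have 1: "fact q ^ d * real q ^ M \<le> (\<Prod>a\<in>A. fact a) * real q ^ (d * q)" .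
  have 2: "sqrt q * (real q / exp 1) ^ q \<le> fact q" by (rule fact_bounds(1)[OF q1])
  have "sqrt q ^ d * (real q ^ (d * q) / exp (real (d * q))) = (sqrt q * (real q / exp 1) ^ q) ^ d"
    by (simp add: power_mult_distrib power_divide exp_of_nat_mult[symmetric] power_mult[symmetric] mult.commute)
  also have "\<dots> \<le> fact q ^ d" using q by (intro power_mono[OF 2]) simp
  finally have 3: "sqrt q ^ d * (real q ^ (d * q) / exp (real (d * q))) * real q ^ M \<le> (\<Prod>a\<in>A. fact a) * real q ^ (d * q)"
    by (intro order_trans[OF mult_right_mono 1]) auto
  then have 4: "sqrt q ^ d * real q ^ M / exp (real (d * q)) \<le> (\<Prod>a\<in>A. fact a)"
    using q by (simp add: field_simps)
  have pos: "0 < sqrt q ^ d * real q ^ M / exp (real (d * q))" using q by simp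
  have 5: "fact M \<le> exp 1 * (sqrt (real (M + 1)) * (real M / exp 1) ^ M)"
  proof (cases "M = 0")
    case False
    then have "fact M \<le> exp 1 * (sqrt M * (real M / exp 1) ^ M)" by (intro fact_bounds(2)) simp
    also have "\<dots> \<le> exp 1 * (sqrt (real (M + 1)) * (real M / exp 1) ^ M)"
      by (intro mult_left_mono mult_right_mono) auto
    finally show ?thesis .
  qed simp
  have "fact M / (\<Prod>a\<in>A. fact a) \<le>
      exp 1 * (sqrt (real (M + 1)) * (real M / exp 1) ^ M) / (sqrt q ^ d * real q ^ M / exp (real (d * q)))"
    by (rule frac_le[OF _ 5 pos 4]) simp
  also have "\<dots> = exp (1 + real s) * (sqrt (real (M + 1)) / sqrt q ^ d) * (real M / real q) ^ M"
    unfolding dq(1) using q by (simp add: power_divide exp_add exp_of_nat_mult[symmetric] field_simps)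
  also have "\<dots> \<le> exp (1 + real d) * (real d powr (real d / 2) * real (M + 1) powr (- ((real d - 1) / 2))) * real d ^ M"
  proof (intro mult_mono)
    have Mq: "real (M + 1) \<le> real d * real q" using dq(3) by (simp flip: of_nat_mult)
    show "(real M / real q) ^ M \<le> real d ^ M"
      using Mq q by (intro power_mono) (simp_all add: pos_divide_le_eq)
    have "sqrt q ^ d = real q powr (real d / 2)"
      using q by (simp add: powr_half_sqrt[symmetric] powr_powr powr_realpow[symmetric])
    also have "\<dots> \<ge> (real (M + 1) / real d) powr (real d / 2)"
      using Mq d by (intro powr_mono2) (simp_all add: pos_divide_le_eq mult.commute)
    finally have "sqrt (real (M + 1)) / sqrt q ^ d \<le> sqrt (real (M + 1)) / (real (M + 1) / real d) powr (real d / 2)"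
      using d q by (intro divide_left_mono mult_pos_pos) auto
    also have "\<dots> = real d powr (real d / 2) * (real (M + 1) powr (1 / 2) / real (M + 1) powr (real d / 2))"
      using d by (simp add: powr_divide powr_half_sqrt)
    also have "real (M + 1) powr (1 / 2) / real (M + 1) powr (real d / 2) = real (M + 1) powr (- ((real d - 1) / 2))"
      by (simp only: powr_diff[symmetric]) (rule arg_cong[of _ _ "\<lambda>z. real (M + 1) powr z"], simp add: field_simps)
    finally show "sqrt (real (M + 1)) / sqrt q ^ d \<le> real d powr (real d / 2) * real (M + 1) powr (- ((real d - 1) / 2))" .
    show "exp (1 + real s) \<le> exp (1 + real d)" using dq(2) by simp
  qed auto
  finally show ?thesis by (simp only: mult.assoc)
qed

lemma sum_lessThan_real: "real (\<Sum>{..<d}) = real d * (real d - 1) / 2"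
  by (induction d) (simp_all add: field_simps)

text \<open>The two inverse factorial products are kept apart: one stays with the Vandermonde square
  as multinomial weight, the other is bounded uniformly by
  \<open>fact_div_prod_fact_le\<close>.\<close>

lemma sq_sum_eq:
  "real (sq_sum d i) = (fact i / shape_weight {..<d})\<^sup>2 *
    (\<Sum>A\<in>shapes d i. (vandermonde A)\<^sup>2 / (\<Prod>a\<in>A. fact a) * (1 / (\<Prod>a\<in>A. fact a)))"
  unfolding sq_sum_def of_nat_sum of_nat_power sum_distrib_left
  by (intro sum.cong refl)
    (simp add: chains_eq_shape_weight shape_weight_def power2_eq_square mult_ac)

text \<open>Powers of \<open>i + 1\<close>: the squared quotient \<open>fact i / fact M\<close>
  gives -2p, the moment bound p, and the uniform bound \<open>U\<close> gives -(d-1)/2. The passage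
  between \<open>M\<close> and \<open>i\<close> costs constants depending only on
  \<open>d\<close>.\<close>

lemma sq_sum_upper:
  assumes "d \<ge> 1"
  shows "\<exists>C>0. \<forall>i. real (sq_sum d i) \<le> C * (real d ^ (2 * i) * real (i + 1) powr (- ((real d ^ 2 - 1) / 2)))"
proof -
  define p where "p = \<Sum>{..<d}"
  define w where "w = shape_weight {..<d}"
  define c1 where "c1 = exp (1 + real d) * real d powr (real d / 2)"
  define c2 where "c2 = real d ^ 2 * (2 * fact (2 * p) * exp 2)"
  define C where "C = c1 * c2 * real (p + 1) ^ p * real d ^ (2 * p) / w\<^sup>2"
  have w: "w > 0" unfolding w_def by (rule shape_weight_pos)
  have d: "real d > 0" using assms by simp
  have c: "c1 > 0" "c2 > 0" using d by (simp_all add: c1_def c2_def)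
  have "C > 0" unfolding C_def using c w d by simp
  moreover have "real (sq_sum d i) \<le> C * (real d ^ (2 * i) * real (i + 1) powr (- ((real d ^ 2 - 1) / 2)))" for i
  proof -
    define M where "M = i + p"
    define e where "e = (real d - 1) / 2"
    define U where "U = c1 * real (M + 1) powr (- e) * real d ^ M / fact M"
    have e: "e \<ge> 0" using assms by (simp add: e_def)
    have U: "1 / (\<Prod>a\<in>A. fact a) \<le> U" if "A \<in> shapes d i" for A
      using fact_div_prod_fact_le[OF that assms] unfolding U_def c1_def e_def M_def p_def
      by (simp add: field_simps)
    have U0: "U \<ge> 0" using c by (simp add: U_def)
    have "(\<Sum>A\<in>shapes d i. (vandermonde A)\<^sup>2 / (\<Prod>a\<in>A. fact a) * (1 / (\<Prod>a\<in>A. fact a)))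
      \<le> (\<Sum>A\<in>shapes d i. (vandermonde A)\<^sup>2 / (\<Prod>a\<in>A. fact a) * U)"
      using U by (intro sum_mono mult_left_mono) (auto intro!: divide_nonneg_nonneg prod_nonneg)
    also have "\<dots> = (\<Sum>A\<in>shapes d i. (vandermonde A)\<^sup>2 / (\<Prod>a\<in>A. fact a)) * U"
      by (simp add: sum_distrib_right)
    also have "\<dots> \<le> (c2 * real (M + 1) ^ p * real d ^ M / fact M) * U"
      using sum_vandermonde_sq_le[OF assms, of i] U0
      by (intro mult_right_mono) (simp_all add: c2_def M_def p_def mult.assoc)
    finally have "real (sq_sum d i) \<le> (fact i / w)\<^sup>2 * ((c2 * real (M + 1) ^ p * real d ^ M / fact M) * U)"
      unfolding sq_sum_eq w_def by (intro mult_left_mono) auto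
    also have "\<dots> = c1 * c2 / w\<^sup>2 * real d ^ (2 * M) * ((fact i / fact M)\<^sup>2 * real (M + 1) ^ p * real (M + 1) powr (- e))"
      by (simp add: U_def power2_eq_square power_mult power_mult_distrib)
    also have "\<dots> \<le> c1 * c2 / w\<^sup>2 * real d ^ (2 * M) *
        ((1 / real (i + 1) ^ p)\<^sup>2 * (real (p + 1) * real (i + 1)) ^ p * real (i + 1) powr (- e))"
    proof (intro mult_left_mono mult_mono)
      show "(fact i / fact M :: real)\<^sup>2 \<le> (1 / real (i + 1) ^ p)\<^sup>2"
      proof (rule power_mono)
        have "fact i * real (i + 1) ^ p \<le> fact M" using fact_add_ge[of i p] by (simp add: M_def)
        then show "fact i / fact M \<le> 1 / real (i + 1) ^ p" by (simp add: field_simps)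
      qed simp
      show "real (M + 1) ^ p \<le> (real (p + 1) * real (i + 1)) ^ p"
        by (rule power_mono) (simp_all add: M_def algebra_simps)
      show "real (M + 1) powr - e \<le> real (i + 1) powr - e"
        using e by (intro powr_mono2') (simp_all add: M_def)
    qed (use c in auto)
    also have "(1 / real (i + 1) ^ p)\<^sup>2 * (real (p + 1) * real (i + 1)) ^ p * real (i + 1) powr (- e) =
        real (p + 1) ^ p * (real (i + 1) powr (- real p) * real (i + 1) powr (- e))"
    proof -
      have "(1 / t ^ p)\<^sup>2 * (u * t) ^ p * v = u ^ p * (1 / t ^ p * v)" if "t > 0" for t u v :: real
        using that by (simp add: power_mult_distrib power2_eq_square)
      moreover have "real (i + 1) powr (- real p) = 1 / real (i + 1) ^ p"
        by (subst powr_minus) (simp add: powr_realpow field_simps)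
      ultimately show ?thesis by simp
    qed
    also have "real (i + 1) powr (- real p) * real (i + 1) powr (- e) = real (i + 1) powr (- ((real d ^ 2 - 1) / 2))"
      unfolding powr_add[symmetric] p_def sum_lessThan_real e_def
      by (rule arg_cong[of _ _ "\<lambda>z. real (i + 1) powr z"]) (simp add: field_simps power2_eq_square)
    also have "c1 * c2 / w\<^sup>2 * real d ^ (2 * M) * (real (p + 1) ^ p * real (i + 1) powr (- ((real d ^ 2 - 1) / 2)))
      = C * (real d ^ (2 * i) * real (i + 1) powr (- ((real d ^ 2 - 1) / 2)))"
      by (simp add: C_def M_def power_add distrib_left)
    finally show ?thesis .
  qed
  ultimately show ?thesis by blast
qed

subsection \<open>Lower bound\<close>

text \<open>Of the elements of such a shape, all but the last lie freely in intervals of length \<open>h\<close> whose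
  distance is \<open>h\<close>; the last one is determined by the sum.\<close>

lemma spread_shapes:
  fixes e q h r i :: nat
  defines "K \<equiv> e * e + 2 * e + 2"
  assumes M: "i + \<Sum>{..<Suc e} = Suc e * q + K * h + r" and "r \<le> e" "h \<ge> 1"
  shows "\<exists>F \<subseteq> shapes (Suc e) i. card F = h ^ e \<and>
    (\<forall>A\<in>F. (\<forall>x\<in>A. q \<le> x \<and> x \<le> q + (K * h + e)) \<and>
      (\<forall>x\<in>A. \<forall>y\<in>A. x \<noteq> y \<longrightarrow> real h \<le> \<bar>real x - real y\<bar>))"
proof -
  define G where "G = (\<Sum>k<e. 2 * k * h)"
  have G: "G + e * h = e * e * h" unfolding G_def by (induction e) (simp_all add: algebra_simps)
  define M where "M = i + \<Sum>{..<Suc e}"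
  \<comment> \<open>Above the base \<open>q\<close>, the free particles use at most
    \<open>G + e * h = e * e * h\<close> in total. By the choice of \<open>K\<close> the last one is
    at least \<open>(2 * e + 2) * h\<close> above \<open>q\<close>, clear of the free intervals,
    which end below \<open>2 * e * h\<close>.\<close>
  define L where "L \<sigma> k = (if k < e then q + 2 * k * h + \<sigma> k else M - (e * q + G + sum \<sigma> {..<e}))"
    for \<sigma> :: "nat \<Rightarrow> nat" and k
  define X where "X = {..<e} \<rightarrow>\<^sub>E {..<h}"
  have Kh: "K * h = e * e * h + 2 * (e * h) + 2 * h" by (simp add: K_def algebra_simps)
  have L_less: "L \<sigma> k = q + 2 * (k * h) + \<sigma> k" "\<sigma> k < h" "k * h + h \<le> e * h" if "\<sigma> \<in> X" "k < e" for \<sigma> k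
  proof -
    show "L \<sigma> k = q + 2 * (k * h) + \<sigma> k" "\<sigma> k < h" using that by (auto simp: L_def X_def)
    have "Suc k * h \<le> e * h" using that by (intro mult_right_mono) auto
    then show "k * h + h \<le> e * h" by simp
  qed
  have S: "sum \<sigma> {..<e} \<le> e * h" if "\<sigma> \<in> X" for \<sigma>
  proof -
    have "sum \<sigma> {..<e} \<le> (\<Sum>k<e. h)"
      by (intro sum_mono) (use L_less(2)[OF that] in \<open>auto intro: less_imp_le\<close>)
    then show ?thesis by simp
  qed
  have M': "M = e * q + q + (e * e * h + 2 * (e * h) + 2 * h) + r"
    using M unfolding M_def Kh by simp
  have Le: "L \<sigma> e = M - (e * q + G + sum \<sigma> {..<e})" for \<sigma> by (simp add: L_def)
  have L_last: "q + 2 * (e * h) + 2 * h \<le> L \<sigma> e" "L \<sigma> e \<le> q + (K * h + e)"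
    "e * q + G + sum \<sigma> {..<e} + L \<sigma> e = M" if "\<sigma> \<in> X" for \<sigma>
    unfolding Le using S[OF that] G M' Kh \<open>r \<le> e\<close> by linarith+
  have gap: "L \<sigma> k + h \<le> L \<sigma> k'" if "\<sigma> \<in> X" "k < k'" "k' \<le> e" for \<sigma> k k'
  proof (cases "k' < e")
    case True
    have "k < e" using that by simp
    have "Suc k * h \<le> k' * h" using that by (intro mult_right_mono) auto
    then have "k * h + h \<le> k' * h" by simp
    then show ?thesis
      using L_less(1,2)[OF that(1) \<open>k < e\<close>] L_less(1)[OF that(1) True] by linarith
  next
    case False
    then have "k' = e" "k < e" using that by simp_all
    have "L \<sigma> k + h \<le> L \<sigma> e" using L_less[OF that(1) \<open>k < e\<close>] L_last(1)[OF that(1)] by linarith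
    then show ?thesis using \<open>k' = e\<close> by simp
  qed
  have range: "q \<le> L \<sigma> k \<and> L \<sigma> k \<le> q + (K * h + e)" if "\<sigma> \<in> X" "k \<le> e" for \<sigma> k
  proof (cases "k < e")
    case True
    then show ?thesis using L_less[OF that(1) True] Kh by linarith
  next
    case False
    then show ?thesis using that L_last(1,2)[OF that(1)] by simp
  qed
  have inj: "inj_on (L \<sigma>) {..<Suc e}" if "\<sigma> \<in> X" for \<sigma>
  proof (rule inj_onI)
    fix k k' assume k: "k \<in> {..<Suc e}" "k' \<in> {..<Suc e}" "L \<sigma> k = L \<sigma> k'"
    show "k = k'"
      using gap[OF that, of k k'] gap[OF that, of k' k] k \<open>h \<ge> 1\<close>
      by (cases k k' rule: linorder_cases) auto
  qed
  define F where "F = (\<lambda>\<sigma>. L \<sigma> ` {..<Suc e}) ` X"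
  have "A \<in> shapes (Suc e) i \<and> (\<forall>x\<in>A. q \<le> x \<and> x \<le> q + (K * h + e)) \<and>
      (\<forall>x\<in>A. \<forall>y\<in>A. x \<noteq> y \<longrightarrow> real h \<le> \<bar>real x - real y\<bar>)" if "A \<in> F" for A
  proof -
    obtain \<sigma> where s: "\<sigma> \<in> X" "A = L \<sigma> ` {..<Suc e}" using \<open>A \<in> F\<close> unfolding F_def by blast
    have "\<Sum>A = sum (L \<sigma>) {..<Suc e}" unfolding s(2) by (simp add: sum.reindex[OF inj[OF s(1)]])
    also have "\<dots> = (\<Sum>k<e. q + 2 * k * h + \<sigma> k) + L \<sigma> e" by (simp add: L_def)
    also have "\<dots> = M" using L_last(3)[OF s(1)] by (simp add: sum.distrib G_def)
    finally have "A \<in> shapes (Suc e) i"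
      unfolding s(2) using card_image[OF inj[OF s(1)]] by (simp add: shapes_def M_def)
    moreover have "q \<le> x \<and> x \<le> q + (K * h + e)" if "x \<in> A" for x
      using that range[OF s(1)] unfolding s(2) by (auto simp: less_Suc_eq_le)
    moreover have "real h \<le> \<bar>real x - real y\<bar>" if "x \<in> A" "y \<in> A" "x \<noteq> y" for x y
    proof -
      obtain k k' where k: "x = L \<sigma> k" "y = L \<sigma> k'" "k \<le> e" "k' \<le> e"
        using \<open>x \<in> A\<close> \<open>y \<in> A\<close> unfolding s(2) by (auto simp: less_Suc_eq_le)
      then have "k \<noteq> k'" using \<open>x \<noteq> y\<close> by auto
      then have "x + h \<le> y \<or> y + h \<le> x"
        using gap[OF s(1), of k k'] gap[OF s(1), of k' k] k by (cases k k' rule: linorder_cases) auto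
      then show ?thesis by linarith
    qed
    ultimately show ?thesis by blast
  qed
  moreover have "card F = h ^ e"
  proof -
    have "inj_on (\<lambda>\<sigma>. L \<sigma> ` {..<Suc e}) X"
    proof (rule inj_onI)
      fix \<sigma> \<tau> assume st: "\<sigma> \<in> X" "\<tau> \<in> X" "L \<sigma> ` {..<Suc e} = L \<tau> ` {..<Suc e}"
      have "\<sigma> k = \<tau> k" if "k < e" for k
      proof -
        have "L \<sigma> k \<in> L \<tau> ` {..<Suc e}" unfolding st(3)[symmetric] using that by auto
        then obtain k' where k': "k' \<le> e" "L \<sigma> k = L \<tau> k'" by (auto simp: less_Suc_eq_le)
        have k: "L \<sigma> k = q + 2 * (k * h) + \<sigma> k" "\<sigma> k < h" "k * h + h \<le> e * h"
          by (rule L_less[OF st(1) that])+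
        have "k' \<noteq> e" using k k'(2) L_last(1)[OF st(2)] by auto
        then have "k' < e" using k'(1) by simp
        note k2 = L_less[OF st(2) this]
        \<comment> \<open>The intervals are disjoint and the last particle lies beyond them, so a
          common position forces the same interval; hence the set determines all offsets.\<close>
        have "k' = k"
        proof (rule ccontr)
          assume "k' \<noteq> k"
          then consider "Suc k \<le> k'" | "Suc k' \<le> k" by linarith
          then show False
          proof cases
            case 1
            then have "Suc k * h \<le> k' * h" by (rule mult_right_mono) simp
            then have "k * h + h \<le> k' * h" by simp
            then show False using k k2 k'(2) by linarith
          next
            case 2
            then have "Suc k' * h \<le> k * h" by (rule mult_right_mono) simp
            then have "k' * h + h \<le> k * h" by simp
            then show False using k k2 k'(2) by linarith
          qed
        qed
        then show ?thesis using k k2 k'(2) by simp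
      qed
      then show "\<sigma> = \<tau>" using st by (intro PiE_ext[of \<sigma> "{..<e}" _ \<tau>]) (auto simp: X_def)
    qed
    then have "card F = card X" unfolding F_def by (rule card_image)
    then show ?thesis by (simp add: X_def card_PiE)
  qed
  ultimately show ?thesis by (intro exI[of _ F]) blast
qed

lemma square_between: "M \<ge> 1 \<Longrightarrow> \<exists>h\<ge>1. h * h \<le> M \<and> M < (Suc h) * (Suc h)"
proof (induction M rule: dec_induct)
  case base
  show ?case by (intro exI[of _ 1]) simp
next
  case (step M)
  then obtain h where h: "h \<ge> 1" "h * h \<le> M" "M < Suc h * Suc h" by blast
  show ?case
  proof (cases "Suc M = Suc h * Suc h")
    case True
    then show ?thesis by (intro exI[of _ "Suc h"]) simp
  next
    case False
    then show ?thesis using h by (intro exI[of _ h]) simp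
  qed
qed

text \<open>All elements lie within \<open>T\<close> of \<open>q\<close>, where \<open>T * T\<close>
  is of order \<open>M\<close>. Replacing each factorial by \<open>fact q\<close> times powers of
  \<open>q + T\<close> loses only a factor \<open>(1 + T / q) ^ s\<close> with
  \<open>s \<le> T\<close>, which is bounded by \<open>exp (T * T / q)\<close> and thus by a
  constant.\<close>

lemma fact_div_prod_fact_ge:
  fixes A :: "nat set"
  assumes A: "finite A" "card A = d" "\<Sum>A = M" and d: "d \<ge> 1" and q: "q \<ge> 1" "M \<le> 2 * (d * q)"
    and x: "\<And>x. x \<in> A \<Longrightarrow> q \<le> x \<and> x \<le> q + T" and T: "T * T \<le> B * M" "M \<le> d * q + T"
  shows "exp (- (real d + 2 * real B * real d)) * (sqrt M / sqrt M ^ d) * real d ^ M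
    \<le> fact M / (\<Prod>a\<in>A. fact a)"
proof -
  have rq: "real q > 0" and rd: "real d > 0" using q d by simp_all
  have dq: "d * q \<le> M"
  proof -
    have "(\<Sum>a\<in>A. q) \<le> \<Sum>A" by (intro sum_mono) (use x in simp)
    then show ?thesis using A by simp
  qed
  then have M1: "M \<ge> 1" using q d by (metis le_trans mult_le_mono nat_mult_1)
  have qM: "q \<le> M" using dq d by (metis le_trans mult_le_mono1 nat_mult_1)
  define s where "s = M - d * q"
  have s: "M = d * q + s" "s \<le> T" using dq T(2) by (simp_all add: s_def)
  have st: "(\<Sum>a\<in>A. a - q) = s"
  proof -
    have "(\<Sum>a\<in>A. a - q) + (\<Sum>a\<in>A. q) = \<Sum>A"
      unfolding sum.distrib[symmetric] by (intro sum.cong) (use x in auto)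
    then show ?thesis using A s(1) by simp
  qed
  have "(\<Prod>a\<in>A. fact a :: real) \<le> (\<Prod>a\<in>A. fact q * real (q + T) ^ (a - q))"
  proof (intro prod_mono conjI)
    fix a assume "a \<in> A"
    then have a: "q \<le> a" "a \<le> q + T" using x by auto
    have "fact (q + (a - q)) \<le> fact q * real (q + (a - q)) ^ (a - q)" by (rule fact_add_le)
    also have "\<dots> \<le> fact q * real (q + T) ^ (a - q)" using a by (intro mult_left_mono power_mono) auto
    finally show "fact a \<le> fact q * real (q + T) ^ (a - q)" using a by simp
  qed simp
  also have "\<dots> = fact q ^ d * real (q + T) ^ s"
    using A by (simp add: prod.distrib power_sum[symmetric] st del: of_nat_add)
  also have "real (q + T) ^ s = real q ^ s * (1 + real T / real q) ^ s"
    using rq by (simp add: power_mult_distrib[symmetric] field_simps)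
  also have "fact q ^ d * (real q ^ s * (1 + real T / real q) ^ s) \<le>
      (exp 1 * (sqrt q * (real q / exp 1) ^ q)) ^ d * (real q ^ s * exp (2 * real B * real d))"
  proof (intro mult_mono power_mono mult_left_mono fact_bounds(2)[OF q(1)])
    have "(1 + real T / real q) ^ s \<le> exp (real s * (real T / real q))" by (rule one_add_power_le_exp) simp
    also have "real s * (real T / real q) \<le> real T * real T / real q"
      using s(2) rq by (simp add: divide_right_mono mult_right_mono)
    also have "\<dots> \<le> (real B * real M) / real q"
      using T(1) rq by (intro divide_right_mono) (simp_all flip: of_nat_mult)
    also have "\<dots> \<le> real B * (2 * (real d * real q)) / real q"
      using q(2) rq by (intro divide_right_mono mult_left_mono) (simp_all flip: of_nat_mult)
    also have "\<dots> = 2 * real B * real d" using rq by simp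
    finally show "(1 + real T / real q) ^ s \<le> exp (2 * real B * real d)" by simp
  qed auto
  also have "(exp 1 * (sqrt q * (real q / exp 1) ^ q)) ^ d =
      exp (real d) * (sqrt q ^ d * (real q ^ (d * q) / exp (real (d * q))))"
    by (simp add: power_mult_distrib power_divide exp_of_nat_mult[symmetric] power_mult[symmetric] mult.commute)
  also have "exp (real d) * (sqrt q ^ d * (real q ^ (d * q) / exp (real (d * q)))) * (real q ^ s * exp (2 * real B * real d))
      = exp (real d + 2 * real B * real d) * sqrt q ^ d * real q ^ M / exp (real (d * q))"
    unfolding s(1) by (simp add: power_add exp_add)
  finally have 1: "(\<Prod>a\<in>A. fact a :: real) \<le> exp (real d + 2 * real B * real d) * sqrt q ^ d * real q ^ M / exp (real (d * q))" .
  have "exp (- (real d + 2 * real B * real d)) * (sqrt M / sqrt M ^ d) * real d ^ M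
      \<le> exp (- (real d + 2 * real B * real d)) * (sqrt M / sqrt q ^ d) * (exp (real (d * q) - real M) * (real M / real q) ^ M)"
  proof (intro mult_mono mult_left_mono divide_left_mono)
    show "sqrt q ^ d \<le> sqrt M ^ d" using qM by (intro power_mono) auto
    \<comment> \<open>The inequality ln Y \<ge> 1 - 1/Y for Y = M/(dq) yields Y^M \<ge> exp (M -
      dq), which compensates the factor exp (dq - M) left by Stirling's bounds.\<close>
    have y: "real M / (real d * real q) > 0" using M1 rq rd by simp
    have "ln (1 / (real M / (real d * real q))) \<le> 1 / (real M / (real d * real q)) - 1"
      by (rule ln_le_minus_one[OF divide_pos_pos[OF zero_less_one y]])
    moreover have "ln (1 / Y) = - ln Y" if "Y > 0" for Y :: real using that by (simp add: ln_div)
    ultimately have "1 - 1 / (real M / (real d * real q)) \<le> ln (real M / (real d * real q))"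
      using y by fastforce
    then have "real M * (1 - 1 / (real M / (real d * real q))) \<le> real M * ln (real M / (real d * real q))"
      by (rule mult_left_mono) simp
    also have "real M * (1 - 1 / (real M / (real d * real q))) = real M - real (d * q)"
      using M1 by (simp add: right_diff_distrib)
    finally have "exp (real M - real (d * q)) \<le> exp (real M * ln (real M / (real d * real q)))" by simp
    also have "\<dots> = (real M / (real d * real q)) ^ M" using y by (simp add: exp_of_nat_mult)
    finally have "real d ^ M * exp (real M - real (d * q)) \<le> real d ^ M * (real M / (real d * real q)) ^ M"
      by (rule mult_left_mono) simp
    also have "\<dots> = (real M / real q) ^ M" using rd by (simp flip: power_mult_distrib)
    finally have "exp (real (d * q) - real M) * (real d ^ M * exp (real M - real (d * q)))
        \<le> exp (real (d * q) - real M) * (real M / real q) ^ M"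
      by (rule mult_left_mono) simp
    then show "real d ^ M \<le> exp (real (d * q) - real M) * (real M / real q) ^ M"
      by (simp add: exp_diff)
  qed (use rq M1 in auto)
  also have "\<dots> = sqrt M * (real M / exp 1) ^ M / (exp (real d + 2 * real B * real d) * sqrt q ^ d * real q ^ M / exp (real (d * q)))"
    by (simp add: power_divide exp_minus exp_diff exp_of_nat_mult[symmetric] exp_add field_simps)
  also have "\<dots> \<le> fact M / (\<Prod>a\<in>A. fact a)"
    by (rule frac_le[OF _ fact_bounds(1)[OF M1] _ 1]) (auto intro: prod_pos)
  finally show ?thesis .
qed

lemma sq_sum_pos:
  assumes "d \<ge> 1" shows "sq_sum d i \<ge> 1"
proof -
  obtain e where e: "d = Suc e" using assms by (cases d) auto
  \<comment> \<open>The shape consisting of a single column of height \<open>i\<close>.\<close>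
  define A where "A = insert (e + i) {..<e}"
  have A: "A \<in> shapes d i" by (simp add: A_def shapes_def e)
  have "real (chains d i A) > 0"
    unfolding chains_eq_shape_weight[OF A] by (intro divide_pos_pos mult_pos_pos shape_weight_pos) simp
  then have "1 \<le> (chains d i A)\<^sup>2" by simp
  also have "\<dots> \<le> sq_sum d i" unfolding sq_sum_def by (rule member_le_sum[OF A _ finite_shapes]) simp
  finally show ?thesis .
qed

text \<open>For \<open>h\<close> the integer square root of \<open>M\<close> there are
  \<open>h ^ e\<close> spread shapes with \<open>e = d - 1\<close>. Powers of \<open>M\<close>: e/2
  from their number, p from the squared Vandermonde product, -e from the squared multinomial bound
  and -2p from \<open>(fact i / fact M)\<^sup>2\<close>, in total -(p + e/2).\<close>

lemma sq_sum_lower_large: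
  fixes e :: nat
  defines "d \<equiv> Suc e"
  shows "\<exists>c>0. \<exists>N. \<forall>i\<ge>N.
    c * (real d ^ (2 * i) * real (i + 1) powr (- ((real d ^ 2 - 1) / 2))) \<le> real (sq_sum d i)"
proof -
  define p where "p = \<Sum>{..<d}"
  define w where "w = shape_weight {..<d}"
  define K where "K = e * e + 2 * e + 2"
  \<comment> \<open>The spread \<open>T = K * h + e\<close> is at most \<open>(K + e) * h\<close>,
    so \<open>T * T \<le> B * (h * h) \<le> B * M\<close>.\<close>
  define B where "B = (K + e) * (K + e)"
  \<comment> \<open>For \<open>h \<ge> N0\<close> the bound \<open>N0 * h \<le> M\<close> makes the
    spread at most about half of \<open>M\<close>, so that
    \<open>M \<le> 2 * (d * q)\<close>.\<close>
  define N0 where "N0 = 2 * K + 2 * e + 2"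
  define c3 where "c3 = exp (- (real d + 2 * real B * real d))"
  define E where "E = (real d ^ 2 - 1) / 2"
  define c where "c = c3\<^sup>2 / (w\<^sup>2 * 4 ^ p * 2 ^ e) * real d ^ (2 * p) * real (p + 1) powr (- E)"
  have w: "w > 0" unfolding w_def by (rule shape_weight_pos)
  have c3: "c3 > 0" by (simp add: c3_def)
  have E: "E = real p + real e / 2"
    unfolding E_def p_def sum_lessThan_real d_def by (simp add: field_simps power2_eq_square)
  have "c > 0" unfolding c_def using w c3 by (simp add: d_def)
  moreover have "c * (real d ^ (2 * i) * real (i + 1) powr (- E)) \<le> real (sq_sum d i)" if i: "i \<ge> N0 * N0" for i
  proof -
    define M where "M = i + p"
    have MN: "N0 * N0 \<le> M" using i by (simp add: M_def)
    moreover have "1 \<le> N0 * N0" by (simp add: N0_def)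
    ultimately have M1: "M \<ge> 1" by linarith
    obtain h where h: "h \<ge> 1" "h * h \<le> M" "M < Suc h * Suc h" using square_between[OF M1] by blast
    have hN: "h \<ge> N0"
    proof (rule ccontr)
      assume "\<not> h \<ge> N0"
      then have "Suc h * Suc h \<le> N0 * N0" by (intro mult_mono) auto
      then show False using h(3) MN by linarith
    qed
    have "N0 * h \<le> h * h" using hN by (rule mult_right_mono) simp
    moreover have "N0 * h = 2 * (K * h) + 2 * (e * h) + 2 * h" by (simp add: N0_def algebra_simps)
    moreover have "e \<le> e * h" using h(1) by simp
    ultimately have big: "2 * (K * h) + 2 * e + 2 \<le> M" using h(1,2) by linarith
    define q where "q = (M - K * h) div d"
    define r where "r = (M - K * h) mod d"
    have "d * q + r = M - K * h" by (simp add: q_def r_def)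
    then have Mq: "M = d * q + K * h + r" using big by linarith
    have "r < d" unfolding r_def by (rule mod_less_divisor) (simp add: d_def)
    then have r: "r \<le> e" by (simp add: d_def)
    have M2: "M \<le> 2 * (d * q)" using Mq r big by linarith
    have q1: "q \<ge> 1" using M2 M1 by (cases q) auto
    obtain F where F: "F \<subseteq> shapes d i" "card F = h ^ e"
      "\<And>A x. A \<in> F \<Longrightarrow> x \<in> A \<Longrightarrow> q \<le> x \<and> x \<le> q + (K * h + e)"
      "\<And>A x y. A \<in> F \<Longrightarrow> x \<in> A \<Longrightarrow> y \<in> A \<Longrightarrow> x \<noteq> y \<Longrightarrow> real h \<le> \<bar>real x - real y\<bar>"
      using spread_shapes[of i e q h r] Mq r h(1) unfolding d_def[symmetric] K_def[symmetric] M_def p_def by metis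
    define R where "R = c3 * (sqrt M / sqrt M ^ d) * real d ^ M"
    have R0: "R \<ge> 0" using c3 by (simp add: R_def)
    have T: "(K * h + e) * (K * h + e) \<le> B * M"
    proof -
      have "K * h + e \<le> (K + e) * h" using h(1) by (simp add: algebra_simps)
      then have "(K * h + e) * (K * h + e) \<le> ((K + e) * h) * ((K + e) * h)" by (intro mult_mono) auto
      also have "\<dots> = B * (h * h)" by (simp add: B_def algebra_simps)
      also have "\<dots> \<le> B * M" using h(2) by (rule mult_left_mono) simp
      finally show ?thesis .
    qed
    have h4: "real M / 4 \<le> real h * real h"
    proof -
      have "Suc h * Suc h \<le> (2 * h) * (2 * h)" using h(1) by (intro mult_mono) auto
      then have "M \<le> 4 * (h * h)" using h(3) by linarith
      then have "real M \<le> real (4 * (h * h))" by (simp only: of_nat_le_iff)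
      then show ?thesis by simp
    qed
    have hs: "sqrt M / 2 \<le> real h"
    proof -
      have "sqrt (real M / 4) \<le> sqrt (real h * real h)" by (rule real_sqrt_le_mono[OF h4])
      then show ?thesis by (simp add: real_sqrt_divide)
    qed
    have tm: "(fact i / w)\<^sup>2 * ((real M / 4) ^ p * (R / fact M)\<^sup>2) \<le> real ((chains d i A)\<^sup>2)" if "A \<in> F" for A
    proof -
      have sh: "A \<in> shapes d i" using that F(1) by blast
      then have A: "finite A" "card A = d" "\<Sum>A = M" by (simp_all add: shapes_def M_def p_def)
      have "R \<le> fact M / (\<Prod>a\<in>A. fact a)" unfolding R_def c3_def
        by (rule fact_div_prod_fact_ge[OF A _ q1 M2 F(3)[OF that] T]) (use Mq r in \<open>simp_all add: d_def\<close>)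
      then have R: "R / fact M \<le> 1 / (\<Prod>a\<in>A. fact a)" by (simp add: field_simps)
      have "real h ^ p \<le> vandermonde A"
        using vandermonde_ge[OF A(1), of "real h"] F(4)[OF that] A(2) by (simp add: p_def)
      then have "real h ^ p * (R / fact M) \<le> vandermonde A * (1 / (\<Prod>a\<in>A. fact a))"
        using R R0 vandermonde_pos[of A] by (intro mult_mono) auto
      then have 1: "real h ^ p * (R / fact M) \<le> shape_weight A" by (simp add: shape_weight_def)
      have "(fact i / w)\<^sup>2 * ((real M / 4) ^ p * (R / fact M)\<^sup>2) \<le> (fact i / w)\<^sup>2 * ((real h * real h) ^ p * (R / fact M)\<^sup>2)"
        using h4 by (intro mult_left_mono mult_right_mono power_mono) auto
      also have "\<dots> = (fact i / w)\<^sup>2 * (real h ^ p * (R / fact M))\<^sup>2"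
        by (simp add: power_mult_distrib power2_eq_square)
      also have "\<dots> \<le> (fact i / w)\<^sup>2 * (shape_weight A)\<^sup>2"
        using 1 R0 by (intro mult_left_mono power_mono) auto
      also have "\<dots> = real ((chains d i A)\<^sup>2)"
        unfolding of_nat_power chains_eq_shape_weight[OF sh] w_def by (simp add: power_mult_distrib power_divide)
      finally show ?thesis .
    qed
    have "c * (real d ^ (2 * i) * real (i + 1) powr (- E)) =
        c3\<^sup>2 / (w\<^sup>2 * 4 ^ p * 2 ^ e) * real d ^ (2 * M) * (real (p + 1) * real (i + 1)) powr (- E)"
    proof -
      have pm: "(real (p + 1) * real (i + 1)) powr (- E) = real (p + 1) powr (- E) * real (i + 1) powr (- E)"
        by (simp only: powr_mult of_nat_0_le_iff)
      show ?thesis unfolding c_def pm M_def by (simp add: power_add distrib_left)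
    qed
    also have "\<dots> \<le> c3\<^sup>2 / (w\<^sup>2 * 4 ^ p * 2 ^ e) * real d ^ (2 * M) * real M powr (- E)"
    proof (intro mult_left_mono powr_mono2')
      show "real M \<le> real (p + 1) * real (i + 1)" by (simp add: M_def algebra_simps)
      show "- E \<le> 0" by (simp add: E)
    qed (use M1 c3 in auto)
    also have "real M powr (- E) = sqrt M ^ e / (real M ^ p * real M ^ e)"
    proof -
      have "real M powr (- E) = real M powr (real e / 2) / (real M powr real p * real M powr real e)"
        unfolding powr_add[symmetric] powr_diff[symmetric] E by (rule arg_cong[of _ _ "\<lambda>z. real M powr z"]) simp
      also have "real M powr (real e / 2) = sqrt M ^ e"
        using M1 by (simp add: powr_half_sqrt[symmetric] powr_powr powr_realpow[symmetric])
      finally show ?thesis using M1 by (simp add: powr_realpow)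
    qed
    also have "c3\<^sup>2 / (w\<^sup>2 * 4 ^ p * 2 ^ e) * real d ^ (2 * M) * (sqrt M ^ e / (real M ^ p * real M ^ e)) =
        (1 / real M ^ p)\<^sup>2 / w\<^sup>2 * ((real M / 4) ^ p * R\<^sup>2) * (sqrt M / 2) ^ e"
    proof -
      have "(sqrt M ^ e)\<^sup>2 = (sqrt M ^ 2) ^ e" by (simp only: power_mult[symmetric] mult.commute)
      then have Z: "(sqrt M / sqrt M ^ d)\<^sup>2 = 1 / real M ^ e" using M1 by (simp add: d_def power_divide)
      have "R\<^sup>2 = c3\<^sup>2 * (1 / real M ^ e) * (real d ^ M)\<^sup>2"
        unfolding R_def power_mult_distrib Z ..
      also have "(real d ^ M)\<^sup>2 = real d ^ (2 * M)" by (simp only: power_mult[symmetric] mult.commute)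
      finally have "R\<^sup>2 = c3\<^sup>2 * (1 / real M ^ e) * real d ^ (2 * M)" .
      then show ?thesis using M1 w by (simp add: power_divide power2_eq_square field_simps)
    qed
    also have "\<dots> \<le> (fact i / fact M)\<^sup>2 / w\<^sup>2 * ((real M / 4) ^ p * R\<^sup>2) * real h ^ e"
    proof (intro mult_mono mult_right_mono divide_right_mono power_mono hs)
      have "fact M \<le> fact i * real M ^ p" using fact_add_le[of i p] by (simp add: M_def)
      then show "1 / real M ^ p \<le> fact i / fact M" using M1 by (simp add: field_simps)
    qed (use R0 in auto)
    also have "\<dots> = (\<Sum>A\<in>F. (fact i / w)\<^sup>2 * ((real M / 4) ^ p * (R / fact M)\<^sup>2))"
    proof -
      have "(a / b)\<^sup>2 / w\<^sup>2 * (Y * R\<^sup>2) * H = H * ((a / w)\<^sup>2 * (Y * (R / b)\<^sup>2))" for a b Y H :: real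
        by (simp add: power_divide mult_ac)
      then show ?thesis unfolding sum_constant F(2) of_nat_power .
    qed
    also have "\<dots> \<le> (\<Sum>A\<in>F. real ((chains d i A)\<^sup>2))" by (rule sum_mono[OF tm])
    also have "\<dots> \<le> (\<Sum>A\<in>shapes d i. real ((chains d i A)\<^sup>2))"
      by (rule sum_mono2[OF finite_shapes F(1)]) simp
    also have "\<dots> = real (sq_sum d i)" by (simp add: sq_sum_def)
    finally show ?thesis .
  qed
  ultimately show ?thesis unfolding E_def by blast
qed

lemma sq_sum_lower:
  assumes "d \<ge> 1"
  shows "\<exists>c>0. \<forall>i. c * (real d ^ (2 * i) * real (i + 1) powr (- ((real d ^ 2 - 1) / 2))) \<le> real (sq_sum d i)"
proof -
  obtain e where e: "d = Suc e" using assms by (cases d) auto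
  define E where "E = (real d ^ 2 - 1) / 2"
  have "1 ^ 2 \<le> real d ^ 2" using assms by (intro power_mono) simp_all
  then have E: "E \<ge> 0" by (simp add: E_def)
  obtain c N where c: "c > 0" "\<And>i. i \<ge> N \<Longrightarrow> c * (real d ^ (2 * i) * real (i + 1) powr (- E)) \<le> real (sq_sum d i)"
    using sq_sum_lower_large[of e] unfolding e[symmetric] E_def[symmetric] by blast
  \<comment> \<open>For the finitely many \<open>i < N\<close> this makes the left side at most 1,
    and \<open>sq_sum_pos\<close> suffices.\<close>
  define c' where "c' = min c (1 / real d ^ (2 * N))"
  have c': "c' > 0" "c' \<le> c" "c' \<le> 1 / real d ^ (2 * N)" using c(1) assms by (simp_all add: c'_def)
  have "c' * (real d ^ (2 * i) * real (i + 1) powr (- E)) \<le> real (sq_sum d i)" for i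
  proof (cases "i \<ge> N")
    case True
    have "c' * (real d ^ (2 * i) * real (i + 1) powr (- E)) \<le> c * (real d ^ (2 * i) * real (i + 1) powr (- E))"
      using c'(2) by (intro mult_right_mono) auto
    then show ?thesis using c(2)[OF True] by linarith
  next
    case False
    have "real (i + 1) powr (- E) \<le> real (i + 1) powr 0" using E by (intro powr_mono) auto
    then have 1: "real (i + 1) powr (- E) \<le> 1" by simp
    have 2: "real d ^ (2 * i) \<le> real d ^ (2 * N)" using False assms by (intro power_increasing) auto
    have "c' * (real d ^ (2 * i) * real (i + 1) powr (- E)) \<le> 1 / real d ^ (2 * N) * (real d ^ (2 * N) * 1)"
      using 1 2 c' by (intro mult_mono) auto
    also have "\<dots> = 1" using assms by simp
    also have "\<dots> \<le> real (sq_sum d i)" using sq_sum_pos[OF assms, of i] by simp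
    finally show ?thesis .
  qed
  then show ?thesis using c'(1) unfolding E_def by blast
qed

subsection \<open>Binomial averaging\<close>

text \<open>Absorption, (n choose i)/(i+1) = (n+1 choose i+1)/(n+1), trades one power of i+1 for one
  of n+1. The remaining powers of i+1 become powers of i+2 at the cost of 2^m, and the index shift
  costs (1+x)/x.\<close>

lemma sum_binomial_div_power_le:
  fixes x :: real
  assumes "x > 0"
  shows "\<exists>K>0. \<forall>n. (\<Sum>i\<le>n. real (n choose i) * x ^ i / real (i + 1) ^ m) \<le> K * (1 + x) ^ n / real (n + 1) ^ m"
proof (induction m)
  case 0
  have "(\<Sum>i\<le>n. real (n choose i) * x ^ i) = (1 + x) ^ n" for n
    using binomial_ring[of x 1 n] by (simp add: add.commute)
  then show ?case by (intro exI[of _ 1]) simp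
next
  case (Suc m)
  then obtain K where K: "K > 0"
    "\<And>n. (\<Sum>i\<le>n. real (n choose i) * x ^ i / real (i + 1) ^ m) \<le> K * (1 + x) ^ n / real (n + 1) ^ m" by blast
  define K' where "K' = 2 ^ m * K * (1 + x) / x"
  have "(\<Sum>i\<le>n. real (n choose i) * x ^ i / real (i + 1) ^ Suc m) \<le> K' * (1 + x) ^ n / real (n + 1) ^ Suc m" for n
  proof -
    define f where "f j = real (Suc n choose j) * x ^ j / real (j + 1) ^ m" for j
    have "(\<Sum>i\<le>n. real (n choose i) * x ^ i / real (i + 1) ^ Suc m) \<le>
        (\<Sum>i\<le>n. 2 ^ m / (real (n + 1) * x) * f (Suc i))"
    proof (rule sum_mono)
      fix i
      have "Suc n * (n choose i) = (Suc n choose Suc i) * Suc i" by (rule Suc_times_binomial_eq)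
      then have "real (Suc n) * real (n choose i) = real (Suc n choose Suc i) * real (Suc i)"
        by (simp only: of_nat_mult[symmetric])
      then have c: "real (n choose i) = real (Suc n choose Suc i) * real (i + 1) / real (n + 1)"
        by (simp add: field_simps)
      have "real (n choose i) * x ^ i / real (i + 1) ^ Suc m =
          real (Suc n choose Suc i) / real (n + 1) * x ^ i * (1 / real (i + 1) ^ m)"
        unfolding c by simp
      also have "\<dots> \<le> real (Suc n choose Suc i) / real (n + 1) * x ^ i * (2 ^ m / real (i + 2) ^ m)"
      proof (rule mult_left_mono)
        have "real (i + 2) ^ m \<le> (2 * real (i + 1)) ^ m" by (intro power_mono) auto
        moreover have "1 / a ^ m \<le> 2 ^ m / b ^ m" if "b ^ m \<le> (2 * a) ^ m" "a > 0" "b > 0" for a b :: real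
          using that by (simp add: field_simps power_mult_distrib)
        ultimately show "1 / real (i + 1) ^ m \<le> 2 ^ m / real (i + 2) ^ m"
          by (metis add_gr_0 of_nat_0_less_iff zero_less_numeral zero_less_one)
      qed (use assms in simp)
      also have "\<dots> = 2 ^ m / (real (n + 1) * x) * f (Suc i)"
        using assms by (simp add: f_def)
      finally show "real (n choose i) * x ^ i / real (i + 1) ^ Suc m \<le> 2 ^ m / (real (n + 1) * x) * f (Suc i)" .
    qed
    also have "\<dots> = 2 ^ m / (real (n + 1) * x) * (\<Sum>i\<le>n. f (Suc i))" by (simp add: sum_distrib_left)
    also have "\<dots> \<le> 2 ^ m / (real (n + 1) * x) * (K * (1 + x) ^ Suc n / real (Suc n + 1) ^ m)"
    proof (rule mult_left_mono)
      have "(\<Sum>i\<le>n. f (Suc i)) \<le> (\<Sum>j\<le>Suc n. f j)"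
        using assms unfolding sum.atMost_Suc_shift by (simp add: f_def)
      also have "\<dots> \<le> K * (1 + x) ^ Suc n / real (Suc n + 1) ^ m" unfolding f_def by (rule K(2))
      finally show "(\<Sum>i\<le>n. f (Suc i)) \<le> K * (1 + x) ^ Suc n / real (Suc n + 1) ^ m" .
    qed (use assms in simp)
    also have "\<dots> \<le> 2 ^ m / (real (n + 1) * x) * (K * (1 + x) ^ Suc n / real (n + 1) ^ m)"
      using assms K(1) by (intro mult_left_mono divide_left_mono power_mono mult_pos_pos) auto
    also have "\<dots> = K' * (1 + x) ^ n / real (n + 1) ^ Suc m" by (simp add: K'_def mult_ac)
    finally show ?thesis .
  qed
  moreover have "K' > 0" using K(1) assms by (simp add: K'_def)
  ultimately show ?case by blast
qed

text \<open>The exponent may be a half-integer; the Cauchy--Schwarz inequality reduces it to an integer.\<close>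

lemma sum_binomial_powr_le:
  fixes x :: real
  assumes "x > 0"
  shows "\<exists>K>0. \<forall>n. (\<Sum>i\<le>n. real (n choose i) * (x ^ i * real (i + 1) powr (- (real m / 2))))
    \<le> K * ((1 + x) ^ n * real (n + 1) powr (- (real m / 2)))"
proof -
  obtain K where K: "K > 0"
    "\<And>n. (\<Sum>i\<le>n. real (n choose i) * x ^ i / real (i + 1) ^ m) \<le> K * (1 + x) ^ n / real (n + 1) ^ m"
    using sum_binomial_div_power_le[OF assms, of m] by blast
  have sq: "(real (j + 1) powr (- (real m / 2)))\<^sup>2 = 1 / real (j + 1) ^ m" for j
    by (simp add: power2_eq_square flip: powr_add) (simp add: powr_minus powr_realpow field_simps)
  have "(\<Sum>i\<le>n. real (n choose i) * (x ^ i * real (i + 1) powr (- (real m / 2))))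
    \<le> sqrt K * ((1 + x) ^ n * real (n + 1) powr (- (real m / 2)))" for n
  proof (rule power2_le_imp_le)
    \<comment> \<open>The squares of \<open>a\<close> are the binomial weights with total (1+x)^n;
      the squares of \<open>b\<close> carry the integral power (i+1)^(-m).\<close>
    define a where "a i = sqrt (real (n choose i) * x ^ i)" for i
    define b where "b i = a i * real (i + 1) powr (- (real m / 2))" for i
    have a: "a i * a i = real (n choose i) * x ^ i" for i using assms by (simp add: a_def)
    have "(\<Sum>i\<le>n. real (n choose i) * (x ^ i * real (i + 1) powr (- (real m / 2)))) = (\<Sum>i\<le>n. a i * b i)"
      by (intro sum.cong refl) (simp add: b_def a mult.assoc[symmetric])
    then have "(\<Sum>i\<le>n. real (n choose i) * (x ^ i * real (i + 1) powr (- (real m / 2))))\<^sup>2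
        \<le> (\<Sum>i\<le>n. (a i)\<^sup>2) * (\<Sum>i\<le>n. (b i)\<^sup>2)"
      using Cauchy_Schwarz_ineq_sum[of a b "{..n}"] by simp
    also have "(\<Sum>i\<le>n. (a i)\<^sup>2) = (1 + x) ^ n"
      using binomial_ring[of x 1 n] by (simp add: power2_eq_square a add.commute)
    also have "(\<Sum>i\<le>n. (b i)\<^sup>2) = (\<Sum>i\<le>n. real (n choose i) * x ^ i / real (i + 1) ^ m)"
      unfolding b_def power_mult_distrib sq by (simp add: power2_eq_square a)
    also have "(1 + x) ^ n * \<dots> \<le> (1 + x) ^ n * (K * (1 + x) ^ n / real (n + 1) ^ m)"
      using assms by (intro mult_left_mono K(2)) simp
    also have "\<dots> = (sqrt K * ((1 + x) ^ n * real (n + 1) powr (- (real m / 2))))\<^sup>2"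
      unfolding power_mult_distrib sq using K(1) by (simp add: power2_eq_square)
    finally show "(\<Sum>i\<le>n. real (n choose i) * (x ^ i * real (i + 1) powr (- (real m / 2))))\<^sup>2
        \<le> (sqrt K * ((1 + x) ^ n * real (n + 1) powr (- (real m / 2))))\<^sup>2" .
    show "0 \<le> sqrt K * ((1 + x) ^ n * real (n + 1) powr (- (real m / 2)))" using K(1) assms by simp
  qed
  then show ?thesis using K(1) by (intro exI[of _ "sqrt K"]) simp
qed

text \<open>Only the upper bound needs averaging; for the lower one, \<open>i \<le> n\<close> bounds
  the power of \<open>i + 1\<close> below by that of \<open>n + 1\<close> term by term. The
  half-integer exponent enters as \<open>m / 2\<close> with
  \<open>m = d\<^sup>2 - 1\<close>.\<close>

lemma card_no_inc_bounds:
  assumes "d \<ge> 1"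
  defines "E \<equiv> (real d ^ 2 - 1) / 2"
  shows "\<exists>c C. c > 0 \<and> C > 0 \<and> (\<forall>n.
    c * ((real d ^ 2 + 1) ^ n * real (n + 1) powr (- E)) \<le> real (card (no_inc d n)) \<and>
    real (card (no_inc d n)) \<le> C * ((real d ^ 2 + 1) ^ n * real (n + 1) powr (- E)))"
proof -
  define x where "x = real d ^ 2"
  have x: "x > 0" using assms(1) by (simp add: x_def)
  have xi: "real d ^ (2 * i) = x ^ i" for i by (simp add: x_def power_mult)
  have "1 \<le> d ^ 2" using assms(1) by simp
  then have Em: "E = real (d ^ 2 - 1) / 2" by (simp add: E_def of_nat_diff)
  then have E0: "E \<ge> 0" by simp
  obtain C1 where C1: "C1 > 0" "\<And>i. real (sq_sum d i) \<le> C1 * (x ^ i * real (i + 1) powr (- E))"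
    using sq_sum_upper[OF assms(1)] unfolding xi E_def[symmetric] by blast
  obtain c1 where c1: "c1 > 0" "\<And>i. c1 * (x ^ i * real (i + 1) powr (- E)) \<le> real (sq_sum d i)"
    using sq_sum_lower[OF assms(1)] unfolding xi E_def[symmetric] by blast
  obtain K where K: "K > 0" "\<And>n. (\<Sum>i\<le>n. real (n choose i) * (x ^ i * real (i + 1) powr (- E)))
    \<le> K * ((1 + x) ^ n * real (n + 1) powr (- E))"
    using sum_binomial_powr_le[OF x, of "d ^ 2 - 1"] unfolding Em[symmetric] by blast
  have card: "real (card (no_inc d n)) = (\<Sum>i\<le>n. real (n choose i) * real (sq_sum d i))" for n
    unfolding card_no_inc(2) by simp
  have "real (card (no_inc d n)) \<le> (C1 * K) * ((x + 1) ^ n * real (n + 1) powr (- E))" for n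
  proof -
    have "real (card (no_inc d n)) \<le> (\<Sum>i\<le>n. real (n choose i) * (C1 * (x ^ i * real (i + 1) powr (- E))))"
      unfolding card by (intro sum_mono mult_left_mono C1(2)) simp
    also have "\<dots> = C1 * (\<Sum>i\<le>n. real (n choose i) * (x ^ i * real (i + 1) powr (- E)))"
      unfolding sum_distrib_left by (intro sum.cong refl) simp
    also have "\<dots> \<le> C1 * (K * ((1 + x) ^ n * real (n + 1) powr (- E)))"
      using C1(1) by (intro mult_left_mono K(2)) simp
    finally show ?thesis by (simp only: mult.assoc add.commute[of x])
  qed
  moreover have "c1 * ((x + 1) ^ n * real (n + 1) powr (- E)) \<le> real (card (no_inc d n))" for n
  proof -
    have "c1 * ((x + 1) ^ n * real (n + 1) powr (- E)) =
        (\<Sum>i\<le>n. real (n choose i) * (c1 * (x ^ i * real (n + 1) powr (- E))))"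
      unfolding binomial_ring sum_distrib_left sum_distrib_right by (intro sum.cong refl) simp
    also have "\<dots> \<le> (\<Sum>i\<le>n. real (n choose i) * (c1 * (x ^ i * real (i + 1) powr (- E))))"
      using c1(1) x E0 by (intro sum_mono mult_left_mono powr_mono2') auto
    also have "\<dots> \<le> real (card (no_inc d n))"
      unfolding card by (intro sum_mono mult_left_mono c1(2)) simp
    finally show ?thesis .
  qed
  ultimately show ?thesis using c1(1) C1(1) K(1) unfolding x_def
    by (intro exI[of _ c1] exI[of _ "C1 * K"]) simp
qed

subsection \<open>Reduction of pattern avoidance\<close>

definition has_inc :: "nat list \<Rightarrow> nat \<Rightarrow> bool" where
  "has_inc p r \<longleftrightarrow> (\<exists>xs. subseq xs p \<and> sorted_wrt (<) xs \<and> length xs = r)"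

text \<open>For \<open>r = k - 1\<close> this merges the patterns of \<open>A_diag k\<close> into
  one condition: the last entry may take any rank except the top one.\<close>

definition inc_drop :: "nat list \<Rightarrow> nat \<Rightarrow> bool" where
  "inc_drop p r \<longleftrightarrow> (\<exists>xs y. subseq (xs @ [y]) p \<and> sorted_wrt (<) xs \<and> length xs = r \<and> y < last xs)"

lemma subseq_imp_index:
  assumes "subseq xs p"
  shows "\<exists>i. strict_mono_on {..<length xs} i \<and> (\<forall>r<length xs. i r < length p \<and> p ! i r = xs ! r)"
  using assms
proof (induction rule: list_emb.induct)
  case (list_emb_Nil ys)
  then show ?case by (simp add: strict_mono_on_def)
next
  case (list_emb_Cons xs ys y)
  then obtain i where "strict_mono_on {..<length xs} i" "\<forall>r<length xs. i r < length ys \<and> ys ! i r = xs ! r"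
    by blast
  then show ?case by (intro exI[of _ "\<lambda>r. Suc (i r)"]) (simp add: strict_mono_on_def)
next
  case (list_emb_Cons2 x y xs ys)
  then obtain i where i: "strict_mono_on {..<length xs} i" "\<forall>r<length xs. i r < length ys \<and> ys ! i r = xs ! r"
    by blast
  define i' where "i' r = (case r of 0 \<Rightarrow> 0 | Suc r \<Rightarrow> Suc (i r))" for r
  have "strict_mono_on {..<length (x # xs)} i'"
    using i(1) by (auto simp: strict_mono_on_def i'_def split: nat.split)
  moreover have "\<forall>r<length (x # xs). i' r < length (y # ys) \<and> (y # ys) ! i' r = (x # xs) ! r"
    using i(2) list_emb_Cons2.hyps by (auto simp: i'_def split: nat.split)
  ultimately show ?case by blast
qed

lemma index_imp_subseq:
  assumes "strict_mono_on {..<m} i" "\<forall>r<m. i r < N" "N \<le> length p"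
  shows "subseq (map (\<lambda>r. p ! i r) [0..<m]) (take N p)"
  using assms
proof (induction m arbitrary: N)
  case (Suc m)
  have im: "i m < N" using Suc.prems by simp
  have "\<forall>r<m. i r < i m" using Suc.prems(1) by (auto simp: strict_mono_on_def)
  moreover have "strict_mono_on {..<m} i" using Suc.prems(1) by (auto simp: strict_mono_on_def)
  ultimately have 1: "subseq (map (\<lambda>r. p ! i r) [0..<m]) (take (i m) p)"
    using Suc.IH[of "i m"] im Suc.prems(3) by simp
  have "take N p = take (i m) p @ take (N - i m) (drop (i m) p)"
    using im by (simp flip: take_add)
  moreover have "p ! i m \<in> set (take (N - i m) (drop (i m) p))"
    using im Suc.prems(3) by (auto simp: in_set_conv_nth intro!: exI[of _ 0])
  then have "subseq [p ! i m] (take (N - i m) (drop (i m) p))" by (simp only: subseq_singleton_left)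
  ultimately show ?case using list_emb_append_mono[OF 1] by simp
qed simp

text \<open>In a pattern of the set the maximum \<open>k\<close> stands before the last entry, so in
  an occurrence the last entry is below the end of the increasing part. Conversely, the number
  \<open>m\<close> of entries of \<open>xs\<close> below \<open>y\<close> selects the pattern that
  ends in \<open>j = m + 1\<close>; distinctness of \<open>p\<close> excludes ties.\<close>

lemma contains_A_diag_iff:
  assumes "k \<ge> 2" "distinct p"
  shows "(\<exists>q\<in>A_diag k. contains_pattern p q) \<longleftrightarrow> inc_drop p (k - 1)"
proof
  assume "\<exists>q\<in>A_diag k. contains_pattern p q"
  then obtain q i where q: "q \<in> A_diag k" and i: "strict_mono_on {..<length q} i" "\<forall>r<length q. i r < length p"
    "\<forall>r<length q. \<forall>s<length q. p ! i r < p ! i s \<longleftrightarrow> q ! r < q ! s"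
    by (auto simp: contains_pattern_def)
  have q': "set q = {1..k}" "distinct q" "sorted_wrt (<) (butlast q)" "last q < k"
    using q by (auto simp: A_diag_def permutations_of_set_def)
  have lq: "length q = k" using distinct_card[OF q'(2)] q'(1) by simp
  then have ne: "q \<noteq> []" using assms(1) by auto
  obtain b x where bx: "q = b @ [x]" using ne by (cases q rule: rev_cases) auto
  have "k \<in> set q" using q'(1) assms(1) by simp
  then have "k \<in> set (butlast q)" using q'(4) unfolding bx by auto
  then obtain r where r: "r < k - 1" "butlast q ! r = k" using lq by (auto simp: in_set_conv_nth)
  then have qr: "q ! r = k" using lq by (simp add: nth_butlast)
  have ql: "q ! (k - 1) < k" using q'(4) ne lq by (simp add: last_conv_nth)
  define xs where "xs = map (\<lambda>r. p ! i r) [0..<k - 1]"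
  have inc: "p ! i s < p ! i t" if "s < t" "t < k - 1" for s t
  proof -
    have "butlast q ! s < butlast q ! t" using q'(3) that lq by (simp add: sorted_wrt_iff_nth_less)
    then have "q ! s < q ! t" using that lq by (simp add: nth_butlast)
    then show ?thesis using i(3) that lq by simp
  qed
  have "Suc (k - 1) = k" using assms(1) by simp
  then have "map (\<lambda>r. p ! i r) [0..<k] = xs @ [p ! i (k - 1)]"
    unfolding xs_def using upt_Suc_append[of 0 "k - 1"] by simp
  moreover have "subseq (map (\<lambda>r. p ! i r) [0..<k]) (take (length p) p)"
    by (rule index_imp_subseq) (use i lq in auto)
  ultimately have "subseq (xs @ [p ! i (k - 1)]) p" by simp
  moreover have "sorted_wrt (<) xs" unfolding xs_def by (simp add: sorted_wrt_iff_nth_less inc)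
  moreover have "p ! i (k - 1) < last xs"
  proof -
    have "p ! i (k - 1) < p ! i r" using i(3) lq r(1) qr ql assms(1) by simp
    also have "\<dots> \<le> p ! i (k - 2)" using inc[of r "k - 2"] r(1) by (cases "r = k - 2") (auto intro: less_imp_le)
    also have "p ! i (k - 2) = last xs"
    proof -
      have "xs \<noteq> []" "length xs = k - 1" using assms(1) by (simp_all add: xs_def)
      then have "last xs = xs ! (k - 2)" by (simp add: last_conv_nth numeral_2_eq_2)
      then show ?thesis using assms(1) by (simp add: xs_def)
    qed
    finally show ?thesis .
  qed
  moreover have "length xs = k - 1" by (simp add: xs_def)
  ultimately show "inc_drop p (k - 1)" unfolding inc_drop_def by blast
next
  assume "inc_drop p (k - 1)"
  then obtain xs y where xs: "subseq (xs @ [y]) p" "sorted_wrt (<) xs" "length xs = k - 1" "y < last xs"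
    by (auto simp: inc_drop_def)
  have dist: "distinct (xs @ [y])"
  proof -
    obtain N where "xs @ [y] = nths p N" using xs(1) unfolding subseq_conv_nths by blast
    then show ?thesis using distinct_nthsI[OF assms(2)] by (simp only:)
  qed
  define m where "m = length (takeWhile (\<lambda>x. x < y) xs)"
  have ne: "xs \<noteq> []" using xs(3) assms(1) by auto
  have mk: "m < k - 1"
  proof (rule ccontr)
    assume "\<not> m < k - 1"
    moreover have "m \<le> k - 1" unfolding m_def xs(3)[symmetric] by (rule length_takeWhile_le)
    ultimately have "takeWhile (\<lambda>x. x < y) xs = xs"
      using takeWhile_eq_take[of "\<lambda>x. x < y" xs] xs(3) unfolding m_def by simp
    then have "last xs < y" using last_in_set[OF ne] by (simp add: takeWhile_eq_all_conv)
    then show False using xs(4) by simp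
  qed
  have less: "xs ! r < y \<longleftrightarrow> r < m" if "r < k - 1" for r
  proof (cases "r < m")
    case True
    then have "takeWhile (\<lambda>x. x < y) xs ! r = xs ! r" "r < length (takeWhile (\<lambda>x. x < y) xs)"
      by (simp_all add: m_def takeWhile_nth)
    then have "xs ! r \<in> set (takeWhile (\<lambda>x. x < y) xs)" using nth_mem by fastforce
    then have "xs ! r < y" by (auto dest: set_takeWhileD)
    then show ?thesis using True by simp
  next
    case False
    have "\<not> xs ! m < y" using nth_length_takeWhile[of "\<lambda>x. x < y" xs] mk xs(3) by (simp add: m_def)
    moreover have "xs ! m \<le> xs ! r"
      using False that xs(2,3) by (cases "r = m") (auto simp: sorted_wrt_iff_nth_less intro!: less_imp_le)
    ultimately show ?thesis using False by simp
  qed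
  define j where "j = m + 1"
  define q where "q = [1..<j] @ [Suc j..<Suc k] @ [j]"
  have j: "j \<in> {1..<k}" using mk by (simp add: j_def)
  have qA: "q \<in> A_diag k" unfolding A_diag_eq q_def using j by blast
  have lq: "length q = k" using j by (simp add: q_def) arith
  have qr: "q ! r = (if r < m then r + 1 else if r < k - 1 then r + 2 else j)" if rk: "r < k" for r
  proof -
    consider "r < m" | "m \<le> r" "r < k - 1" | "r = k - 1" using rk by linarith
    then show ?thesis
    proof cases
      case 1
      then show ?thesis by (auto simp: q_def nth_append j_def simp del: upt_Suc)
    next
      case 2
      have "[Suc j..<Suc k] ! (r - m) = Suc j + (r - m)" using 2 by (intro nth_upt) (simp add: j_def)
      then show ?thesis using 2 mk by (simp add: q_def nth_append j_def del: upt_Suc)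
    next
      case 3
      have "q = ([1..<j] @ [Suc j..<Suc k]) @ [j]" "length ([1..<j] @ [Suc j..<Suc k]) = k - 1"
        using j by (auto simp: q_def simp del: upt_Suc)
      then have "q ! (k - 1) = j" by (metis nth_append_length)
      then show ?thesis using 3 mk by simp
    qed
  qed
  obtain i where i: "strict_mono_on {..<length (xs @ [y])} i"
    "\<forall>r<length (xs @ [y]). i r < length p \<and> p ! i r = (xs @ [y]) ! r"
    using subseq_imp_index[OF xs(1)] by blast
  have lk: "length (xs @ [y]) = k" using xs(3) assms(1) by simp
  have mono: "xs ! r < xs ! s \<longleftrightarrow> r < s" if "r < k - 1" "s < k - 1" for r s
  proof -
    have "xs ! r < xs ! s" if "r < s" "s < k - 1" for r s
      using xs(2,3) that by (simp add: sorted_wrt_iff_nth_less)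
    from this[of r s] this[of s r] that show ?thesis by (cases r s rule: linorder_cases) auto
  qed
  have "(xs @ [y]) ! r < (xs @ [y]) ! s \<longleftrightarrow> q ! r < q ! s" if rs: "r < k" "s < k" for r s
  proof -
    have xr: "(xs @ [y]) ! r = (if r < k - 1 then xs ! r else y)" if "r < k" for r
      using that xs(3) by (auto simp: nth_append)
    have ney: "xs ! r \<noteq> y" if "r < k - 1" for r using that dist xs(3) nth_mem[of r xs] by auto
    then have gt: "y < xs ! r \<longleftrightarrow> \<not> r < m" if "r < k - 1" for r using less[OF that] ney[OF that] by auto
    consider "r < k - 1" "s < k - 1" | "r < k - 1" "s = k - 1" | "r = k - 1" "s < k - 1"
      | "r = k - 1" "s = k - 1" using rs by linarith
    then show ?thesis
    proof cases
      case 1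
      then show ?thesis unfolding xr[OF rs(1)] xr[OF rs(2)] qr[OF rs(1)] qr[OF rs(2)]
        using mono[OF 1] by simp
    next
      case 2
      then show ?thesis unfolding xr[OF rs(1)] xr[OF rs(2)] qr[OF rs(1)] qr[OF rs(2)]
        using less[OF 2(1)] mk by (simp add: j_def)
    next
      case 3
      then show ?thesis unfolding xr[OF rs(1)] xr[OF rs(2)] qr[OF rs(1)] qr[OF rs(2)]
        using gt[OF 3(2)] mk by (simp add: j_def)
    qed simp
  qed
  then have "contains_pattern p q" unfolding contains_pattern_def lq
    using i lk by (intro exI[of _ i]) simp
  then show "\<exists>q\<in>A_diag k. contains_pattern p q" using qA by blast
qed

lemma Av_A_diag_eq:
  assumes "k \<ge> 2"
  shows "Av n (A_diag k) = {p. set p = {1..n} \<and> distinct p \<and> \<not> inc_drop p (k - 1)}"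
  unfolding Av_def avoids_pattern_def permutations_of_set_def
  using contains_A_diag_iff[OF assms] by blast

lemma inc_subseq_eq_has_inc:
  assumes "set p \<subseteq> {..<n}" shows "inc_subseq n p r \<longleftrightarrow> has_inc p r"
proof -
  have "set xs \<subseteq> {..<n}" if "subseq xs p" for xs using list_emb_set[OF that] assms by (metis subset_iff subsetI)
  then show ?thesis unfolding inc_subseq_def has_inc_def by blast
qed

lemma has_inc_map:
  assumes "strict_mono f" shows "has_inc p r \<Longrightarrow> has_inc (map f p) r"
proof -
  assume "has_inc p r"
  then obtain xs where "subseq xs p" "sorted_wrt (<) xs" "length xs = r" by (auto simp: has_inc_def)
  then have "subseq (map f xs) (map f p)" "sorted_wrt (<) (map f xs)" "length (map f xs) = r"
    using assms by (auto simp: sorted_wrt_map strict_mono_def intro: subseq_map sorted_wrt_mono_rel[rotated])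
  then show ?thesis unfolding has_inc_def by blast
qed

lemma no_inc_drop_split:
  assumes "distinct p" "\<not> inc_drop p (Suc d)"
  shows "\<exists>\<sigma> \<tau>. p = \<sigma> @ \<tau> \<and> \<not> has_inc \<sigma> (Suc d) \<and> sorted_wrt (<) \<tau> \<and>
    (\<forall>t\<in>set \<tau>. \<exists>xs. subseq (xs @ [t]) p \<and> sorted_wrt (<) (xs @ [t]) \<and> length xs = d)"
  using assms
proof (induction p rule: rev_induct)
  case Nil
  have "\<not> has_inc [] (Suc d)" by (auto simp: has_inc_def dest: list_emb_length)
  then show ?case by simp
next
  case (snoc v p)
  have "\<not> inc_drop p (Suc d)" using snoc.prems(2) unfolding inc_drop_def
    by (meson subseq_rev_drop_many)
  then obtain \<sigma> \<tau> where st: "p = \<sigma> @ \<tau>" "\<not> has_inc \<sigma> (Suc d)" "sorted_wrt (<) \<tau>"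
    "\<forall>t\<in>set \<tau>. \<exists>xs. subseq (xs @ [t]) p \<and> sorted_wrt (<) (xs @ [t]) \<and> length xs = d"
    using snoc.IH snoc.prems(1) by auto
  show ?case
  proof (cases "has_inc p (Suc d)")
    case True
    then have ne: "\<tau> \<noteq> []" using st(1,2) by auto
    have lt: "t < v" if t: "t \<in> set \<tau>" for t
    proof -
      obtain xs where xs: "subseq (xs @ [t]) p" "sorted_wrt (<) (xs @ [t])" "length xs = d" using st(4) t by blast
      have "subseq ((xs @ [t]) @ [v]) (p @ [v])" using xs(1) by (rule list_emb_append_mono) simp
      then have "\<not> v < t" using snoc.prems(2) xs unfolding inc_drop_def
        by (metis last_snoc length_append_singleton)
      moreover have "t \<noteq> v" using snoc.prems(1) t st(1) by auto
      ultimately show ?thesis by simp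
    qed
    have new: "\<exists>xs. subseq (xs @ [v]) (p @ [v]) \<and> sorted_wrt (<) (xs @ [v]) \<and> length xs = d"
    proof -
      obtain xs where xs: "subseq (xs @ [last \<tau>]) p" "sorted_wrt (<) (xs @ [last \<tau>])" "length xs = d"
        using st(4) ne last_in_set by blast
      have "subseq xs p" using xs(1) by (meson subseq_order.trans subseq_rev_drop_many subseq_order.refl)
      then have "subseq (xs @ [v]) (p @ [v])" by simp
      moreover have "sorted_wrt (<) (xs @ [v])"
        using xs(2) lt[OF last_in_set[OF ne]] by (auto simp: sorted_wrt_append intro: less_trans)
      ultimately show ?thesis using xs(3) by blast
    qed
    have "\<forall>t\<in>set (\<tau> @ [v]). \<exists>xs. subseq (xs @ [t]) (p @ [v]) \<and> sorted_wrt (<) (xs @ [t]) \<and> length xs = d"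
      using new st(4) subseq_rev_drop_many by (metis Un_iff empty_iff list.set(1) set_ConsD set_append)
    moreover have "sorted_wrt (<) (\<tau> @ [v])" using st(3) lt by (simp add: sorted_wrt_append)
    ultimately show ?thesis using st(1,2) by (intro exI[of _ \<sigma>] exI[of _ "\<tau> @ [v]"]) simp
  next
    case False
    show ?thesis
    proof (cases "has_inc (p @ [v]) (Suc d)")
      case True
      then obtain zs where zs: "subseq zs (p @ [v])" "sorted_wrt (<) zs" "length zs = Suc d"
        by (auto simp: has_inc_def)
      then have "\<not> subseq zs p" using False by (auto simp: has_inc_def)
      then obtain ys where "zs = ys @ [v]" using zs(1) by (auto simp: subseq_snoc_iff)
      then show ?thesis using zs False by (intro exI[of _ p] exI[of _ "[v]"]) auto
    next
      case False
      then show ?thesis by (intro exI[of _ "p @ [v]"] exI[of _ "[]"]) simp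
    qed
  qed
qed

text \<open>A covering suffices. Different prefixes may give the same permutation, for instance when
  the smallest remaining value is appended without creating a long increasing subsequence.\<close>

lemma card_Av_upper:
  assumes "k \<ge> 3"
  shows "card (Av n (A_diag k)) \<le> card (no_inc (k - 2) n)"
proof (rule surj_card_le[OF card_no_inc(1)])
  define g where "g \<sigma> = map Suc \<sigma> @ sorted_list_of_set ({1..n} - set (map Suc \<sigma>))" for \<sigma>
  have kk: "Suc (k - 2) = k - 1" using assms by simp
  show "Av n (A_diag k) \<subseteq> g ` no_inc (k - 2) n"
  proof
    fix p assume "p \<in> Av n (A_diag k)"
    then have p: "set p = {1..n}" "distinct p" "\<not> inc_drop p (Suc (k - 2))"
      using assms kk by (simp_all add: Av_A_diag_eq)
    obtain \<sigma> \<tau> where st: "p = \<sigma> @ \<tau>" "\<not> has_inc \<sigma> (Suc (k - 2))" "sorted_wrt (<) \<tau>"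
      using no_inc_drop_split[OF p(2,3)] by blast
    define \<sigma>' where "\<sigma>' = map (\<lambda>x. x - 1) \<sigma>"
    have sub: "set \<sigma> \<subseteq> {1..n}" using p(1) st(1) by auto
    then have s: "map Suc \<sigma>' = \<sigma>" by (auto simp: \<sigma>'_def intro!: map_idI)
    have "\<sigma>' \<in> no_inc (k - 2) n"
    proof -
      have "distinct (map Suc \<sigma>')" unfolding s using p(2) st(1) by simp
      then have "distinct \<sigma>'" by (simp add: distinct_map)
      moreover have "x - 1 < n" if "x \<in> set \<sigma>" for x using subsetD[OF sub that] by auto
      then have sb: "set \<sigma>' \<subseteq> {..<n}" by (auto simp: \<sigma>'_def)
      moreover have "\<not> has_inc \<sigma>' (Suc (k - 2))"
        using has_inc_map[of Suc \<sigma>'] st(2) s by (auto simp: strict_mono_def)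
      ultimately show ?thesis using inc_subseq_eq_has_inc[OF sb] by (simp add: no_inc_def)
    qed
    moreover have "p = g \<sigma>'"
    proof -
      have "set \<tau> = {1..n} - set \<sigma>" using p(1,2) st(1) by auto
      moreover have "sorted_list_of_set (set \<tau>) = \<tau>"
        using st(3) by (simp add: sorted_list_of_set.idem_if_sorted_distinct strict_sorted_iff)
      ultimately show ?thesis unfolding g_def s st(1) by simp
    qed
    ultimately show "p \<in> g ` no_inc (k - 2) n" by blast
  qed
qed

lemma sorted_wrt_subseq_pair: "subseq [a, b] ys \<Longrightarrow> sorted_wrt R ys \<Longrightarrow> R a b"
  by (induction ys) (auto simp: subseq_singleton_left split: if_splits)

text \<open>The shift by 2 leaves out the value 1, which then opens the sorted tail; cutting there
  inverts the map. A drop with at most one entry in the tail would have its whole increasing part in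
  the prefix; with more, its last two entries lie in the sorted tail and cannot descend.\<close>

lemma card_Av_lower:
  assumes "k \<ge> 3" "n \<ge> 1"
  shows "card (no_inc (k - 2) (n - 1)) \<le> card (Av n (A_diag k))"
proof (rule card_inj_on_le)
  define Q where "Q q = map (\<lambda>x. x + 2) q" for q :: "nat list"
  define S where "S q = sorted_list_of_set ({1..n} - set (Q q))" for q
  define g where "g q = Q q @ S q" for q
  have kk: "Suc (k - 2) = k - 1" using assms by simp
  have S: "sorted_wrt (<) (S q)" "set (S q) = {1..n} - set (Q q)" "distinct (S q)" for q
    by (simp_all add: S_def)
  show "inj_on g (no_inc (k - 2) (n - 1))"
  proof (rule inj_on_inverseI[of _ "\<lambda>p. map (\<lambda>x. x - 2) (takeWhile (\<lambda>x. x \<noteq> 1) p)"])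
    fix q
    have "1 \<in> set (S q)" using S(2) assms(2) by (auto simp: Q_def)
    then obtain s ss where ss: "S q = s # ss" by (cases "S q") auto
    have "s \<le> 1" using S(1)[of q] \<open>1 \<in> set (S q)\<close> unfolding ss by auto
    moreover have "s \<in> {1..n}" using S(2)[of q] unfolding ss by auto
    ultimately have "takeWhile (\<lambda>x. x \<noteq> 1) (S q) = []" unfolding ss by simp
    moreover have "takeWhile (\<lambda>x. x \<noteq> 1) (Q q @ S q) = Q q @ takeWhile (\<lambda>x. x \<noteq> 1) (S q)"
      by (rule takeWhile_append2) (auto simp: Q_def)
    ultimately show "map (\<lambda>x. x - 2) (takeWhile (\<lambda>x. x \<noteq> 1) (g q)) = q"
      by (simp add: g_def Q_def o_def)
  qed
  show "g ` no_inc (k - 2) (n - 1) \<subseteq> Av n (A_diag k)"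
  proof
    fix p assume "p \<in> g ` no_inc (k - 2) (n - 1)"
    then obtain q where q: "p = Q q @ S q" "q \<in> no_inc (k - 2) (n - 1)" by (auto simp: g_def)
    then have q': "distinct q" "set q \<subseteq> {..<n - 1}" "\<not> has_inc q (Suc (k - 2))"
      using inc_subseq_eq_has_inc by (auto simp: no_inc_def)
    have Qs: "set (Q q) \<subseteq> {1..n}" using q'(2) by (auto simp: Q_def)
    have Qd: "distinct (Q q)" using q'(1) by (simp add: Q_def distinct_map inj_on_def)
    have "map (\<lambda>x. x - 2) (Q q) = q" by (simp add: Q_def o_def)
    have Qi: "\<not> has_inc (Q q) (Suc (k - 2))"
    proof
      assume "has_inc (Q q) (Suc (k - 2))"
      then obtain xs where xs: "subseq xs (Q q)" "sorted_wrt (<) xs" "length xs = Suc (k - 2)"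
        by (auto simp: has_inc_def)
      have ge2: "2 \<le> x" if xm: "x \<in> set xs" for x
      proof -
        obtain y where "y \<in> set (Q q)" "x = y" using list_emb_set[OF xs(1) xm] by blast
        then show ?thesis by (auto simp: Q_def)
      qed
      have "sorted_wrt (<) (map (\<lambda>x. x - 2) xs)" unfolding sorted_wrt_map
        by (rule sorted_wrt_mono_rel[OF _ xs(2)]) (use ge2 in \<open>simp add: diff_less_mono\<close>)
      moreover have "subseq (map (\<lambda>x. x - 2) xs) q"
        using subseq_map[OF xs(1), of "\<lambda>x. x - 2"] \<open>map (\<lambda>x. x - 2) (Q q) = q\<close> by simp
      ultimately show False using q'(3) xs(3) by (auto simp: has_inc_def)
    qed
    have "\<not> inc_drop p (Suc (k - 2))"
    proof
      assume "inc_drop p (Suc (k - 2))"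
      then obtain xs y where xs: "subseq (xs @ [y]) (Q q @ S q)" "sorted_wrt (<) xs" "length xs = Suc (k - 2)" "y < last xs"
        unfolding q(1) inc_drop_def by blast
      obtain a b where ab: "xs @ [y] = a @ b" "subseq a (Q q)" "subseq b (S q)"
        using xs(1) by (auto simp: subseq_append_iff)
      show False
      proof (cases "length b \<le> 1")
        case True
        then obtain c where c: "a = xs @ c" using ab(1) by (cases b rule: rev_cases) auto
        have "subseq xs (xs @ c)" by (rule subseq_rev_drop_many) simp
        then have "subseq xs (Q q)" using ab(2) unfolding c by (rule subseq_order.trans)
        then show False using Qi xs(2,3) by (auto simp: has_inc_def)
      next
        case False
        then obtain b' where b': "b = b' @ [y]" "b' \<noteq> []" "xs = a @ b'"
          using ab(1) by (cases b rule: rev_cases) auto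
        then obtain c z where c: "b' = c @ [z]" by (cases b' rule: rev_cases) auto
        have "subseq [z, y] b" unfolding b'(1) c by (simp add: subseq_drop_many)
        then have "subseq [z, y] (S q)" using ab(3) by (rule subseq_order.trans)
        then have "z < y" by (rule sorted_wrt_subseq_pair[OF _ S(1)])
        then show False using xs(4) b'(3) c by simp
      qed
    qed
    moreover have "set p = {1..n}" "distinct p" using q(1) Qs Qd S by auto
    ultimately show "p \<in> Av n (A_diag k)"
      using assms kk by (simp add: Av_A_diag_eq)
  qed
  show "finite (Av n (A_diag k))"
    by (rule finite_subset[of _ "permutations_of_set {1..n}"]) (auto simp: Av_def)
qed

theorem theorem11:
  fixes k :: nat
  assumes "k \<ge> 3"
  shows "\<exists>c C :: real. c > 0 \<and> C > 0 \<and>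
    (\<forall>n :: nat. n \<ge> 1 \<longrightarrow>
       c * (((real k - 2)^2 + 1) ^ n / real n powr (((real k)^2 - 4 * real k + 3) / 2))
         \<le> real (card (Av n (A_diag k))) \<and>
       real (card (Av n (A_diag k)))
         \<le> C * (((real k - 2)^2 + 1) ^ n / real n powr (((real k)^2 - 4 * real k + 3) / 2)))"
proof -
  define d where "d = k - 2"
  define x where "x = real d ^ 2 + 1"
  define E where "E = (real d ^ 2 - 1) / 2"
  have d: "d \<ge> 1" "real k - 2 = real d" using assms by (simp_all add: d_def of_nat_diff)
  have E_eq: "((real k)^2 - 4 * real k + 3) / 2 = E"
    unfolding E_def d(2)[symmetric] by (simp add: power2_eq_square algebra_simps)
  have x: "x > 0" by (simp add: x_def add_nonneg_pos)
  have "1 ^ 2 \<le> real d ^ 2" using d(1) by (intro power_mono) simp_all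
  then have E: "E \<ge> 0" by (simp add: E_def)
  obtain c C where c: "c > 0" "\<And>n. c * (x ^ n * real (n + 1) powr (- E)) \<le> real (card (no_inc d n))"
    and C: "C > 0" "\<And>n. real (card (no_inc d n)) \<le> C * (x ^ n * real (n + 1) powr (- E))"
    using card_no_inc_bounds[OF d(1)] unfolding x_def[symmetric] E_def[symmetric] by blast
  \<comment> \<open>The lower bound uses sequences over \<open>n - 1\<close> values; the missing
    factor of the base \<open>x\<close> goes into the constant, and \<open>n - 1 + 1 = n\<close>
    gives the exact power.\<close>
  have "c / x * (x ^ n / real n powr E) \<le> real (card (Av n (A_diag k))) \<and>
      real (card (Av n (A_diag k))) \<le> C * (x ^ n / real n powr E)" if n: "n \<ge> 1" for n
  proof
    have "c / x * (x ^ n / real n powr E) = c * (x ^ (n - 1) * real (n - 1 + 1) powr (- E))"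
      using n x by (cases n) (simp_all add: powr_minus_divide)
    also have "\<dots> \<le> real (card (no_inc d (n - 1)))" by (rule c(2))
    also have "\<dots> \<le> real (card (Av n (A_diag k)))" using card_Av_lower[OF assms n] by (simp add: d_def)
    finally show "c / x * (x ^ n / real n powr E) \<le> real (card (Av n (A_diag k)))" .
    have "real (card (Av n (A_diag k))) \<le> real (card (no_inc d n))"
      using card_Av_upper[OF assms] by (simp add: d_def)
    also have "\<dots> \<le> C * (x ^ n * real (n + 1) powr (- E))" by (rule C(2))
    also have "\<dots> \<le> C * (x ^ n * real n powr (- E))"
      using C(1) x n E by (intro mult_left_mono powr_mono2') auto
    also have "\<dots> = C * (x ^ n / real n powr E)" by (simp add: powr_minus_divide)
    finally show "real (card (Av n (A_diag k))) \<le> C * (x ^ n / real n powr E)" .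
  qed
  then show ?thesis unfolding d(2) x_def[symmetric] E_eq using c(1) C(1) x
    by (intro exI[of _ "c / x"] exI[of _ C]) simp
qed

end
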